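(* Let $\phi$ be a nonnegative, radially decreasing, weakly singular kernel on $\mathbb{R}$ satisfying, for some $s\in(0,1)$, $\Lambda>0$ and $R_0>0$, $$\phi(x)\le\Lambda|x|^{-s},\qquad 0<|x|<R_0,$$ and set $\varphi(x)=\int_0^x\phi(y)\,dy$. Let $\Omega=\bigcup_{j=0}^J(\ell_j,r_j)\subset\mathbb{R}$ be a finite union of disjoint bounded open intervals with $r_{j-1}<\ell_j$ for each $j\in\{1,\dots,J\}$. Let $k\ge1$ be an integer, and let $\rho_0\in H^k(\mathbb{R})$ with $\rho_0>0$ on $\Omega$ and $\rho_0=0$ outside $\Omega$. Let $u_0:\Omega\to\mathbb{R}$ be such that $\psi_0:=u_0+\varphi*\rho_0\in H^{k+1}(\Omega)$ and $\psi_0$ is strictly increasing on $\overline\Omega$. Then there exists a global-in-time solution $(\rho,u)$, associated to the initial data $(\rho_0,u_0)$, of the one-dimensional Euler Alignment model (without vacuum velocity, with coupling strength $\kappa=1$) under either of the following assumptions: (1) $\inf_\Omega\psi_0'>0$; or (2) $s\in(0,\tfrac12)$, and there exist $\mu\in\left(1,\tfrac{1-s}{s}\right)$, $c>0$ and $R_1\in(0,R_0)$ such that $$\psi_0(\beta)-\psi_0(\alpha)\ge c(\beta-\alpha)^\mu\qquad\text{for all }\alpha,\beta\in\Omega\text{ with }0\le\beta-\alpha<R_1 .$$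
   Context: Radially decreasing means that $\phi(x)$ depends only on $|x|$ and is nonincreasing in $|x|$. Weakly singular means that $\phi$ is locally integrable with a singularity at the origin like $|x|^{-s}$ for some $s\in(0,1)$. $H^k$ denotes the $L^2$-based Sobolev space, and $(\varphi*\rho_0)(\alpha)=\int_\Omega\varphi(\alpha-\gamma)\rho_0(\gamma)\,d\gamma$. The values of $\psi_0$ on $\overline\Omega$ are those of its continuous extension from $\Omega$. Euler Alignment model without vacuum velocity (1D, $\kappa=1$): for $t\ge0$ and $x\in\Omega(t)=\{x:\rho(x,t)>0\}$, with $\Omega(0)=\Omega$, $$\partial_t\rho+\partial_x(\rho u)=0,\qquad \partial_t u+u\,\partial_x u=\int_{\Omega(t)}\phi(x-y)\,(u(y,t)-u(x,t))\,\rho(y,t)\,dy,$$ with $\rho(\cdot,0)=\rho_0$, $u(\cdot,0)=u_0$; the velocity is defined only in $\Omega(t)$, and $\Omega(t)=X(\Omega,t)$, where $X$ is the flow map $\dot X(\alpha,t)=u(X(\alpha,t),t)$, $X(\alpha,0)=\alpha$. In Lagrangian variables, with $dm_\gamma=\rho_0(\gamma)\,d\gamma$, the system is equivalently $$\dot X(\alpha,t)=\psi_0(\alpha)-\int_\Omega\varphi(X(\alpha,t)-X(\gamma,t))\,dm_\gamma,\qquad X(\alpha,0)=\alpha,\qquad\alpha\in\Omega .$$ A global-in-time solution is one defined for all $t\in[0,\infty)$, with $X(\cdot,t):\Omega\to\Omega(t)$ bijective and $\partial_\alpha X(\cdot,t)>0$ for all $t\ge0$, and with $$\rho(x,t)=\frac{\rho_0(X^{-1}(x,t))}{\partial_\alpha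 X(X^{-1}(x,t),t)},\qquad u(x,t)=\dot X(X^{-1}(x,t),t),\qquad x\in\Omega(t).$$ *)

theory Defs
  imports "HOL-Analysis.Analysis" "HOL-Library.Landau_Symbols"
begin

section \<open>Sobolev spaces on open subsets of the line\<close>

definition test_function :: "real set \<Rightarrow> (real \<Rightarrow> real) \<Rightarrow> bool" where
  "test_function S \<eta> \<longleftrightarrow>
     (\<forall>n x. (deriv ^^ n) \<eta> differentiable (at x)) \<and>
     (\<exists>K. compact K \<and> K \<subseteq> S \<and> (\<forall>x. x \<notin> K \<longrightarrow> \<eta> x = 0))"

definition square_integrable_on :: "real set \<Rightarrow> (real \<Rightarrow> real) \<Rightarrow> bool" where
  "square_integrable_on S f \<longleftrightarrow>
     set_borel_measurable lebesgue S f \<and> set_integrable lebesgue S (\<lambda>x. (f x)\<^sup>2)"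

definition weak_derivative ::
    "nat \<Rightarrow> real set \<Rightarrow> (real \<Rightarrow> real) \<Rightarrow> (real \<Rightarrow> real) \<Rightarrow> bool" where
  "weak_derivative n S f g \<longleftrightarrow>
     (\<forall>\<eta>. test_function S \<eta> \<longrightarrow>
        (LINT x:S|lebesgue. f x * (deriv ^^ n) \<eta> x) =
        (- 1) ^ n * (LINT x:S|lebesgue. g x * \<eta> x))"

definition sobolev_H :: "nat \<Rightarrow> real set \<Rightarrow> (real \<Rightarrow> real) \<Rightarrow> bool" where
  "sobolev_H k S f \<longleftrightarrow>
     square_integrable_on S f \<and>
     (\<forall>n\<in>{1..k}. \<exists>g. square_integrable_on S g \<and> weak_derivative n S f g)"

section \<open>Kernels\<close>

text \<open>A singular kernel has no finite value at the origin, so the value \<open>\<phi> 0\<close> of the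
  total function representing it is left unconstrained throughout. It never matters, since
  \<open>\<phi>\<close> only enters through integrals.\<close>

definition nonnegative_kernel :: "(real \<Rightarrow> real) \<Rightarrow> bool" where
  "nonnegative_kernel \<phi> \<longleftrightarrow> (\<forall>x. x \<noteq> 0 \<longrightarrow> 0 \<le> \<phi> x)"

definition radially_decreasing :: "(real \<Rightarrow> real) \<Rightarrow> bool" where
  "radially_decreasing \<phi> \<longleftrightarrow>
     (\<forall>x y. \<bar>x\<bar> = \<bar>y\<bar> \<longrightarrow> \<phi> x = \<phi> y) \<and>
     (\<forall>x y. 0 < \<bar>x\<bar> \<and> \<bar>x\<bar> \<le> \<bar>y\<bar> \<longrightarrow> \<phi> y \<le> \<phi> x)"

definition weakly_singular :: "(real \<Rightarrow> real) \<Rightarrow> bool" where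
  "weakly_singular \<phi> \<longleftrightarrow>
     (\<forall>a b. set_integrable lborel {a..b} \<phi>) \<and>
     (\<exists>s. 0 < s \<and> s < 1 \<and> \<phi> \<in> \<Theta>[at 0](\<lambda>x. \<bar>x\<bar> powr (- s)))"

definition kernel_primitive :: "(real \<Rightarrow> real) \<Rightarrow> real \<Rightarrow> real" where
  "kernel_primitive \<phi> x = (LBINT y=0..x. \<phi> y)"

text \<open>The quantity \<open>\<psi>\<^sub>0 = u\<^sub>0 + \<Phi> * \<rho>\<^sub>0\<close>, with \<open>\<Phi>\<close> the primitive of the kernel.
  As for the initial velocity, only its values on \<open>\<Omega>\<close> are meaningful.\<close>

definition psi_init ::
    "(real \<Rightarrow> real) \<Rightarrow> real set \<Rightarrow> (real \<Rightarrow> real) \<Rightarrow> (real \<Rightarrow> real) \<Rightarrow> real \<Rightarrow> real" where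
  "psi_init \<phi> \<Omega> \<rho>\<^sub>0 u\<^sub>0 \<alpha> =
     u\<^sub>0 \<alpha> + (LBINT \<gamma>:\<Omega>. kernel_primitive \<phi> (\<alpha> - \<gamma>) * \<rho>\<^sub>0 \<gamma>)"

section \<open>The Euler Alignment model without vacuum velocity\<close>

text \<open>Space-time fields are written in the order \<open>\<rho> x t\<close>, \<open>u x t\<close>, and the flow map as
  \<open>X \<alpha> t\<close>. Time derivatives at \<open>t = 0\<close> are one-sided.\<close>

definition fluid_domain :: "(real \<Rightarrow> real \<Rightarrow> real) \<Rightarrow> real \<Rightarrow> real set" where
  "fluid_domain \<rho> t = {x. 0 < \<rho> x t}"

text \<open>The density is in general only of class \<open>H\<^sup>1\<close> in space, hence not differentiable at every
  point, so the continuity equation is understood in the sense of distributions in \<open>x\<close>, at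
  every time. The values of \<open>u\<close> in the vacuum are multiplied by \<open>\<rho> = 0\<close>.\<close>

definition continuity_equation ::
    "(real \<Rightarrow> real \<Rightarrow> real) \<Rightarrow> (real \<Rightarrow> real \<Rightarrow> real) \<Rightarrow> bool" where
  "continuity_equation \<rho> u \<longleftrightarrow>
     (\<forall>t\<ge>0. integrable lborel (\<lambda>x. \<rho> x t) \<and> integrable lborel (\<lambda>x. \<rho> x t * u x t)) \<and>
     (\<forall>\<eta>. test_function UNIV \<eta> \<longrightarrow>
        (\<forall>t\<ge>0. ((\<lambda>\<tau>. LBINT x. \<rho> x \<tau> * \<eta> x) has_real_derivative
                  (LBINT x. \<rho> x t * u x t * deriv \<eta> x)) (at t within {0..})))"

definition velocity_equation ::
    "(real \<Rightarrow> real) \<Rightarrow> (real \<Rightarrow> real \<Rightarrow> real) \<Rightarrow> (real \<Rightarrow> real \<Rightarrow> real) \<Rightarrow> bool" where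
  "velocity_equation \<phi> \<rho> u \<longleftrightarrow>
     (\<forall>t\<ge>0. \<forall>x\<in>fluid_domain \<rho> t.
        set_integrable lborel (fluid_domain \<rho> t) (\<lambda>y. \<phi> (x - y) * (u y t - u x t) * \<rho> y t) \<and>
        (\<exists>u\<^sub>t u\<^sub>x.
           ((\<lambda>\<tau>. u x \<tau>) has_real_derivative u\<^sub>t) (at t within {0..}) \<and>
           ((\<lambda>y. u y t) has_real_derivative u\<^sub>x) (at x) \<and>
           u\<^sub>t + u x t * u\<^sub>x =
             (LBINT y:fluid_domain \<rho> t. \<phi> (x - y) * (u y t - u x t) * \<rho> y t)))"

definition lagrangian_equation ::
    "(real \<Rightarrow> real) \<Rightarrow> real set \<Rightarrow> (real \<Rightarrow> real) \<Rightarrow> (real \<Rightarrow> real) \<Rightarrow>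
     (real \<Rightarrow> real \<Rightarrow> real) \<Rightarrow> bool" where
  "lagrangian_equation \<phi> \<Omega> \<rho>\<^sub>0 u\<^sub>0 X \<longleftrightarrow>
     (\<forall>\<alpha>\<in>\<Omega>. X \<alpha> 0 = \<alpha>) \<and>
     (\<forall>\<alpha>\<in>\<Omega>. \<forall>t\<ge>0.
        set_integrable lborel \<Omega> (\<lambda>\<gamma>. kernel_primitive \<phi> (X \<alpha> t - X \<gamma> t) * \<rho>\<^sub>0 \<gamma>) \<and>
        (X \<alpha> has_real_derivative
           (psi_init \<phi> \<Omega> \<rho>\<^sub>0 u\<^sub>0 \<alpha> -
            (LBINT \<gamma>:\<Omega>. kernel_primitive \<phi> (X \<alpha> t - X \<gamma> t) * \<rho>\<^sub>0 \<gamma>)))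
          (at t within {0..}))"

text \<open>The formulas \<open>\<rho> = (\<rho>\<^sub>0 / \<partial>\<^sub>\<alpha>X) \<circ> X\<^sup>-\<^sup>1\<close> and \<open>u = X' \<circ> X\<^sup>-\<^sup>1\<close> on the fluid domain are stated at
  the points \<open>x = X \<alpha> t\<close>, which exhaust it because \<open>X\<close> is bijective; for \<open>u\<close> this is the
  flow map equation.\<close>

definition global_solution ::
    "(real \<Rightarrow> real) \<Rightarrow> real set \<Rightarrow> (real \<Rightarrow> real) \<Rightarrow> (real \<Rightarrow> real) \<Rightarrow>
     (real \<Rightarrow> real \<Rightarrow> real) \<Rightarrow> (real \<Rightarrow> real \<Rightarrow> real) \<Rightarrow> bool" where
  "global_solution \<phi> \<Omega> \<rho>\<^sub>0 u\<^sub>0 \<rho> u \<longleftrightarrow>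
     (\<forall>x. \<rho> x 0 = \<rho>\<^sub>0 x) \<and> (\<forall>x\<in>\<Omega>. u x 0 = u\<^sub>0 x) \<and>
     (\<forall>t\<ge>0. \<forall>x. 0 \<le> \<rho> x t) \<and>
     continuity_equation \<rho> u \<and> velocity_equation \<phi> \<rho> u \<and>
     (\<exists>X. lagrangian_equation \<phi> \<Omega> \<rho>\<^sub>0 u\<^sub>0 X \<and>
        (\<forall>t\<ge>0. bij_betw (\<lambda>\<alpha>. X \<alpha> t) \<Omega> (fluid_domain \<rho> t) \<and>
           (\<forall>\<alpha>\<in>\<Omega>.
              (\<lambda>a. X a t) differentiable (at \<alpha>) \<and> 0 < deriv (\<lambda>a. X a t) \<alpha> \<and>
              (X \<alpha> has_real_derivative u (X \<alpha> t) t) (at t within {0..}) \<and>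
              \<rho> (X \<alpha> t) t = \<rho>\<^sub>0 \<alpha> / deriv (\<lambda>a. X a t) \<alpha>)))"

end

theory Submission imports Defs begin

text \<open>The right-hand side of the Lagrangian equation is only Hoelder continuous, because the primitive
  \<open>\<Phi>\<close> of the kernel is. It becomes Lipschitz in the sup norm on the set of configurations with
  \<open>X \<beta> - X \<alpha> \<ge> a (\<beta> - \<alpha>)\<^sup>p\<close> for all \<open>\<alpha> < \<beta>\<close>, provided \<open>p s < 1\<close>, since then \<open>\<phi> (X \<alpha> - X \<gamma>)\<close>
  is dominated by the integrable kernel \<open>\<bar>\<alpha> - \<gamma>\<bar>\<close> to the power \<open>- p s\<close>. This set is closed and convex,
  and for small \<open>a\<close> a short explicit Euler step maps it into itself: at the critical distance the
  increment of \<open>\<psi>\<^sub>0\<close> beats that of the alignment force. Here \<open>p = 1\<close> under the first assumption and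
  \<open>p = \<mu> / (1 - s)\<close> under the second. Picard iteration inside the set therefore converges for all times.
  Distances \<open>D\<close> of trajectories solve a linear equation \<open>D' = \<Delta>\<psi>\<^sub>0 - q D\<close> with bounded \<open>q\<close>, which
  gives the derivative of \<open>X\<close> in the label together with a positive lower bound. The Eulerian
  equations follow by differentiating under the integral along the flow.\<close>

section \<open>Differentiation under the integral sign\<close>

text \<open>Origin of the exponent: let two labels at distance \<delta> have critical distance
  \<open>D = a * \<delta> powr p\<close>. If \<mu> > 1, the Hoelder bound for \<Phi> makes the force
  increment of order \<open>D powr (1 - s)\<close>, that is
  \<open>a powr (1 - s) * \<delta> powr (p * (1 - s))\<close>. Matching this with the growth
  \<open>c * \<delta> powr \<mu>\<close> gives \<open>p = \<mu> / (1 - s)\<close>, and then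
  \<open>p * s < 1\<close> says exactly \<mu> < (1 - s) / s. For \<mu> = 1 this choice would demand
  s < 1/2. There p = 1 is taken together with the Lipschitz bound \<open>K * D\<close>: K is of
  order \<open>a powr (- s)\<close>, so \<open>K * D\<close> is of order
  \<open>a powr (1 - s) * \<delta>\<close>. In both cases the surviving power of a is positive, so a
  small a suffices.

  The iteration lives on configurations without any regularity in the label. Since the kernel is
  singular and may jump, every later derivative rests on an almost everywhere derivative and a
  domination tied to one base point.

  The hypotheses offer only weak derivatives of \<psi>, whereas the velocity equation needs a
  classical one at every point of \<Omega>. It is recovered from the weak second derivative, which
  is why smooth test functions have to be built.\<close>

text \<open>Dominated convergence along sequences. The domination compares only with the base point
  x, because the Lipschitz weight of the kernel primitive depends on its base point and blows up at
  the origin. The set T allows one-sided derivatives at time 0.\<close>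

lemma has_real_derivative_integral:
  fixes f :: "real \<Rightarrow> 'a \<Rightarrow> real"
  assumes "x \<in> T"
    and int: "\<And>y. y \<in> T \<Longrightarrow> integrable M (f y)"
    and der: "AE w in M. ((\<lambda>y. f y w) has_real_derivative f' w) (at x within T)"
    and bound: "\<And>y. y \<in> T \<Longrightarrow> AE w in M. \<bar>f y w - f x w\<bar> \<le> \<bar>y - x\<bar> * g w"
    and g: "integrable M g" and f': "f' \<in> borel_measurable M"
  shows "((\<lambda>y. \<integral>w. f y w \<partial>M) has_real_derivative (\<integral>w. f' w \<partial>M)) (at x within T)"
  unfolding has_field_derivative_iff tendsto_at_iff_sequentially comp_def
proof (intro allI impI)
  fix X :: "nat \<Rightarrow> real"
  assume XT: "\<forall>i. X i \<in> T - {x}" and X: "X \<longlonglongrightarrow> x"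
  have "(\<lambda>i. \<integral>w. (f (X i) w - f x w) / (X i - x) \<partial>M) \<longlonglongrightarrow> (\<integral>w. f' w \<partial>M)"
  proof (rule integral_dominated_convergence[where w = g])
    show "(\<lambda>w. (f (X i) w - f x w) / (X i - x)) \<in> borel_measurable M" for i
      using int[of x] int[of "X i"] XT assms(1) by (intro borel_measurable_divide borel_measurable_diff) auto
    show "AE w in M. (\<lambda>i. (f (X i) w - f x w) / (X i - x)) \<longlonglongrightarrow> f' w"
      using der
      by (rule AE_mp) (use X XT in \<open>auto simp: has_field_derivative_iff tendsto_at_iff_sequentially comp_def\<close>)
    show "AE w in M. norm ((f (X i) w - f x w) / (X i - x)) \<le> g w" for i
      using bound[of "X i"] XT by (auto simp: divide_le_eq mult.commute intro: AE_mp)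
  qed (use g f' in auto)
  moreover have "(\<integral>w. (f (X i) w - f x w) / (X i - x) \<partial>M) =
      ((\<integral>w. f (X i) w \<partial>M) - (\<integral>w. f x w \<partial>M)) / (X i - x)" for i
    using int[of x] int[of "X i"] XT assms(1) by (subst integral_divide_zero) (auto simp: Bochner_Integration.integral_diff)
  ultimately show "(\<lambda>i. ((\<integral>w. f (X i) w \<partial>M) - (\<integral>w. f x w \<partial>M)) / (X i - x)) \<longlonglongrightarrow> (\<integral>w. f' w \<partial>M)"
    by (simp only:)
qed

section \<open>Smooth bumps and weak second derivatives\<close>

text \<open>The classical flat function exp(-1/x) with a polynomial factor in 1/x, so that all its
  derivatives keep one shape.\<close>

definition flat_exp :: "real poly \<Rightarrow> real \<Rightarrow> real" where
  "flat_exp p x = (if 0 < x then poly p (1 / x) * exp (- (1 / x)) else 0)"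

lemma poly_times_exp_minus_tendsto_0:
  fixes p :: "real poly"
  shows "((\<lambda>x. poly p x * exp (- x)) \<longlongrightarrow> 0) at_top"
proof -
  have "((\<lambda>x::real. \<Sum>i\<le>degree p. coeff p i * (x ^ i / exp x)) \<longlongrightarrow> (\<Sum>i\<le>degree p. coeff p i * 0)) at_top"
    by (intro tendsto_intros tendsto_power_div_exp_0)
  then show ?thesis
    by (simp add: poly_altdef sum_divide_distrib exp_minus divide_inverse sum_distrib_right mult.assoc)
qed

lemma flat_exp_tendsto_0: "(flat_exp p \<longlongrightarrow> 0) (at 0)"
proof -
  have "((\<lambda>x. poly p (1 / x) * exp (- (1 / x))) \<longlongrightarrow> 0) (at_right 0)"
    using filterlim_compose[OF poly_times_exp_minus_tendsto_0[of p] filterlim_inverse_at_top_right]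
    by (simp add: divide_inverse)
  then have "(flat_exp p \<longlongrightarrow> 0) (at_right 0)"
    by (rule Lim_transform_eventually)
      (auto simp: flat_exp_def eventually_at_right_less intro: eventually_mono[OF eventually_at_right_less])
  moreover have "(flat_exp p \<longlongrightarrow> 0) (at_left 0)"
    by (rule tendsto_eventually)
      (auto simp: flat_exp_def eventually_at_filter)
  ultimately show ?thesis
    by (simp add: filterlim_split_at)
qed

text \<open>With y = 1/x, differentiation in x is -y^2 d/dy and sends p(y) e^(-y) to y^2 (p - p')(y)
  e^(-y); the two \<open>pCons 0\<close> multiply by y^2. At the origin the difference quotient is
  itself a \<open>flat_exp\<close>, with polynomial y p(y), and tends to 0.\<close>

lemma has_real_derivative_flat_exp:
  "(flat_exp p has_real_derivative flat_exp (pCons 0 (pCons 0 (p - pderiv p))) x) (at x)"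
proof -
  consider "x < 0" | "x > 0" | "x = 0" by linarith
  then show ?thesis
  proof cases
    case 1
    have "((\<lambda>x. 0) has_real_derivative 0) (at x)" by simp
    then have "(flat_exp p has_real_derivative 0) (at x)"
      by (rule has_field_derivative_transform_within_open[of _ _ _ "{..<0}"])
        (use 1 in \<open>auto simp: flat_exp_def\<close>)
    then show ?thesis using 1 by (simp add: flat_exp_def)
  next
    case 2
    have "((\<lambda>x. poly p (1 / x) * exp (- (1 / x))) has_real_derivative
        flat_exp (pCons 0 (pCons 0 (p - pderiv p))) x) (at x)"
      using 2 by (auto intro!: derivative_eq_intros DERIV_chain2[OF poly_DERIV]
        simp: flat_exp_def power2_eq_square field_simps)
    then show ?thesis
      by (rule has_field_derivative_transform_within_open[of _ _ _ "{0<..}"])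
        (use 2 in \<open>auto simp: flat_exp_def\<close>)
  next
    case 3
    have "(\<lambda>y. (flat_exp p y - flat_exp p 0) / (y - 0)) = flat_exp (pCons 0 p)"
      by (auto simp: flat_exp_def)
    then show ?thesis
      using flat_exp_tendsto_0[of "pCons 0 p"] 3
      by (simp add: has_field_derivative_iff) (simp add: flat_exp_def)
  qed
qed

text \<open>Smoothness in \<open>test_function\<close> is phrased by iterating \<open>deriv\<close>.
  A class of functions closed under differentiation yields all orders by one induction; the rules
  are those needed for linear combinations of rescaled bumps.\<close>

inductive_set flat_algebra :: "(real \<Rightarrow> real) set" where
  flat: "(\<lambda>x. flat_exp p (c * x + d)) \<in> flat_algebra"
| add: "f \<in> flat_algebra \<Longrightarrow> g \<in> flat_algebra \<Longrightarrow> (\<lambda>x. f x + g x) \<in> flat_algebra"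
| mult: "f \<in> flat_algebra \<Longrightarrow> g \<in> flat_algebra \<Longrightarrow> (\<lambda>x. f x * g x) \<in> flat_algebra"
| scale: "f \<in> flat_algebra \<Longrightarrow> (\<lambda>x. c * f x) \<in> flat_algebra"

lemma flat_algebra_deriv:
  assumes "f \<in> flat_algebra"
  shows "\<exists>f'\<in>flat_algebra. \<forall>x. (f has_real_derivative f' x) (at x)"
  using assms
proof induction
  case (flat p c d)
  show ?case
  proof (intro bexI[of _ "\<lambda>x. c * flat_exp (pCons 0 (pCons 0 (p - pderiv p))) (c * x + d)"] allI)
    show "((\<lambda>x. flat_exp p (c * x + d)) has_real_derivative
        c * flat_exp (pCons 0 (pCons 0 (p - pderiv p))) (c * x + d)) (at x)" for x
      by (rule DERIV_cong[OF DERIV_chain2[OF has_real_derivative_flat_exp]])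
        (auto intro!: derivative_eq_intros)
  qed (rule flat_algebra.scale[OF flat_algebra.flat])
next
  case (add f g)
  then obtain f' g' where "f' \<in> flat_algebra" "g' \<in> flat_algebra"
    "\<And>x. (f has_real_derivative f' x) (at x)" "\<And>x. (g has_real_derivative g' x) (at x)" by auto
  then show ?case
    by (intro bexI[of _ "\<lambda>x. f' x + g' x"]) (auto intro!: derivative_eq_intros flat_algebra.intros)
next
  case (mult f g)
  then obtain f' g' where "f' \<in> flat_algebra" "g' \<in> flat_algebra"
    "\<And>x. (f has_real_derivative f' x) (at x)" "\<And>x. (g has_real_derivative g' x) (at x)" by auto
  with mult show ?case
    by (intro bexI[of _ "\<lambda>x. f' x * g x + g' x * f x"])
      (auto intro!: derivative_eq_intros flat_algebra.intros)
next
  case (scale f c)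
  then obtain f' where "f' \<in> flat_algebra" "\<And>x. (f has_real_derivative f' x) (at x)" by auto
  then show ?case
    by (intro bexI[of _ "\<lambda>x. c * f' x"]) (auto intro!: derivative_eq_intros flat_algebra.intros)
qed

lemma flat_algebra_smooth:
  assumes "f \<in> flat_algebra"
  shows "(deriv ^^ n) f \<in> flat_algebra"
proof (induction n)
  case (Suc n)
  then obtain f' where "f' \<in> flat_algebra" "\<And>x. ((deriv ^^ n) f has_real_derivative f' x) (at x)"
    using flat_algebra_deriv by blast
  moreover from this have "deriv ((deriv ^^ n) f) = f'"
    by (auto intro!: DERIV_imp_deriv)
  ultimately show ?case by simp
qed (use assms in auto)

text \<open>The test functions used later are second primitives of bump combinations and are not
  shown to lie in \<open>flat_algebra\<close>; only from the second derivative on do the iterates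
  belong to it, hence the separate orders 0 and 1.\<close>

lemma second_primitive_smooth:
  assumes "\<And>x. (f has_real_derivative f1 x) (at x)" "\<And>x. (f1 has_real_derivative f2 x) (at x)"
    and "f2 \<in> flat_algebra"
  shows "(deriv ^^ n) f differentiable (at x)" "(deriv ^^ 2) f = f2"
proof -
  have 1: "deriv f = f1" "deriv f1 = f2"
    using assms(1,2) by (auto intro!: ext DERIV_imp_deriv)
  then show 2: "(deriv ^^ 2) f = f2" by (simp add: numeral_2_eq_2)
  consider "n = 0" | "n = 1" | m where "n = m + 2"
    by (metis One_nat_def Suc_1 add.commute add_2_eq_Suc' not0_implies_Suc)
  then show "(deriv ^^ n) f differentiable (at x)"
  proof cases
    case 3
    have "(deriv ^^ n) f = (deriv ^^ m) f2" by (simp only: 3 funpow_add comp_def 2)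
    moreover have "(deriv ^^ m) f2 \<in> flat_algebra" using assms(3) by (rule flat_algebra_smooth)
    ultimately show ?thesis
      using flat_algebra_deriv real_differentiable_def by metis
  qed (use assms(1,2) 1 in \<open>auto simp: real_differentiable_def\<close>)
qed

definition bump :: "real \<Rightarrow> real" where
  "bump x = flat_exp 1 (1 + x) * flat_exp 1 (1 - x)"

lemma bump_nonneg: "0 \<le> bump x" and bump_pos: "\<bar>x\<bar> < 1 \<Longrightarrow> 0 < bump x"
  and bump_eq_0: "1 \<le> \<bar>x\<bar> \<Longrightarrow> bump x = 0"
  by (auto simp: bump_def flat_exp_def)

lemma bump_affine_flat_algebra: "(\<lambda>x. bump (c * x + d)) \<in> flat_algebra"
proof -
  have "(\<lambda>x. flat_exp 1 (c * x + (1 + d)) * flat_exp 1 ((- c) * x + (1 - d))) \<in> flat_algebra"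
    by (intro flat_algebra.intros)
  then show ?thesis by (simp add: bump_def algebra_simps)
qed

lemma continuous_bump: "continuous_on A bump"
proof -
  obtain f where "\<And>x. ((\<lambda>x. bump (1 * x + 0)) has_real_derivative f x) (at x)"
    using flat_algebra_deriv[OF bump_affine_flat_algebra[of 1 0]] by blast
  then show ?thesis
    by (auto intro!: continuous_at_imp_continuous_on DERIV_isCont)
qed

text \<open>Since the bump vanishes outside [-1, 1], its first primitive is constant and its second
  primitive affine to the right of 1. Hence \<open>B2 x / m\<close> is a smooth substitute for
  \<open>max 0 x\<close> with bounded error.\<close>

lemma bump_primitives:
  obtains B1 B2 m n where "0 < m" "\<And>x. (B2 has_real_derivative B1 x) (at x)"
    "\<And>x. (B1 has_real_derivative bump x) (at x)"
    "(bump has_integral m) {-1..1}"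
    "\<And>x. x \<le> -1 \<Longrightarrow> B2 x = 0" "\<And>x. 1 \<le> x \<Longrightarrow> B2 x = m * x + n"
proof -
  have prim: "\<exists>F. F (-1) = 0 \<and> (\<forall>x. (F has_real_derivative f x) (at x))"
    if f: "\<And>A. continuous_on A f" for f :: "real \<Rightarrow> real"
  proof -
    \<comment> \<open>A signed integral: \<open>{-1..x}\<close> is empty for x < -1, so its integral
      would be 0 there.\<close>
    define F where "F x = (if -1 \<le> x then integral {-1..x} f else - integral {x..-1} f)" for x
    have "(F has_real_derivative f x) (at x)" for x
    proof -
      \<comment> \<open>A base point left of both x and -1, from which one formula describes F on
        both sides of -1.\<close>
      define a where "a = min x (-1) - 1"
      have a: "a \<le> -1" "a < x" by (auto simp: a_def)
      have Feq: "F y = integral {a..y} f - integral {a..-1} f" if "y \<in> {a<..}" for y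
      proof (cases "-1 \<le> y")
        case True
        then show ?thesis
          using Henstock_Kurzweil_Integration.integral_combine[of a "-1" y f] True
            integrable_continuous_interval[OF f, of a y]
          a by (auto simp: F_def)
      next
        case False
        then show ?thesis
          using Henstock_Kurzweil_Integration.integral_combine[of a y "-1" f] False that
            integrable_continuous_interval[OF f, of a "-1"]
          by (auto simp: F_def)
      qed
      have "((\<lambda>y. integral {a..y} f - integral {a..-1} f) has_real_derivative f x) (at x)"
      proof -
        have "((\<lambda>y. integral {a..y} f) has_real_derivative f x) (at x within {a..x+1})"
          by (rule integral_has_real_derivative) (use f in \<open>auto simp: a_def\<close>)
        then have "((\<lambda>y. integral {a..y} f) has_real_derivative f x) (at x)"
          by (subst (asm) at_within_interior) (auto simp: a_def)
        then show ?thesis by (auto intro!: derivative_eq_intros)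
      qed
      then show ?thesis
        by (rule has_field_derivative_transform_within_open[of _ _ _ "{a<..}"])
          (use Feq in \<open>auto simp: a_def\<close>)
    qed
    moreover have "F (-1) = 0" by (simp add: F_def)
    ultimately show ?thesis by blast
  qed
  obtain B1 where B1: "B1 (-1) = 0" "\<And>x. (B1 has_real_derivative bump x) (at x)"
    using prim[of bump] continuous_bump by blast
  have "continuous_on A B1" for A
    using B1(2) by (auto intro!: continuous_at_imp_continuous_on DERIV_isCont)
  then obtain B2 where B2: "B2 (-1) = 0" "\<And>x. (B2 has_real_derivative B1 x) (at x)"
    using prim[of B1] by blast
  have B1_left: "B1 x = 0" if x: "x \<le> -1" for x
  proof (cases "x = -1")
    case False
    then obtain z where "z < -1" "B1 (-1) - B1 x = (-1 - x) * bump z"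
      using MVT2[of x "-1" B1 bump] B1(2) x False by force
    then show ?thesis using B1(1) by (simp add: bump_eq_0)
  qed (simp add: B1)
  have B1_right: "B1 x = B1 1" if x: "1 \<le> x" for x
  proof (cases "x = 1")
    case False
    then obtain z where "1 < z" "B1 x - B1 1 = (x - 1) * bump z"
      using MVT2[of 1 x B1 bump] B1(2) x False by force
    then show ?thesis by (simp add: bump_eq_0)
  qed simp
  have B2_left: "B2 x = 0" if x: "x \<le> -1" for x
  proof (cases "x = -1")
    case False
    then obtain z where "z < -1" "B2 (-1) - B2 x = (-1 - x) * B1 z"
      using MVT2[of x "-1" B2 B1] B2(2) x False by force
    then show ?thesis using B2(1) by (simp add: B1_left)
  qed (simp add: B2)
  have B2_right: "B2 x = B1 1 * x + (B2 1 - B1 1)" if x: "1 \<le> x" for x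
  proof (cases "x = 1")
    case False
    then obtain z where "1 < z" "B2 x - B2 1 = (x - 1) * B1 z"
      using MVT2[of 1 x B2 B1] B2(2) x False by force
    then show ?thesis using B1_right[of z] by (simp add: algebra_simps)
  qed simp
  have "0 < B1 1"
  proof -
    obtain z where "-1 < z" "z < 1" "B1 1 - B1 (-1) = (1 - -1) * bump z"
      using MVT2[of "-1" 1 B1 bump] B1(2) by force
    then show ?thesis using B1(1) bump_pos[of z] by simp
  qed
  moreover have "(bump has_integral (B1 1 - B1 (-1))) {-1..1}"
    by (rule fundamental_theorem_of_calculus)
      (use B1(2) in \<open>auto simp: has_real_derivative_iff_has_vector_derivative[symmetric]
        intro: has_field_derivative_at_within\<close>)
  moreover from this have "(bump has_integral B1 1) {-1..1}" using B1(1) by simp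
  ultimately show thesis
    using that[OF _ B2(2) B1(2) _ B2_left B2_right] by blast
qed

text \<open>Substituting z = x + e n w moves everything to the fixed interval [-1, 1], where f is
  bounded near x because \<open>e n \<le> d\<close>; dominated convergence then uses the continuity
  of f at x. The Lebesgue completion appears because \<open>weak_derivative\<close> is stated with
  it.\<close>

lemma bump_approximate_identity:
  fixes f :: "real \<Rightarrow> real"
  assumes S: "open S" "continuous_on S f" "cball x d \<subseteq> S" "0 < d"
    and m: "(bump has_integral m) {-1..1}" "0 < m"
    and e: "e \<longlonglongrightarrow> 0" "\<And>n. 0 < e n" "\<And>n. e n \<le> d"
  shows "set_integrable lebesgue S (\<lambda>z. f z * bump ((z - x) / e n))"
    and "(\<lambda>n. LINT z:S|lebesgue. f z * (bump ((z - x) / e n) / (e n * m))) \<longlonglongrightarrow> f x"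
proof -
  obtain C where C: "\<And>z. z \<in> cball x d \<Longrightarrow> \<bar>f z\<bar> \<le> C"
  proof -
    have "bounded (f ` cball x d)"
      by (intro compact_imp_bounded compact_continuous_image continuous_on_subset[OF S(2,3)] compact_cball)
    then show ?thesis using that unfolding bounded_iff by (auto simp del: mem_cball)
  qed
  have fS[measurable]: "(\<lambda>z. indicator S z * f z) \<in> borel_measurable borel"
    using borel_measurable_continuous_on_indicator[OF _ S(2)] S(1) by simp
  have bump_meas[measurable]: "bump \<in> borel_measurable borel"
    by (rule borel_measurable_continuous_onI[OF continuous_bump])
  have bump_int: "integrable lborel (\<lambda>z. indicator {-1..1} z * bump z)" 
     "(\<integral>z. indicator {-1..1} z * bump z \<partial>lborel) = m"
  proof -
    have "set_integrable lborel {-1..1} bump"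
      by (rule borel_integrable_atLeastAtMost') (rule continuous_bump)
    then show "integrable lborel (\<lambda>z. indicator {-1..1} z * bump z)" 
     "(\<integral>z. indicator {-1..1} z * bump z \<partial>lborel) = m"
      using set_borel_integral_eq_integral(2)[of "{-1..1}" bump] integral_unique[OF m(1)]
      by (simp_all only: set_integrable_def set_lebesgue_integral_def real_scaleR_def)
  qed
  have eq: "indicator S (x + e n * w) * f (x + e n * w) * bump w =
      f (x + e n * w) * (indicator {-1..1} w * bump w)" for n w
  proof (cases "\<bar>w\<bar> \<le> 1")
    case True
    then have "e n * \<bar>w\<bar> \<le> d * 1" by (intro mult_mono) (use e S(4) in \<open>auto simp: less_imp_le\<close>)
    then have "x + e n * w \<in> S"
      using S(3) e(2)[of n] by (auto simp: dist_real_def abs_mult subset_iff)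
    then show ?thesis using True by (auto simp: abs_le_iff)
  qed (use bump_eq_0[of w] in auto)
  have bd: "\<bar>f (x + e n * w) * (indicator {-1..1} w * bump w)\<bar> \<le> C * (indicator {-1..1} w * bump w)" for n w
  proof (cases "\<bar>w\<bar> \<le> 1")
    case True
    then have "e n * \<bar>w\<bar> \<le> d * 1" by (intro mult_mono) (use e S(4) in \<open>auto simp: less_imp_le\<close>)
    then have "\<bar>f (x + e n * w)\<bar> \<le> C"
      using C[of "x + e n * w"] e(2)[of n] by (auto simp: dist_real_def abs_mult)
    then show ?thesis by (auto simp: abs_mult bump_nonneg intro!: mult_right_mono)
  qed (use bump_eq_0[of w] in auto)
  have meas: "(\<lambda>w. indicator S (x + e n * w) * f (x + e n * w) * bump w) \<in> borel_measurable lborel" for n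
    using measurable_compose[of "\<lambda>w. x + e n * w" borel borel, OF _ fS] by measurable
  have int: "integrable lborel (\<lambda>w. indicator S (x + e n * w) * f (x + e n * w) * bump w)" for n
  proof (rule Bochner_Integration.integrable_bound[OF integrable_mult_right[OF bump_int(1), of C] meas AE_I2])
    show "norm (indicator S (x + e n * w) * f (x + e n * w) * bump w)
        \<le> norm (C * (indicator {-1..1} w * bump w))" for w
      unfolding eq real_norm_def using bd[of n w] by linarith
  qed
  have int': "integrable lborel (\<lambda>z. indicator S z * (f z * bump ((z - x) / e n)))" for n
  proof -
    have "x + e n * (- x / e n + 1 / e n * z) = z" "- x / e n + 1 / e n * z = (z - x) / e n" for z
      using e(2)[of n] by (auto simp: divide_simps)
    then show ?thesis
      using lborel_integrable_real_affine[OF int[of n], of "1 / e n" "- x / e n"] e(2)[of n]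
      by (simp only: mult.assoc) simp
  qed
  then show "set_integrable lebesgue S (\<lambda>z. f z * bump ((z - x) / e n))"
    unfolding set_integrable_def
    by (subst integrable_completion) (use borel_measurable_integrable[OF int'[of n]] in simp_all)
  have val: "(LINT z:S|lebesgue. f z * (bump ((z - x) / e n) / (e n * m))) =
      (\<integral>w. indicator S (x + e n * w) * f (x + e n * w) * bump w \<partial>lborel) / m" for n
  proof -
    have "(LINT z:S|lebesgue. f z * (bump ((z - x) / e n) / (e n * m))) =
      (\<integral>z. (indicator S z * (f z * bump ((z - x) / e n))) / (e n * m) \<partial>lborel)"
      unfolding set_lebesgue_integral_def
      using borel_measurable_divide[OF borel_measurable_integrable[OF int'[of n]] borel_measurable_const[of "e n * m"]]
      by (subst integral_completion) auto
    also have "\<dots> = (\<integral>z. indicator S z * (f z * bump ((z - x) / e n)) \<partial>lborel) / (e n * m)"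
      by simp
    also have "(\<integral>z. indicator S z * (f z * bump ((z - x) / e n)) \<partial>lborel) =
       e n * (\<integral>w. indicator S (x + e n * w) * f (x + e n * w) * bump w \<partial>lborel)"
      by (subst lborel_integral_real_affine[of "e n" _ x]) (use e(2)[of n] in \<open>auto simp: mult.assoc\<close>)
    finally show ?thesis using e(2)[of n] by simp
  qed
  have "(\<lambda>n. \<integral>w. indicator S (x + e n * w) * f (x + e n * w) * bump w \<partial>lborel) \<longlonglongrightarrow>
     (\<integral>w. f x * (indicator {-1..1} w * bump w) \<partial>lborel)"
  proof (rule integral_dominated_convergence[where w = "\<lambda>w. C * (indicator {-1..1} w * bump w)"])
    show "AE w in lborel. (\<lambda>n. indicator S (x + e n * w) * f (x + e n * w) * bump w)
        \<longlonglongrightarrow> f x * (indicator {-1..1} w * bump w)"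
    proof (rule AE_I2)
      fix w
      have "isCont f x"
        using S(2,3,4) continuous_on_eq_continuous_at[OF S(1), of f] by (auto simp: subset_iff)
      moreover have "(\<lambda>n. x + e n * w) \<longlonglongrightarrow> x"
        using tendsto_add[OF tendsto_const[of x] tendsto_mult[OF e(1) tendsto_const[of w]]] by simp
      ultimately have "(\<lambda>n. f (x + e n * w)) \<longlonglongrightarrow> f x"
        by (rule isCont_tendsto_compose)
      then show "(\<lambda>n. indicator S (x + e n * w) * f (x + e n * w) * bump w)
        \<longlonglongrightarrow> f x * (indicator {-1..1} w * bump w)"
        unfolding eq by (intro tendsto_intros)
    qed
    show "(\<lambda>w. indicator S (x + e n * w) * f (x + e n * w) * bump w) \<in> borel_measurable lborel" for n
      using int by (rule borel_measurable_integrable)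
    show "AE w in lborel. norm (indicator S (x + e n * w) * f (x + e n * w) * bump w)
        \<le> C * (indicator {-1..1} w * bump w)" for n
      unfolding eq real_norm_def using bd by (rule AE_I2)
  qed (use bump_int in \<open>auto intro!: borel_measurable_integrable\<close>)
  then have "(\<lambda>n. (\<integral>w. indicator S (x + e n * w) * f (x + e n * w) * bump w \<partial>lborel) / m) \<longlonglongrightarrow>
     (\<integral>w. f x * (indicator {-1..1} w * bump w) \<partial>lborel) / m"
    using m(2) by (intro tendsto_divide tendsto_const) auto
  also have "(\<integral>w. f x * (indicator {-1..1} w * bump w) \<partial>lborel) / m = f x"
    using m(2) bump_int by simp
  finally show "(\<lambda>n. LINT z:S|lebesgue. f z * (bump ((z - x) / e n) / (e n * m))) \<longlonglongrightarrow> f x"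
    unfolding val .
qed

lemma set_integrable_lebesgue_bounded_mult:
  fixes h g :: "real \<Rightarrow> real"
  assumes "set_integrable lebesgue S h" "g \<in> borel_measurable borel" "\<And>z. z \<in> S \<Longrightarrow> \<bar>g z\<bar> \<le> C"
  shows "set_integrable lebesgue S (\<lambda>z. h z * g z)"
proof -
  have "integrable lebesgue (\<lambda>z. C * (indicator S z * h z))"
    using assms(1) by (simp add: set_integrable_def)
  moreover have "(\<lambda>z. (indicator S z * h z) * g z) \<in> borel_measurable lebesgue"
  proof (rule borel_measurable_times)
    show "(\<lambda>z. indicator S z * h z) \<in> borel_measurable lebesgue"
      using assms(1) by (intro borel_measurable_integrable) (simp add: set_integrable_def)
    show "g \<in> borel_measurable lebesgue"
      using assms(2) by (intro measurable_completion) simp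
  qed
  moreover have "AE z in lebesgue. norm ((indicator S z * h z) * g z) \<le> norm (C * (indicator S z * h z))"
  proof (rule AE_I2)
    fix z
    show "norm ((indicator S z * h z) * g z) \<le> norm (C * (indicator S z * h z))"
    proof (cases "z \<in> S")
      case True
      then show ?thesis using assms(3)[of z] by (auto simp: abs_mult mult.commute intro!: mult_right_mono)
    qed simp
  qed
  ultimately show ?thesis
    unfolding set_integrable_def real_scaleR_def mult.assoc[symmetric]
    by (rule Bochner_Integration.integrable_bound)
qed

lemma has_real_derivative_rescale:
  fixes F :: "real \<Rightarrow> real"
  assumes "(F has_real_derivative D) (at ((z - w) / e))" "0 < e"
  shows "((\<lambda>z. F ((z - w) / e)) has_real_derivative D * (1 / e)) (at z)"
proof -
  have "((\<lambda>z. (z - w) / e) has_real_derivative 1 / e) (at z)"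
    using assms(2) by (auto intro!: derivative_eq_intros)
  then show ?thesis
    using DERIV_chain2[where f = F and g = "\<lambda>z. (z - w) / e" and x = z] assms by blast
qed

lemma abs_convex_difference_le:
  fixes a b c :: real
  assumes "0 < th" "th < 1" "\<bar>a\<bar> \<le> B" "\<bar>b\<bar> \<le> B" "\<bar>c\<bar> \<le> B"
  shows "\<bar>th * a - b + (1 - th) * c\<bar> \<le> 2 * B"
proof -
  have "\<bar>th * a\<bar> \<le> th * B" "\<bar>(1 - th) * c\<bar> \<le> (1 - th) * B"
    using assms by (auto simp: abs_mult intro!: mult_left_mono)
  moreover have "th * B + B + (1 - th) * B = 2 * B" by (simp add: algebra_simps)
  ultimately show ?thesis using assms(4) by linarith
qed

text \<open>Tested against a function whose second derivative is an affinely balanced combination of three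
  narrow bumps; the balance makes its second primitive compactly supported.\<close>
lemma weak_second_derivative_integral_kernel:
  fixes f h :: "real \<Rightarrow> real"
  assumes S: "open S" "bounded S" and f: "continuous_on S f"
    and weak: "weak_derivative 2 S f h" and h: "set_integrable lebesgue S h"
    and "0 < d" and sub: "{x1 - d..x2 + d} \<subseteq> S" and "x1 < y" "y < x2"
    and th: "th = (x2 - y) / (x2 - x1)"
  defines "T \<equiv> \<lambda>y. LINT z:S|lebesgue. h z * max 0 (z - y)"
  shows "th * f x1 - f y + (1 - th) * f x2 = th * T x1 - T y + (1 - th) * T x2"
proof -
  obtain m B1 B2 n where "0 < m" and B2: "\<And>x. (B2 has_real_derivative B1 x) (at x)"
    and B1: "\<And>x. (B1 has_real_derivative bump x) (at x)"
    and int_bump: "(bump has_integral m) {-1..1}"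
    and B2_left: "\<And>x. x \<le> -1 \<Longrightarrow> B2 x = 0" and B2_right: "\<And>x. 1 \<le> x \<Longrightarrow> B2 x = m * x + n"
    by (rule bump_primitives) blast
  have cont_B2: "continuous_on A B2" for A
    using B2 by (auto intro!: continuous_at_imp_continuous_on DERIV_isCont)
  have meas_B2[measurable]: "B2 \<in> borel_measurable borel"
    by (rule borel_measurable_continuous_onI[OF cont_B2])
  \<comment> \<open>Both functions vanish left of -1 and differ by the constant n / m right of 1, so
    only a compact interval remains.\<close>
  obtain C where C: "\<bar>B2 w / m - max 0 w\<bar> \<le> C" for w
  proof -
    have "bounded ((\<lambda>w. B2 w / m - max 0 w) ` {-1..1})"
      using \<open>0 < m\<close> by (intro compact_imp_bounded compact_continuous_image continuous_intros cont_B2) auto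
    then obtain C where C: "\<forall>w\<in>{-1..1}. \<bar>B2 w / m - max 0 w\<bar> \<le> C"
      unfolding bounded_iff by (auto simp del: atLeastAtMost_iff)
    have "\<bar>B2 w / m - max 0 w\<bar> \<le> \<bar>C\<bar> + \<bar>n / m\<bar>" for w
    proof -
      consider "w \<le> -1" | "w \<in> {-1..1}" | "1 \<le> w" by force
      then show ?thesis
      proof cases
        case 1
        then show ?thesis by (simp add: B2_left)
      next
        case 2
        then have "\<bar>B2 w / m - max 0 w\<bar> \<le> C" using C by blast
        then show ?thesis by linarith
      next
        case 3
        then show ?thesis using \<open>0 < m\<close> by (simp add: B2_right add_divide_distrib)
      qed
    qed
    then show ?thesis using that by blast
  qed
  \<comment> \<open>This is the affine balance: the weights th, -1, 1 - th annihilate affine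
    functions sampled at x1, y, x2, which cancels the affine tails of \<open>B2\<close> in
    \<open>supp\<close>.\<close>
  have y: "y = th * x1 + (1 - th) * x2" and th01: "0 < th" "th < 1"
  proof -
    have "0 < x2 - x1" using assms(8,9) by simp
    then show "0 < th" "th < 1" using assms(8,9) by (simp_all add: th)
    have "th * (x2 - x1) = x2 - y" using \<open>0 < x2 - x1\<close> by (simp add: th)
    then show "y = th * x1 + (1 - th) * x2" by (simp add: algebra_simps)
  qed
  define e where "e k = d * inverse (real (Suc k))" for k
  have e: "0 < e k" "e k \<le> d" for k
    using \<open>0 < d\<close> by (auto simp: e_def field_simps)
  have e0: "e \<longlonglongrightarrow> 0"
    unfolding e_def by (rule tendsto_mult_right_zero[OF LIMSEQ_inverse_real_of_nat])
  \<comment> \<open>The prefactor is chosen so that the second derivative \<open>eta2\<close>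
    combines bumps of unit mass and width \<open>e k\<close>, while \<open>eta\<close> itself
    converges to the tent \<open>tri\<close>.\<close>
  define eta where "eta k z = e k / m *
    (th * B2 ((z - x1) / e k) - B2 ((z - y) / e k) + (1 - th) * B2 ((z - x2) / e k))" for k z
  define eta1 where "eta1 k z = 1 / m *
    (th * B1 ((z - x1) / e k) - B1 ((z - y) / e k) + (1 - th) * B1 ((z - x2) / e k))" for k z
  define eta2 where "eta2 k z = 1 / (e k * m) *
    (th * bump ((z - x1) / e k) - bump ((z - y) / e k) + (1 - th) * bump ((z - x2) / e k))" for k z
  have d1: "(eta k has_real_derivative eta1 k z) (at z)" for k z
  proof -
    have "eta1 k z = e k / m * (th * (B1 ((z - x1) / e k) * (1 / e k)) - B1 ((z - y) / e k) * (1 / e k) +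
        (1 - th) * (B1 ((z - x2) / e k) * (1 / e k)))"
      using e(1)[of k] \<open>0 < m\<close> by (simp add: eta1_def field_simps)
    then show ?thesis
      unfolding eta_def[abs_def]
      by (simp only:) (intro DERIV_cmult DERIV_add DERIV_diff has_real_derivative_rescale B2 e)
  qed
  have d2: "(eta1 k has_real_derivative eta2 k z) (at z)" for k z
  proof -
    have "eta2 k z = 1 / m * (th * (bump ((z - x1) / e k) * (1 / e k)) - bump ((z - y) / e k) * (1 / e k) +
        (1 - th) * (bump ((z - x2) / e k) * (1 / e k)))"
      using e(1)[of k] \<open>0 < m\<close> by (simp add: eta2_def field_simps)
    then show ?thesis
      unfolding eta1_def[abs_def]
      by (simp only:) (intro DERIV_cmult DERIV_add DERIV_diff has_real_derivative_rescale B1 e)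
  qed
  have fa: "eta2 k \<in> flat_algebra" for k
  proof -
    have b: "(\<lambda>z. bump ((z - w) / e k)) \<in> flat_algebra" for w
      using bump_affine_flat_algebra[of "1 / e k" "- w / e k"]
      by (simp add: diff_divide_distrib)
    have "(\<lambda>z. 1 / (e k * m) * ((th * bump ((z - x1) / e k) + (-1) * bump ((z - y) / e k)) +
        (1 - th) * bump ((z - x2) / e k))) \<in> flat_algebra"
      by (intro flat_algebra.scale flat_algebra.add b)
    then show ?thesis by (simp add: eta2_def[abs_def])
  qed
  have supp: "eta k z = 0" if "z \<notin> {x1 - d..x2 + d}" for k z
  proof (cases "z < x1 - d")
    case True
    have "(z - w) / e k \<le> -1" if "x1 \<le> w" for w
      using True that e[of k] by (simp add: divide_le_eq)
    then show ?thesis using assms(8,9) by (simp add: eta_def B2_left)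
  next
    case False
    have "1 \<le> (z - w) / e k" if "w \<le> x2" for w
      using False \<open>z \<notin> _\<close> that e[of k] by (simp add: le_divide_eq)
    then have "eta k z = e k / m * (th * (m * ((z - x1) / e k) + n) - (m * ((z - y) / e k) + n)
        + (1 - th) * (m * ((z - x2) / e k) + n))"
      using assms(8,9) by (simp add: eta_def B2_right)
    also have "\<dots> = 0"
      using e(1)[of k] \<open>0 < m\<close> unfolding y by (simp add: field_simps)
    finally show ?thesis .
  qed
  have "test_function S (eta k)" for k
    unfolding test_function_def
    using second_primitive_smooth(1)[OF d1 d2 fa] supp sub
    by (auto intro!: exI[of _ "{x1 - d..x2 + d}"])
  then have weak_eq: "(LINT z:S|lebesgue. f z * eta2 k z) = (LINT z:S|lebesgue. h z * eta k z)" for k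
    using weak[unfolded weak_derivative_def, rule_format, of "eta k"]
    by (simp add: second_primitive_smooth(2)[OF d1 d2 fa])
  have sub': "cball w d \<subseteq> S" if "x1 \<le> w" "w \<le> x2" for w
    using sub that by (auto simp: dist_real_def subset_iff abs_le_iff)
  note approx = bump_approximate_identity[OF S(1) f sub' \<open>0 < d\<close> int_bump \<open>0 < m\<close> e0 e]
  have "(\<lambda>k. LINT z:S|lebesgue. f z * eta2 k z) \<longlonglongrightarrow> th * f x1 - f y + (1 - th) * f x2"
  proof -
    let ?a = "\<lambda>w k z. f z * (bump ((z - w) / e k) / (e k * m))"
    have int: "set_integrable lebesgue S (?a w k)" if "x1 \<le> w" "w \<le> x2" for w k
      using set_integrable_mult_right[OF approx(1)[OF that, of k], of "1 / (e k * m)"] by simp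
    have "(LINT z:S|lebesgue. f z * eta2 k z) = th * (LINT z:S|lebesgue. ?a x1 k z) -
       (LINT z:S|lebesgue. ?a y k z) + (1 - th) * (LINT z:S|lebesgue. ?a x2 k z)" for k
    proof -
      have "(LINT z:S|lebesgue. f z * eta2 k z) =
          (LINT z:S|lebesgue. th * ?a x1 k z - ?a y k z + (1 - th) * ?a x2 k z)"
        by (rule arg_cong[of _ _ "set_lebesgue_integral lebesgue S"])
          (auto simp: eta2_def algebra_simps add_divide_distrib diff_divide_distrib)
      also have "\<dots> = th * (LINT z:S|lebesgue. ?a x1 k z) -
       (LINT z:S|lebesgue. ?a y k z) + (1 - th) * (LINT z:S|lebesgue. ?a x2 k z)"
        using int[of x1 k] int[of y k] int[of x2 k] assms(8,9)
        by (subst set_integral_add(2) set_integral_diff(2) set_integral_mult_right |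
            intro set_integral_diff(1) set_integrable_mult_right | simp)+
      finally show ?thesis .
    qed
    then show ?thesis
      using assms(8,9) by (simp only:) (intro tendsto_intros approx(2); simp)
  qed
  moreover have "(\<lambda>k. LINT z:S|lebesgue. h z * eta k z) \<longlonglongrightarrow> th * T x1 - T y + (1 - th) * T x2"
  proof -
    obtain R where R: "\<And>z. z \<in> S \<Longrightarrow> \<bar>z\<bar> \<le> R" using S(2) by (auto simp: bounded_iff)
    \<comment> \<open>The limiting tent; its distributional second derivative is the combination of
      point masses at x1, y, x2 with weights th, -1, 1 - th.\<close>
    define tri where "tri z = th * max 0 (z - x1) - max 0 (z - y) + (1 - th) * max 0 (z - x2)" for z
    have hT: "set_integrable lebesgue S (\<lambda>z. h z * max 0 (z - w))" for w
      by (rule set_integrable_lebesgue_bounded_mult[OF h, of _ "R + \<bar>w\<bar>"]) (use R in force)+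
    have T_eq: "th * T x1 - T y + (1 - th) * T x2 = (LINT z:S|lebesgue. h z * tri z)"
    proof -
      have "(LINT z:S|lebesgue. h z * tri z) = (LINT z:S|lebesgue. th * (h z * max 0 (z - x1)) -
          h z * max 0 (z - y) + (1 - th) * (h z * max 0 (z - x2)))"
        by (rule arg_cong[of _ _ "set_lebesgue_integral lebesgue S"]) (auto simp: tri_def algebra_simps)
      also have "\<dots> = th * T x1 - T y + (1 - th) * T x2"
        using hT[of x1] hT[of y] hT[of x2] unfolding T_def
        by (subst set_integral_add(2) set_integral_diff(2) set_integral_mult_right |
            intro set_integral_diff(1) set_integrable_mult_right | simp)+
      finally show ?thesis by simp
    qed
    \<comment> \<open>As \<open>max 0\<close> is positively homogeneous, the bound C rescales to
      \<open>C * e k\<close>, uniformly in z; integrability of h then suffices for the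
      limit.\<close>
    have close: "\<bar>eta k z - tri z\<bar> \<le> 2 * (C * e k)" for k z
    proof -
      have c: "\<bar>e k / m * B2 ((z - w) / e k) - max 0 (z - w)\<bar> \<le> C * e k" for w
      proof -
        have "e k / m * B2 ((z - w) / e k) - max 0 (z - w) =
            e k * (B2 ((z - w) / e k) / m - max 0 ((z - w) / e k))"
          using e(1)[of k] by (auto simp: max_def field_simps)
        then show ?thesis using C[of "(z - w) / e k"] e(1)[of k] by (simp add: abs_mult mult.commute)
      qed
      have "eta k z - tri z = th * (e k / m * B2 ((z - x1) / e k) - max 0 (z - x1))
         - (e k / m * B2 ((z - y) / e k) - max 0 (z - y))
         + (1 - th) * (e k / m * B2 ((z - x2) / e k) - max 0 (z - x2))"
        by (simp add: eta_def tri_def diff_divide_distrib add_divide_distrib algebra_simps)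
      then show ?thesis
        using abs_convex_difference_le[OF th01 c c c, of x1 y x2] by simp
    qed
    have tri_meas[measurable]: "tri \<in> borel_measurable borel"
      unfolding tri_def[abs_def] by measurable
    have tri_bound: "\<bar>tri z\<bar> \<le> 2 * (R + \<bar>x1\<bar> + \<bar>y\<bar> + \<bar>x2\<bar>)" if "z \<in> S" for z
      unfolding tri_def using R[OF that] by (intro abs_convex_difference_le th01) auto
    have htri: "set_integrable lebesgue S (\<lambda>z. h z * tri z)"
      by (rule set_integrable_lebesgue_bounded_mult[OF h tri_meas tri_bound])
    have hd: "set_integrable lebesgue S (\<lambda>z. h z * (eta k z - tri z))" for k
      by (rule set_integrable_lebesgue_bounded_mult[OF h _ close[of k]]) 
        (simp add: eta_def[abs_def] tri_def[abs_def])
    have "(\<lambda>k. LINT z:S|lebesgue. h z * (eta k z - tri z)) \<longlonglongrightarrow> 0"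
    proof (rule tendsto_rabs_zero_cancel, rule tendsto_sandwich[OF _ _ tendsto_const])
      show "\<forall>\<^sub>F k in sequentially. 0 \<le> \<bar>LINT z:S|lebesgue. h z * (eta k z - tri z)\<bar>" by simp
      show "\<forall>\<^sub>F k in sequentially. \<bar>LINT z:S|lebesgue. h z * (eta k z - tri z)\<bar> \<le>
          2 * (C * e k) * (LINT z:S|lebesgue. \<bar>h z\<bar>)"
      proof (intro always_eventually allI)
        fix k
        have habs: "set_integrable lebesgue S (\<lambda>z. 2 * (C * e k) * \<bar>h z\<bar>)"
          using set_integrable_abs[OF h] by (rule set_integrable_mult_right)
        have "\<bar>LINT z:S|lebesgue. h z * (eta k z - tri z)\<bar> \<le> (LINT z:S|lebesgue. \<bar>h z * (eta k z - tri z)\<bar>)"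
          using set_integral_norm_bound[OF hd[of k]] by simp
        also have "\<dots> \<le> (LINT z:S|lebesgue. 2 * (C * e k) * \<bar>h z\<bar>)"
          using set_integrable_abs[OF hd[of k]] habs
        proof (rule set_integral_mono)
          fix z
          show "\<bar>h z * (eta k z - tri z)\<bar> \<le> 2 * (C * e k) * \<bar>h z\<bar>"
            unfolding abs_mult mult.commute[of "\<bar>h z\<bar>"] by (intro mult_right_mono close abs_ge_zero)
        qed
        finally show "\<bar>LINT z:S|lebesgue. h z * (eta k z - tri z)\<bar> \<le>
          2 * (C * e k) * (LINT z:S|lebesgue. \<bar>h z\<bar>)" by simp
      qed
      show "(\<lambda>k. 2 * (C * e k) * (LINT z:S|lebesgue. \<bar>h z\<bar>)) \<longlonglongrightarrow> 0"
        by (intro tendsto_mult_left_zero tendsto_mult_right_zero e0)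
    qed
    then have "(\<lambda>k. (LINT z:S|lebesgue. h z * (eta k z - tri z)) + (LINT z:S|lebesgue. h z * tri z))
        \<longlonglongrightarrow> 0 + (LINT z:S|lebesgue. h z * tri z)"
      by (intro tendsto_add tendsto_const)
    moreover have "(LINT z:S|lebesgue. h z * (eta k z - tri z)) + (LINT z:S|lebesgue. h z * tri z) =
        (LINT z:S|lebesgue. h z * eta k z)" for k
      by (subst set_integral_add(2)[OF hd htri, symmetric]) (simp add: algebra_simps)
    ultimately show ?thesis by (simp add: T_eq)
  qed
  ultimately show ?thesis
    unfolding weak_eq by (rule LIMSEQ_unique)
qed

text \<open>T is a second primitive of h, and the three-point identity says that f - T is affine
  between x1 and x2. Differentiability of T at x holds under the integral: y \<mapsto>
  \<open>max 0 (z - y)\<close> is 1-Lipschitz and has a kink at x only for the single value z =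
  x.\<close>

proposition weak_second_derivative_imp_differentiable:
  fixes f h :: "real \<Rightarrow> real"
  assumes S: "open S" "bounded S" and f: "continuous_on S f"
    and weak: "weak_derivative 2 S f h" and h: "set_integrable lebesgue S h" and "x \<in> S"
  shows "f differentiable (at x)"
proof -
  obtain r where r: "0 < r" "cball x r \<subseteq> S"
    using S(1) \<open>x \<in> S\<close> open_contains_cball by blast
  \<comment> \<open>Half the radius: x1 and x2 lie at distance d from x, and the margin d around
    them still fits into S.\<close>
  define d where "d = r / 2"
  define x1 where "x1 = x - d"
  define x2 where "x2 = x + d"
  define T where "T y = (LINT z:S|lebesgue. h z * max 0 (z - y))" for y
  have sub: "{x1 - d..x2 + d} \<subseteq> S" and "0 < d"
    using r by (auto simp: d_def x1_def x2_def dist_real_def subset_iff abs_le_iff field_simps)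
  obtain R where R: "\<And>z. z \<in> S \<Longrightarrow> \<bar>z\<bar> \<le> R" using S(2) by (auto simp: bounded_iff)
  have hT: "set_integrable lebesgue S (\<lambda>z. h z * max 0 (z - w))" for w
    by (rule set_integrable_lebesgue_bounded_mult[OF h, of _ "R + \<bar>w\<bar>"]) (use R in force)+
  have "(T has_real_derivative
      (\<integral>z. - (indicator S z * h z) * indicator {x<..} z \<partial>lebesgue)) (at x within UNIV)"
    unfolding T_def[abs_def] set_lebesgue_integral_def real_scaleR_def
  proof (rule has_real_derivative_integral[where g = "\<lambda>z. \<bar>indicator S z * h z\<bar>"])
    show "integrable lebesgue (\<lambda>z. indicator S z * (h z * max 0 (z - y)))" for y
      using hT by (simp add: set_integrable_def)
    show "integrable lebesgue (\<lambda>z. \<bar>indicator S z * h z\<bar>)"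
      using h by (simp add: set_integrable_def)
    show "(\<lambda>z. - (indicator S z * h z) * indicator {x<..} z) \<in> borel_measurable lebesgue"
    proof (rule borel_measurable_times)
      show "(\<lambda>z. - (indicator S z * h z)) \<in> borel_measurable lebesgue"
        using h by (intro borel_measurable_uminus borel_measurable_integrable) (simp add: set_integrable_def)
    qed (intro borel_measurable_indicator, simp)
    have "AE z in lebesgue. z \<noteq> x"
      by (intro AE_completion AE_lborel_singleton)
    then show "AE z in lebesgue. ((\<lambda>y. indicator S z * (h z * max 0 (z - y))) has_real_derivative
        - (indicator S z * h z) * indicator {x<..} z) (at x)"
    proof (rule AE_mp, intro AE_I2 impI)
      fix z assume "z \<noteq> x"
      then consider "z < x" | "x < z" by linarith
      then show "((\<lambda>y. indicator S z * (h z * max 0 (z - y))) has_real_derivative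
        - (indicator S z * h z) * indicator {x<..} z) (at x)"
      proof cases
        case 1
        have "((\<lambda>y. 0) has_real_derivative 0) (at x)" by simp
        then have "((\<lambda>y. indicator S z * (h z * max 0 (z - y))) has_real_derivative 0) (at x)"
          by (rule has_field_derivative_transform_within_open[of _ _ _ "{z<..}"]) (use 1 in auto)
        then show ?thesis using 1 by simp
      next
        case 2
        have "((\<lambda>y. indicator S z * (h z * (z - y))) has_real_derivative - (indicator S z * h z)) (at x)"
          by (auto intro!: derivative_eq_intros)
        then have "((\<lambda>y. indicator S z * (h z * max 0 (z - y))) has_real_derivative
            - (indicator S z * h z)) (at x)"
          by (rule has_field_derivative_transform_within_open[of _ _ _ "{..<z}"]) (use 2 in auto)
        then show ?thesis using 2 by simp
      qed
    qed
    show "AE z in lebesgue. \<bar>indicator S z * (h z * max 0 (z - y)) - indicator S z * (h z * max 0 (z - x))\<bar>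
        \<le> \<bar>y - x\<bar> * \<bar>indicator S z * h z\<bar>" for y
    proof (rule AE_I2)
      fix z
      have "indicator S z * (h z * max 0 (z - y)) - indicator S z * (h z * max 0 (z - x)) =
          (indicator S z * h z) * (max 0 (z - y) - max 0 (z - x))"
        by (simp add: algebra_simps)
      moreover have "\<bar>max 0 (z - y) - max 0 (z - x)\<bar> \<le> \<bar>y - x\<bar>" by linarith
      ultimately show "\<bar>indicator S z * (h z * max 0 (z - y)) - indicator S z * (h z * max 0 (z - x))\<bar>
        \<le> \<bar>y - x\<bar> * \<bar>indicator S z * h z\<bar>"
        by (metis abs_ge_zero abs_mult mult.commute mult_left_mono)
    qed
  qed auto
  then have T: "T differentiable (at x)" by (auto simp: real_differentiable_def)
  define th where "th y = (x2 - y) / (x2 - x1)" for y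
  have "(\<lambda>y. T y + th y * (f x1 - T x1) + (1 - th y) * (f x2 - T x2)) differentiable (at x)"
    unfolding th_def using T \<open>0 < d\<close>
    by (intro differentiable_add differentiable_mult differentiable_diff differentiable_divide
        differentiable_const differentiable_ident) (auto simp: x1_def x2_def)
  then obtain D where "((\<lambda>y. T y + th y * (f x1 - T x1) + (1 - th y) * (f x2 - T x2))
      has_real_derivative D) (at x)"
    by (auto simp: real_differentiable_def)
  then have "(f has_real_derivative D) (at x)"
  proof (rule has_field_derivative_transform_within_open[of _ _ _ "{x1<..<x2}"])
    fix y assume "y \<in> {x1<..<x2}"
    then show "T y + th y * (f x1 - T x1) + (1 - th y) * (f x2 - T x2) = f y"
      using weak_second_derivative_integral_kernel[OF S f weak h \<open>0 < d\<close> sub, of y "th y"]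
      by (simp add: th_def T_def algebra_simps)
  qed (use \<open>0 < d\<close> in \<open>auto simp: x1_def x2_def\<close>)
  then show ?thesis by (auto simp: real_differentiable_def)
qed

section \<open>The kernel and its primitive\<close>

lemma has_integral_const_interval:
  fixes c :: real
  assumes "a \<le> b" shows "((\<lambda>x. c) has_integral c * (b - a)) {a..b}"
  using has_integral_const_real[of c a b] assms by (simp add: mult.commute)

locale alignment_kernel =
  fixes \<phi> :: "real \<Rightarrow> real" and s \<Lambda> R\<^sub>0 :: real
  assumes nonneg: "nonnegative_kernel \<phi>" and radial: "radially_decreasing \<phi>"
    and singular: "weakly_singular \<phi>"
    and s: "0 < s" "s < 1" and pos: "0 < \<Lambda>" "0 < R\<^sub>0"
    and upper: "\<And>x. 0 < \<bar>x\<bar> \<Longrightarrow> \<bar>x\<bar> < R\<^sub>0 \<Longrightarrow> \<phi> x \<le> \<Lambda> * \<bar>x\<bar> powr (- s)"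
begin

abbreviation \<Phi> :: "real \<Rightarrow> real" where "\<Phi> \<equiv> kernel_primitive \<phi>"

text \<open>The power bound evaluated at \<open>R\<^sub>0 / 2\<close>, a point strictly inside its
  range. By monotonicity it controls the kernel at all distances beyond
  \<open>R\<^sub>0\<close>.\<close>

definition K\<^sub>0 :: real where "K\<^sub>0 = \<Lambda> * (R\<^sub>0 / 2) powr (- s)"

text \<open>Only relevant for \<open>z \<noteq> 0\<close>: at the origin \<open>0 powr (- s) = 0\<close>.\<close>
definition envelope :: "real \<Rightarrow> real" where
  "envelope z = 4 * \<Lambda> / (1 - s) * (\<bar>z\<bar> / 2) powr (- s) + 4 * K\<^sub>0"

lemma K\<^sub>0_pos: "0 < K\<^sub>0"
  using pos by (simp add: K\<^sub>0_def)

lemma envelope_pos: "0 < envelope z"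
  unfolding envelope_def using pos s K\<^sub>0_pos by (intro add_nonneg_pos) auto

lemma kernel_nonneg: "x \<noteq> 0 \<Longrightarrow> 0 \<le> \<phi> x"
  using nonneg by (simp add: nonnegative_kernel_def)

lemma kernel_abs_le: "0 < \<bar>x\<bar> \<Longrightarrow> \<bar>x\<bar> \<le> \<bar>y\<bar> \<Longrightarrow> \<phi> y \<le> \<phi> x"
  using radial unfolding radially_decreasing_def by blast

lemma kernel_even: "\<phi> (- x) = \<phi> x"
  using radial abs_minus_cancel unfolding radially_decreasing_def by blast

lemma kernel_le:
  assumes "x \<noteq> 0" shows "\<phi> x \<le> \<Lambda> * \<bar>x\<bar> powr (- s) + K\<^sub>0"
proof (cases "\<bar>x\<bar> < R\<^sub>0")
  case True
  then show ?thesis using upper[of x] assms K\<^sub>0_pos by simp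
next
  case False
  then have "\<phi> x \<le> \<phi> (R\<^sub>0 / 2)" using pos by (intro kernel_abs_le) auto
  also have "\<dots> \<le> K\<^sub>0" using upper[of "R\<^sub>0 / 2"] pos by (simp add: K\<^sub>0_def)
  finally show ?thesis using pos by (simp add: add_increasing)
qed

lemma kernel_le_envelope: "x \<noteq> 0 \<Longrightarrow> \<phi> x \<le> envelope x"
proof -
  assume "x \<noteq> 0"
  have "\<Lambda> * \<bar>x\<bar> powr (- s) \<le> 4 * \<Lambda> / (1 - s) * (\<bar>x\<bar> / 2) powr (- s)"
  proof (rule mult_mono)
    show "\<Lambda> \<le> 4 * \<Lambda> / (1 - s)" using s pos by (simp add: field_simps)
    show "\<bar>x\<bar> powr (- s) \<le> (\<bar>x\<bar> / 2) powr (- s)"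
      using s \<open>x \<noteq> 0\<close> by (intro powr_mono2') auto
  qed (use s pos in auto)
  then show ?thesis using kernel_le[OF \<open>x \<noteq> 0\<close>] K\<^sub>0_pos by (simp add: envelope_def)
qed

lemma kernel_set_integrable: "set_integrable lborel {a..b} \<phi>"
  using singular by (simp add: weakly_singular_def)

lemma kernel_integrable_on: "\<phi> integrable_on {a..b}"
  using set_borel_integral_eq_integral(1)[OF kernel_set_integrable] .

lemma borel_measurable_kernel [measurable]: "\<phi> \<in> borel_measurable borel"
proof (rule borel_measurable_LIMSEQ_real)
  show "(\<lambda>z. indicator {-real n..real n} z * \<phi> z) \<in> borel_measurable borel" for n
    using borel_measurable_integrable[OF kernel_set_integrable[of "- real n" "real n", unfolded set_integrable_def]]
    by simp
  show "(\<lambda>n. indicator {-real n..real n} z * \<phi> z) \<longlonglongrightarrow> \<phi> z" for z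
  proof (rule tendsto_eventually)
    obtain N where N: "\<bar>z\<bar> \<le> real N" using real_arch_simple by blast
    show "\<forall>\<^sub>F n in sequentially. indicator {-real n..real n} z * \<phi> z = \<phi> z"
      using eventually_ge_at_top[of N]
    proof eventually_elim
      case (elim n)
      then have "z \<in> {-real n..real n}" using N by (auto simp: abs_le_iff)
      then show ?case by simp
    qed
  qed
qed

section \<open>Hoelder and weighted Lipschitz estimates for the kernel primitive\<close>

lemma primitive_diff:
  assumes "a \<le> b" shows "\<Phi> b - \<Phi> a = integral {a..b} \<phi>"
proof -
  have nn: "\<Phi> x = integral {0..x} \<phi>" if "0 \<le> x" for x
    using interval_integral_Icc[where a = 0 and b = x and f = \<phi>] set_borel_integral_eq_integral(2)[OF kernel_set_integrable] that
    by (simp add: kernel_primitive_def zero_ereal_def)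
  have np: "\<Phi> x = - integral {x..0} \<phi>" if "x \<le> 0" for x
    using interval_integral_Icc[where a = x and b = 0 and f = \<phi>] set_borel_integral_eq_integral(2)[OF kernel_set_integrable] that
      interval_integral_endpoints_reverse[where a = 0 and b = "ereal x" and f = \<phi>]
    by (simp add: kernel_primitive_def zero_ereal_def)
  consider "0 \<le> a" | "a \<le> 0" "0 \<le> b" | "b \<le> 0" using assms by linarith
  then show ?thesis
  proof cases
    case 1
    then show ?thesis
      using Henstock_Kurzweil_Integration.integral_combine[of 0 a b \<phi>] kernel_integrable_on assms nn[of a] nn[of b] by simp
  next
    case 2
    then show ?thesis
      using Henstock_Kurzweil_Integration.integral_combine[of a 0 b \<phi>] kernel_integrable_on np[of a] nn[of b] by simp
  next
    case 3
    then show ?thesis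
      using Henstock_Kurzweil_Integration.integral_combine[of a b 0 \<phi>] kernel_integrable_on assms np[of a] np[of b] by simp
  qed
qed

text \<open>The value \<open>\<phi> 0\<close> is arbitrary, so the majorant is replaced by it at the
  origin, which leaves the integral unchanged.\<close>

lemma integral_kernel_le:
  assumes "a \<le> b" "(g has_integral I) {a..b}" "\<And>x. x \<in> {a..b} \<Longrightarrow> x \<noteq> 0 \<Longrightarrow> \<phi> x \<le> g x"
  shows "integral {a..b} \<phi> \<le> I"
proof -
  have "((\<lambda>x. if x = 0 then \<phi> 0 else g x) has_integral I) {a..b}"
    by (rule has_integral_spike_finite[OF _ _ assms(2), of "{0}"]) auto
  then show ?thesis
    by (intro has_integral_le[OF integrable_integral[OF kernel_integrable_on]]) (use assms(3) in auto)
qed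

lemma integral_kernel_nonneg: "0 \<le> integral {a..b} \<phi>"
proof -
  have "((\<lambda>x. if x = 0 then \<phi> 0 else 0) has_integral 0) {a..b}"
    by (rule has_integral_spike_finite[OF _ _ has_integral_0, of "{0}"]) auto
  then show ?thesis
    by (intro has_integral_le[OF _ integrable_integral[OF kernel_integrable_on]]) (use kernel_nonneg in auto)
qed

lemma primitive_mono: "a \<le> b \<Longrightarrow> \<Phi> a \<le> \<Phi> b"
  using primitive_diff integral_kernel_nonneg[of a b] by fastforce

lemma primitive_odd: "\<Phi> (- x) = - \<Phi> x"
proof -
  have "\<Phi> (- x) = - \<Phi> x" if "0 \<le> x" for x
  proof -
    have "\<Phi> 0 = 0" by (simp add: kernel_primitive_def zero_ereal_def)
    then have "\<Phi> (-x) = - integral {-x..0} \<phi>" using primitive_diff[of "-x" 0] that by simp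
    also have "integral {-x..0} \<phi> = integral {0..x} \<phi>"
      using Henstock_Kurzweil_Integration.integral_reflect_real[of x 0 \<phi>] by (simp add: kernel_even)
    also have "\<dots> = \<Phi> x" using primitive_diff[of 0 x] that \<open>\<Phi> 0 = 0\<close> by simp
    finally show ?thesis .
  qed
  from this[of x] this[of "-x"] show ?thesis by (cases "0 \<le> x") auto
qed

lemma primitive_le:
  assumes "0 \<le> D" shows "\<Phi> D \<le> \<Lambda> / (1 - s) * D powr (1 - s) + K\<^sub>0 * D"
proof -
  have "((\<lambda>x. x powr (- s)) has_integral (D powr (- s + 1) / (- s + 1))) {0..D}"
    by (rule has_integral_powr_from_0) (use s assms in auto)
  then have "((\<lambda>x. \<Lambda> * x powr (- s) + K\<^sub>0) has_integral
      (\<Lambda> * (D powr (- s + 1) / (- s + 1)) + K\<^sub>0 * (D - 0))) {0..D}"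
    by (intro has_integral_add has_integral_mult_right has_integral_const_interval assms)
  then have "integral {0..D} \<phi> \<le> \<Lambda> * (D powr (- s + 1) / (- s + 1)) + K\<^sub>0 * (D - 0)"
    by (rule integral_kernel_le[OF assms]) (use kernel_le in force)
  moreover have "\<Phi> 0 = 0" by (simp add: kernel_primitive_def zero_ereal_def)
  ultimately show ?thesis using primitive_diff[OF assms] by (simp add: algebra_simps)
qed

lemma primitive_diff_le_const:
  assumes "0 \<le> D" "0 < w" "\<And>y. z \<le> y \<Longrightarrow> y \<le> z + D \<Longrightarrow> w \<le> \<bar>y\<bar>"
  shows "\<Phi> (z + D) - \<Phi> z \<le> D * \<phi> w"
proof -
  have "((\<lambda>y. \<phi> w) has_integral \<phi> w * (z + D - z)) {z..z + D}"
    by (rule has_integral_const_interval) (use assms in simp)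
  then have "integral {z..z + D} \<phi> \<le> \<phi> w * (z + D - z)"
  proof (rule integral_kernel_le[rotated])
    fix x assume "x \<in> {z..z + D}"
    then have "w \<le> \<bar>x\<bar>" using assms(3) by simp
    then show "\<phi> x \<le> \<phi> w" using assms(2) by (intro kernel_abs_le) auto
  qed (use assms in simp)
  then show ?thesis using primitive_diff[of z "z + D"] assms(1) by (simp add: mult.commute)
qed

text \<open>Either [z, z + D] keeps distance D from the origin, and there the kernel is at most
  \<phi> D; or it lies in [-2D, 2D], and the increment is at most 2 \<Phi>(2D) by oddness. The
  factor 4 combines the two halves with (2D)^(1-s) \<le> 2 D^(1-s) and with the length 2D.\<close>

lemma primitive_holder:
  assumes "0 \<le> D"
  shows "\<Phi> (z + D) - \<Phi> z \<le> 4 * \<Lambda> / (1 - s) * D powr (1 - s) + 4 * K\<^sub>0 * D"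
proof (cases "D = 0")
  case False
  with assms have D: "0 < D" by simp
  have eq: "D * D powr (- s) = D powr (1 - s)"
    using D powr_add[of D 1 "- s"] by simp
  show ?thesis
  proof (cases "\<forall>y. z \<le> y \<and> y \<le> z + D \<longrightarrow> D \<le> \<bar>y\<bar>")
    case True
    then have "\<Phi> (z + D) - \<Phi> z \<le> D * \<phi> D"
      using primitive_diff_le_const[OF assms D] by blast
    also have "\<dots> \<le> D * (\<Lambda> * \<bar>D\<bar> powr (- s) + K\<^sub>0)"
      using D by (intro mult_left_mono kernel_le) auto
    also have "\<dots> = \<Lambda> * D powr (1 - s) + K\<^sub>0 * D"
      using D by (simp add: algebra_simps eq[symmetric])
    also have "\<dots> \<le> 4 * \<Lambda> / (1 - s) * D powr (1 - s) + 4 * K\<^sub>0 * D"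
      using s pos D K\<^sub>0_pos by (intro add_mono mult_right_mono) (auto simp: field_simps)
    finally show ?thesis .
  next
    case False
    then have "- (2 * D) \<le> z" "z + D \<le> 2 * D" by auto
    then have "\<Phi> (z + D) - \<Phi> z \<le> \<Phi> (2 * D) - \<Phi> (- (2 * D))"
      by (intro diff_mono primitive_mono)
    also have "\<dots> = 2 * \<Phi> (2 * D)" by (simp add: primitive_odd)
    also have "\<dots> \<le> 2 * (\<Lambda> / (1 - s) * (2 * D) powr (1 - s) + K\<^sub>0 * (2 * D))"
      using primitive_le[of "2 * D"] D by simp
    also have "(2 * D) powr (1 - s) \<le> 2 * D powr (1 - s)"
      using D s powr_mono[of "1 - s" 1 2] by (simp add: powr_mult mult_right_mono)
    finally show ?thesis using s pos by (simp add: mult_left_mono divide_right_mono)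
  qed
qed simp

text \<open>This explains the shape of \<open>envelope\<close>. For |h| \<le> |z|/2 the segment
  stays at distance |z|/2 from the origin and the kernel there is bounded by its value at |z|/2. For
  larger |h| the Hoelder bound divided by |h| is decreasing in |h|, hence at most its value at
  |z|/2. The weight depends on z alone, not on h.\<close>

lemma primitive_lipschitz_away:
  assumes "z \<noteq> 0" shows "\<bar>\<Phi> (z + h) - \<Phi> z\<bar> \<le> \<bar>h\<bar> * envelope z"
proof -
  define a where "a = min z (z + h)"
  have eq: "\<bar>\<Phi> (z + h) - \<Phi> z\<bar> = \<Phi> (a + \<bar>h\<bar>) - \<Phi> a"
    using primitive_mono[of z "z + h"] primitive_mono[of "z + h" z] by (auto simp: a_def min_def)
  show ?thesis
  proof (cases "\<bar>h\<bar> \<le> \<bar>z\<bar> / 2")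
    case True
    have "\<Phi> (a + \<bar>h\<bar>) - \<Phi> a \<le> \<bar>h\<bar> * \<phi> (\<bar>z\<bar> / 2)"
      by (rule primitive_diff_le_const) (use True assms in \<open>auto simp: a_def\<close>)
    also have "\<phi> (\<bar>z\<bar> / 2) \<le> \<Lambda> * (\<bar>z\<bar> / 2) powr (- s) + K\<^sub>0"
      using kernel_le[of "\<bar>z\<bar> / 2"] assms by simp
    also have "\<dots> \<le> envelope z"
      unfolding envelope_def using s pos K\<^sub>0_pos by (intro add_mono mult_right_mono) (auto simp: field_simps)
    finally show ?thesis unfolding eq by (simp add: mult_left_mono)
  next
    case False
    then have h: "0 < \<bar>h\<bar>" using assms by auto
    have "\<Phi> (a + \<bar>h\<bar>) - \<Phi> a \<le> 4 * \<Lambda> / (1 - s) * \<bar>h\<bar> powr (1 - s) + 4 * K\<^sub>0 * \<bar>h\<bar>"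
      by (rule primitive_holder) simp
    also have "\<bar>h\<bar> powr (1 - s) = \<bar>h\<bar> * \<bar>h\<bar> powr (- s)"
      using h powr_add[of "\<bar>h\<bar>" 1 "- s"] by simp
    finally have "\<Phi> (a + \<bar>h\<bar>) - \<Phi> a \<le> \<bar>h\<bar> * (4 * \<Lambda> / (1 - s) * \<bar>h\<bar> powr (- s) + 4 * K\<^sub>0)"
      by (simp add: algebra_simps)
    also have "\<dots> \<le> \<bar>h\<bar> * envelope z"
      unfolding envelope_def using False assms s pos
      by (intro mult_left_mono add_mono powr_mono2') auto
    finally show ?thesis unfolding eq .
  qed
qed

lemma continuous_primitive: "isCont \<Phi> z"
proof -
  have "((\<lambda>h. \<Phi> (z + h) - \<Phi> z) \<longlongrightarrow> 0) (at 0)"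
  proof (rule tendsto_rabs_zero_cancel, rule tendsto_sandwich[OF _ _ tendsto_const])
    show "\<forall>\<^sub>F h in at 0. \<bar>\<Phi> (z + h) - \<Phi> z\<bar> \<le> 4 * \<Lambda> / (1 - s) * \<bar>h\<bar> powr (1 - s) + 4 * K\<^sub>0 * \<bar>h\<bar>"
    proof (intro always_eventually allI)
      fix h
      define a where "a = min z (z + h)"
      have "\<bar>\<Phi> (z + h) - \<Phi> z\<bar> = \<Phi> (a + \<bar>h\<bar>) - \<Phi> a"
        using primitive_mono[of z "z + h"] primitive_mono[of "z + h" z] by (auto simp: a_def min_def)
      then show "\<bar>\<Phi> (z + h) - \<Phi> z\<bar> \<le> 4 * \<Lambda> / (1 - s) * \<bar>h\<bar> powr (1 - s) + 4 * K\<^sub>0 * \<bar>h\<bar>"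
        using primitive_holder[of "\<bar>h\<bar>" a] by simp
    qed
    have "((\<lambda>h. 4 * \<Lambda> / (1 - s) * \<bar>h\<bar> powr (1 - s) + 4 * K\<^sub>0 * \<bar>h\<bar>) \<longlongrightarrow>
        4 * \<Lambda> / (1 - s) * 0 + 4 * K\<^sub>0 * \<bar>0\<bar>) (at 0)"
    proof (intro tendsto_intros)
      show "((\<lambda>h::real. \<bar>h\<bar> powr (1 - s)) \<longlongrightarrow> 0) (at 0)"
        by (rule tendsto_zero_powrI[OF tendsto_rabs_zero[OF tendsto_ident_at] tendsto_const])
          (use s in simp_all)
    qed
    then show "((\<lambda>h. 4 * \<Lambda> / (1 - s) * \<bar>h\<bar> powr (1 - s) + 4 * K\<^sub>0 * \<bar>h\<bar>) \<longlongrightarrow> 0) (at 0)"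
      by simp
  qed simp
  then show ?thesis
    unfolding isCont_iff by (rule LIM_zero_cancel)
qed

lemma has_real_derivative_primitive:
  assumes "isCont \<phi> z" shows "(\<Phi> has_real_derivative \<phi> z) (at z)"
proof -
  have "((\<lambda>u. integral {z - 1..u} \<phi>) has_vector_derivative \<phi> z) (at z within {z - 1..z + 1} - {})"
    by (rule integral_has_vector_derivative_continuous_at)
      (use continuous_at_imp_continuous_at_within[OF assms] kernel_integrable_on in simp_all)
  then have "((\<lambda>u. integral {z - 1..u} \<phi>) has_real_derivative \<phi> z) (at z)"
    using at_within_interior[of z "{z - 1..z + 1}"]
    by (simp add: has_real_derivative_iff_has_vector_derivative)
  then have "((\<lambda>u. \<Phi> (z - 1) + integral {z - 1..u} \<phi>) has_real_derivative 0 + \<phi> z) (at z)"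
    by (intro DERIV_add DERIV_const)
  then show ?thesis
    unfolding add_0
  proof (rule has_field_derivative_transform_within_open[of _ _ _ "{z - 1<..}"])
    fix u assume "u \<in> {z - 1<..}"
    then show "\<Phi> (z - 1) + integral {z - 1..u} \<phi> = \<Phi> u"
      using primitive_diff[of "z - 1" u] by simp
  qed simp_all
qed

text \<open>The kernel is monotone on each half-line. It is negated on the positive one because the
  library result is for nondecreasing functions.\<close>

lemma countable_discontinuities: "countable {z. \<not> isCont \<phi> z}"
proof -
  have "countable {a \<in> {0<..}. \<not> isCont (\<lambda>x. - \<phi> x) a}"
    by (intro mono_on_ctble_discont_open) (auto intro!: mono_onI kernel_abs_le)
  then have "countable {a \<in> {0<..}. \<not> isCont \<phi> a}"
  proof (rule countable_subset[rotated])
    have "isCont \<phi> a" if "isCont (\<lambda>x. - \<phi> x) a" for a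
      using continuous_minus[OF that] by simp
    then show "{a \<in> {0<..}. \<not> isCont \<phi> a} \<subseteq> {a \<in> {0<..}. \<not> isCont (\<lambda>x. - \<phi> x) a}" by blast
  qed
  moreover have "countable {a \<in> {..<0}. \<not> isCont \<phi> a}"
    by (intro mono_on_ctble_discont_open) (auto intro!: mono_onI kernel_abs_le)
  ultimately have "countable ({a \<in> {0<..}. \<not> isCont \<phi> a} \<union> {a \<in> {..<0}. \<not> isCont \<phi> a} \<union> {0})"
    by auto
  then show ?thesis by (rule countable_subset[rotated]) force
qed

end

section \<open>Global solutions of the Lagrangian equation\<close>

text \<open>The abstract modulus e serves both growth assumptions at once. Fixing the value 0 off
  \<Omega> makes configurations total Borel functions and is respected by pointwise limits.\<close>

definition separated :: "real set \<Rightarrow> (real \<Rightarrow> real) \<Rightarrow> (real \<Rightarrow> real) set" where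
  "separated \<Omega> e = {Y. (\<forall>\<alpha>. \<alpha> \<notin> \<Omega> \<longrightarrow> Y \<alpha> = 0) \<and> bounded (Y ` \<Omega>) \<and>
     (\<forall>\<alpha>\<in>\<Omega>. \<forall>\<beta>\<in>\<Omega>. \<alpha> < \<beta> \<longrightarrow> e (\<beta> - \<alpha>) \<le> Y \<beta> - Y \<alpha>)}"

lemma separated_measurable:
  assumes "open \<Omega>" "\<And>d. 0 < d \<Longrightarrow> 0 < e d" "Y \<in> separated \<Omega> e"
  shows "Y \<in> borel_measurable borel"
proof -
  have "mono_on \<Omega> Y"
  proof (rule mono_onI)
    fix x y assume "x \<in> \<Omega>" "y \<in> \<Omega>" "x \<le> y"
    then show "Y x \<le> Y y"
      using assms(2)[of "y - x"] assms(3) by (cases "x = y") (force simp: separated_def)+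
  qed
  then have "Y \<in> borel_measurable (restrict_space borel \<Omega>)"
    by (rule borel_measurable_mono_on_fnc)
  then have "(\<lambda>x. indicator \<Omega> x *\<^sub>R Y x) \<in> borel_measurable borel"
    using borel_measurable_restrict_space_iff[of \<Omega> borel Y] assms(1) by simp
  moreover have "(\<lambda>x. indicator \<Omega> x *\<^sub>R Y x) = Y"
    using assms(3) by (auto simp: separated_def indicator_def fun_eq_iff)
  ultimately show ?thesis by simp
qed

lemma has_real_derivative_integral_within_Ici:
  fixes f :: "real \<Rightarrow> real"
  assumes "continuous_on {0..} f" "0 \<le> t"
  shows "((\<lambda>t. integral {0..t} f) has_real_derivative f t) (at t within {0..})"
proof -
  have "((\<lambda>t. integral {0..t} f) has_real_derivative f t) (at t within {0..t + 1})"
    by (rule integral_has_real_derivative) (use assms continuous_on_subset[OF assms(1)] in auto)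
  moreover have "at t within {0..t + 1} = at t within {0..}"
    by (rule at_within_nhd[of _ "{t - 1<..<t + 1}"]) auto
  ultimately show ?thesis by simp
qed

lemma has_integral_exp_scaled:
  fixes b c t :: real
  assumes "b \<noteq> 0" "0 \<le> t"
  shows "((\<lambda>\<tau>. c * exp (b * \<tau>)) has_integral c / b * (exp (b * t) - 1)) {0..t}"
proof -
  have "((\<lambda>\<tau>. c * exp (b * \<tau>)) has_integral (c / b * exp (b * t) - c / b * exp (b * 0))) {0..t}"
  proof (rule fundamental_theorem_of_calculus[OF assms(2)])
    show "((\<lambda>\<tau>. c / b * exp (b * \<tau>)) has_vector_derivative c * exp (b * x)) (at x within {0..t})" for x
      unfolding has_real_derivative_iff_has_vector_derivative[symmetric]
      using assms(1) by (auto intro!: derivative_eq_intros)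
  qed
  then show ?thesis by (simp add: right_diff_distrib)
qed

text \<open>The exponents add up to 4 L, and integration against the weight L gains the factor 1/4.
  It beats the Lipschitz constant 2 of the Euler step, so the iteration contracts by 1/2 on the
  whole half-line of times.\<close>

lemma weighted_integral_bound:
  fixes f :: "real \<Rightarrow> real"
  assumes "0 < L" "0 \<le> t" "continuous_on {0..} f" "\<And>\<tau>. 0 \<le> \<tau> \<Longrightarrow> \<bar>f \<tau>\<bar> \<le> A * exp (3 * L * \<tau>)" "0 \<le> A"
  shows "\<bar>exp (- L * t) * integral {0..t} (\<lambda>\<tau>. L * exp (L * \<tau>) * f \<tau>)\<bar> \<le> A / 4 * exp (3 * L * t)"
proof -
  have "norm (integral {0..t} (\<lambda>\<tau>. L * exp (L * \<tau>) * f \<tau>)) \<le> integral {0..t} (\<lambda>\<tau>. L * A * exp (4 * L * \<tau>))"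
  proof (rule integral_norm_bound_integral)
    show "(\<lambda>\<tau>. L * exp (L * \<tau>) * f \<tau>) integrable_on {0..t}"
      by (intro integrable_continuous_interval continuous_intros continuous_on_subset[OF assms(3)]) auto
    show "(\<lambda>\<tau>. L * A * exp (4 * L * \<tau>)) integrable_on {0..t}"
      by (intro integrable_continuous_interval continuous_intros)
    fix \<tau> assume "\<tau> \<in> {0..t}"
    then have "\<bar>f \<tau>\<bar> \<le> A * exp (3 * L * \<tau>)" using assms(4) by simp
    then have "L * exp (L * \<tau>) * \<bar>f \<tau>\<bar> \<le> L * exp (L * \<tau>) * (A * exp (3 * L * \<tau>))"
      using assms(1) by (intro mult_left_mono) auto
    also have "\<dots> = L * A * exp (4 * L * \<tau>)"
      using exp_add[of "L * \<tau>" "3 * L * \<tau>"] by (simp add: algebra_simps)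
    finally show "norm (L * exp (L * \<tau>) * f \<tau>) \<le> L * A * exp (4 * L * \<tau>)"
      using assms(1) by (simp add: abs_mult)
  qed
  also have "\<dots> = A / 4 * (exp (4 * L * t) - 1)"
    using integral_unique[OF has_integral_exp_scaled[of "4 * L" t "L * A"]] assms(1,2) by simp
  also have "\<dots> \<le> A / 4 * exp (4 * L * t)" using assms(5) by (simp add: algebra_simps)
  finally have "\<bar>integral {0..t} (\<lambda>\<tau>. L * exp (L * \<tau>) * f \<tau>)\<bar> \<le> A / 4 * exp (4 * L * t)" by simp
  then have "exp (- L * t) * \<bar>integral {0..t} (\<lambda>\<tau>. L * exp (L * \<tau>) * f \<tau>)\<bar> \<le> exp (- L * t) * (A / 4 * exp (4 * L * t))"
    by (intro mult_left_mono) auto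
  also have "\<dots> = A / 4 * exp (3 * L * t)"
    using exp_add[of "- L * t" "4 * L * t"] by (simp add: algebra_simps)
  finally show ?thesis by (simp add: abs_mult)
qed

text \<open>What the dynamics needs from kernel and mass: B is a Lipschitz weight for \<Phi> at a
  base point, possibly singular at 0, and K bounds its integral uniformly over separated
  configurations. The singularity of the kernel enters only through these two.\<close>

locale alignment_force =
  fixes \<Omega> :: "real set" and m :: "real measure" and \<Phi> B e :: "real \<Rightarrow> real" and K Rb :: real
  assumes finite_m: "finite_measure m" and sets_m: "sets m = sets borel"
    and m_\<Omega>: "AE \<gamma> in m. \<gamma> \<in> \<Omega>" and m_diffuse: "\<And>x. AE \<gamma> in m. \<gamma> \<noteq> x"
    and open_\<Omega>: "open \<Omega>" and bounded_\<Omega>: "\<And>\<alpha>. \<alpha> \<in> \<Omega> \<Longrightarrow> \<bar>\<alpha>\<bar> \<le> Rb"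
    and mono_\<Phi>: "\<And>a b. a \<le> b \<Longrightarrow> \<Phi> a \<le> \<Phi> b" and cont_\<Phi>: "\<And>z. isCont \<Phi> z"
    and lip_\<Phi>: "\<And>z h. z \<noteq> 0 \<Longrightarrow> \<bar>\<Phi> (z + h) - \<Phi> z\<bar> \<le> \<bar>h\<bar> * B z" and B_nonneg: "\<And>z. 0 \<le> B z"
    and B_int: "\<And>Y \<alpha>. Y \<in> separated \<Omega> e \<Longrightarrow> \<alpha> \<in> \<Omega> \<Longrightarrow> integrable m (\<lambda>\<gamma>. B (Y \<alpha> - Y \<gamma>))"
    and B_le: "\<And>Y \<alpha>. Y \<in> separated \<Omega> e \<Longrightarrow> \<alpha> \<in> \<Omega> \<Longrightarrow> (\<integral>\<gamma>. B (Y \<alpha> - Y \<gamma>) \<partial>m) \<le> K"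
    and K_pos: "0 < K"
    and e_pos: "\<And>d. 0 < d \<Longrightarrow> 0 < e d"
begin

section \<open>Lipschitz bounds for the force on separated configurations\<close>

abbreviation "S \<equiv> separated \<Omega> e"

lemma S_sep: "Y \<in> S \<Longrightarrow> \<alpha> \<in> \<Omega> \<Longrightarrow> \<beta> \<in> \<Omega> \<Longrightarrow> \<alpha> < \<beta> \<Longrightarrow> e (\<beta> - \<alpha>) \<le> Y \<beta> - Y \<alpha>"
  and S_off: "Y \<in> S \<Longrightarrow> \<alpha> \<notin> \<Omega> \<Longrightarrow> Y \<alpha> = 0"
  and S_bdd: "Y \<in> S \<Longrightarrow> bounded (Y ` \<Omega>)"
  by (simp_all add: separated_def)

lemma S_less: "Y \<in> S \<Longrightarrow> \<alpha> \<in> \<Omega> \<Longrightarrow> \<beta> \<in> \<Omega> \<Longrightarrow> \<alpha> < \<beta> \<Longrightarrow> Y \<alpha> < Y \<beta>"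
  using S_sep[of Y \<alpha> \<beta>] e_pos[of "\<beta> - \<alpha>"] by simp

lemma S_inj: "Y \<in> S \<Longrightarrow> \<alpha> \<in> \<Omega> \<Longrightarrow> \<beta> \<in> \<Omega> \<Longrightarrow> \<alpha> \<noteq> \<beta> \<Longrightarrow> Y \<alpha> \<noteq> Y \<beta>"
  using S_less[of Y \<alpha> \<beta>] S_less[of Y \<beta> \<alpha>] by linarith

lemma S_bound: "Y \<in> S \<Longrightarrow> \<exists>b. \<forall>\<gamma>. \<bar>Y \<gamma>\<bar> \<le> b"
proof -
  assume Y: "Y \<in> S"
  obtain b where b: "\<forall>x\<in>Y ` \<Omega>. norm x \<le> b" using S_bdd[OF Y] unfolding bounded_iff by blast
  have "\<bar>Y \<gamma>\<bar> \<le> max b 0" for \<gamma>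
    using b S_off[OF Y, of \<gamma>] by (cases "\<gamma> \<in> \<Omega>") (auto simp: max.coboundedI1)
  then show ?thesis by blast
qed

lemma space_m [simp]: "space m = UNIV"
  using sets_eq_imp_space_eq[OF sets_m] by simp

lemma measurable_m: "f \<in> borel_measurable borel \<Longrightarrow> f \<in> borel_measurable m"
  by (subst measurable_cong_sets[OF sets_m refl])

lemma S_measurable: "Y \<in> S \<Longrightarrow> Y \<in> borel_measurable borel"
  by (rule separated_measurable[OF open_\<Omega> e_pos])

lemma \<Phi>_measurable: "\<Phi> \<in> borel_measurable borel"
  by (rule borel_measurable_continuous_onI, rule continuous_at_imp_continuous_on) (simp add: cont_\<Phi>)

lemma \<Phi>_diff_measurable: "Y \<in> S \<Longrightarrow> (\<lambda>\<gamma>. \<Phi> (x - Y \<gamma>)) \<in> borel_measurable m"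
  by (intro measurable_m measurable_compose[OF _ \<Phi>_measurable] borel_measurable_diff
      borel_measurable_const S_measurable)

lemma \<Phi>_abs_le: "\<bar>z\<bar> \<le> b \<Longrightarrow> \<bar>\<Phi> z\<bar> \<le> \<bar>\<Phi> b\<bar> + \<bar>\<Phi> (- b)\<bar>"
  using mono_\<Phi>[of z b] mono_\<Phi>[of "- b" z] by (auto simp: abs_le_iff)

lemma \<Phi>_integrable: assumes "Y \<in> S" shows "integrable m (\<lambda>\<gamma>. \<Phi> (x - Y \<gamma>))"
proof -
  obtain b where b: "\<And>\<gamma>. \<bar>Y \<gamma>\<bar> \<le> b" using S_bound[OF assms] by blast
  have "\<bar>\<Phi> (x - Y \<gamma>)\<bar> \<le> \<bar>\<Phi> (\<bar>x\<bar> + b)\<bar> + \<bar>\<Phi> (- (\<bar>x\<bar> + b))\<bar>" for \<gamma>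
    by (rule \<Phi>_abs_le) (use b[of \<gamma>] in linarith)
  then show ?thesis
    by (intro finite_measure.integrable_const_bound[OF finite_m _ \<Phi>_diff_measurable[OF assms]] AE_I2) simp
qed

definition F :: "(real \<Rightarrow> real) \<Rightarrow> real \<Rightarrow> real" where
  "F Y \<alpha> = (\<integral>\<gamma>. \<Phi> (Y \<alpha> - Y \<gamma>) \<partial>m)"

lemma AE_ne: assumes "Y \<in> S" "\<alpha> \<in> \<Omega>" shows "AE \<gamma> in m. \<gamma> \<in> \<Omega> \<and> Y \<alpha> - Y \<gamma> \<noteq> 0"
  using m_\<Omega> m_diffuse[of \<alpha>]
proof eventually_elim
  case (elim \<gamma>)
  then show ?case using S_inj[OF assms(1,2), of \<gamma>] by auto
qed

text \<open>The common source of both Lipschitz bounds for F: the shift h is the change of the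
  configuration in \<open>F_lip\<close> and the change of the label in \<open>F_diff\<close>. Labels
  with \<open>Y \<gamma> = Y \<alpha>\<close>, where B may blow up, form a null set.\<close>

lemma integral_shift_bound:
  assumes "Y \<in> S" "\<alpha> \<in> \<Omega>" "integrable m g"
    and "\<And>\<gamma>. \<gamma> \<in> \<Omega> \<Longrightarrow> g \<gamma> = \<Phi> (Y \<alpha> - Y \<gamma> + h \<gamma>)" "\<And>\<gamma>. \<gamma> \<in> \<Omega> \<Longrightarrow> \<bar>h \<gamma>\<bar> \<le> d"
  shows "\<bar>(\<integral>\<gamma>. g \<gamma> \<partial>m) - F Y \<alpha>\<bar> \<le> d * (\<integral>\<gamma>. B (Y \<alpha> - Y \<gamma>) \<partial>m)"
proof -
  have "\<bar>(\<integral>\<gamma>. g \<gamma> \<partial>m) - F Y \<alpha>\<bar> = \<bar>\<integral>\<gamma>. g \<gamma> - \<Phi> (Y \<alpha> - Y \<gamma>) \<partial>m\<bar>"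
    unfolding F_def using Bochner_Integration.integral_diff[OF assms(3) \<Phi>_integrable[OF assms(1), of "Y \<alpha>"]] by simp
  also have "\<dots> \<le> (\<integral>\<gamma>. d * B (Y \<alpha> - Y \<gamma>) \<partial>m)"
  proof (rule order_trans[OF integral_abs_bound], rule integral_mono_AE)
    show "integrable m (\<lambda>\<gamma>. \<bar>g \<gamma> - \<Phi> (Y \<alpha> - Y \<gamma>)\<bar>)"
      by (intro integrable_abs Bochner_Integration.integrable_diff assms(3) \<Phi>_integrable[OF assms(1)])
    show "integrable m (\<lambda>\<gamma>. d * B (Y \<alpha> - Y \<gamma>))"
      by (intro integrable_mult_right B_int assms(1,2))
    show "AE \<gamma> in m. \<bar>g \<gamma> - \<Phi> (Y \<alpha> - Y \<gamma>)\<bar> \<le> d * B (Y \<alpha> - Y \<gamma>)"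
      using AE_ne[OF assms(1,2)]
    proof eventually_elim
      case (elim \<gamma>)
      then have "\<bar>g \<gamma> - \<Phi> (Y \<alpha> - Y \<gamma>)\<bar> \<le> \<bar>h \<gamma>\<bar> * B (Y \<alpha> - Y \<gamma>)"
        using lip_\<Phi>[of "Y \<alpha> - Y \<gamma>" "h \<gamma>"] assms(4)[of \<gamma>] by simp
      also have "\<dots> \<le> d * B (Y \<alpha> - Y \<gamma>)"
        using elim assms(5)[of \<gamma>] B_nonneg by (intro mult_right_mono) auto
      finally show ?case .
    qed
  qed
  also have "\<dots> = d * (\<integral>\<gamma>. B (Y \<alpha> - Y \<gamma>) \<partial>m)" by simp
  finally show ?thesis .
qed

lemma F_lip:
  assumes "Y \<in> S" "Z \<in> S" "\<alpha> \<in> \<Omega>" "\<And>\<gamma>. \<gamma> \<in> \<Omega> \<Longrightarrow> \<bar>Y \<gamma> - Z \<gamma>\<bar> \<le> d"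
  shows "\<bar>F Y \<alpha> - F Z \<alpha>\<bar> \<le> 2 * d * K"
proof -
  have "0 \<le> d" using assms(4)[OF assms(3)] by linarith
  have "\<bar>F Y \<alpha> - F Z \<alpha>\<bar> \<le> (2 * d) * (\<integral>\<gamma>. B (Z \<alpha> - Z \<gamma>) \<partial>m)"
    unfolding F_def[of Y]
  proof (rule integral_shift_bound[OF assms(2,3) \<Phi>_integrable[OF assms(1)],
      of _ "\<lambda>\<gamma>. (Y \<alpha> - Z \<alpha>) - (Y \<gamma> - Z \<gamma>)"])
    show "\<bar>(Y \<alpha> - Z \<alpha>) - (Y \<gamma> - Z \<gamma>)\<bar> \<le> 2 * d" if "\<gamma> \<in> \<Omega>" for \<gamma>
      using assms(4)[OF that] assms(4)[OF assms(3)] by linarith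
  qed simp
  also have "\<dots> \<le> (2 * d) * K" using \<open>0 \<le> d\<close> B_le[OF assms(2,3)] by (intro mult_left_mono) auto
  finally show ?thesis .
qed

lemma F_diff:
  assumes "Y \<in> S" "\<alpha> \<in> \<Omega>" "\<beta> \<in> \<Omega>"
  shows "\<bar>F Y \<beta> - F Y \<alpha>\<bar> \<le> K * \<bar>Y \<beta> - Y \<alpha>\<bar>"
proof -
  have "\<bar>F Y \<beta> - F Y \<alpha>\<bar> \<le> \<bar>Y \<beta> - Y \<alpha>\<bar> * (\<integral>\<gamma>. B (Y \<alpha> - Y \<gamma>) \<partial>m)"
    unfolding F_def[of Y \<beta>]
    by (rule integral_shift_bound[OF assms(1,2) \<Phi>_integrable[OF assms(1)], of _ "\<lambda>\<gamma>. Y \<beta> - Y \<alpha>"]) auto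
  also have "\<dots> \<le> \<bar>Y \<beta> - Y \<alpha>\<bar> * K" using B_le[OF assms(1,2)] by (intro mult_left_mono) auto
  finally show ?thesis by (simp add: mult.commute)
qed

lemma F_mono:
  assumes "Y \<in> S" "\<alpha> \<in> \<Omega>" "\<beta> \<in> \<Omega>" "\<alpha> \<le> \<beta>" shows "F Y \<alpha> \<le> F Y \<beta>"
proof -
  have "Y \<alpha> \<le> Y \<beta>" using S_less[OF assms(1-3)] assms(4) by (cases "\<alpha> = \<beta>") auto
  then show ?thesis unfolding F_def
    by (intro integral_mono \<Phi>_integrable assms(1) mono_\<Phi>) auto
qed

lemma F_bounded: assumes "Y \<in> S" shows "\<exists>C. \<forall>\<alpha>\<in>\<Omega>. \<bar>F Y \<alpha>\<bar> \<le> C"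
proof (cases "\<Omega> = {}")
  case False
  then obtain \<beta> where \<beta>: "\<beta> \<in> \<Omega>" by blast
  obtain b where b: "\<And>\<gamma>. \<bar>Y \<gamma>\<bar> \<le> b" using S_bound[OF assms] by blast
  have "\<bar>F Y \<alpha>\<bar> \<le> \<bar>F Y \<beta>\<bar> + K * (2 * b)" if "\<alpha> \<in> \<Omega>" for \<alpha>
  proof -
    have "K * \<bar>Y \<alpha> - Y \<beta>\<bar> \<le> K * (2 * b)"
      using K_pos b[of \<alpha>] b[of \<beta>] by (intro mult_left_mono) linarith+
    then show ?thesis using F_diff[OF assms \<beta> that] by linarith
  qed
  then show ?thesis by blast
qed simp

end

text \<open>\<open>invariant\<close> is the barrier condition: pairs within twice their minimal
  distance are not driven towards each other. The factor 2 is the room that one Euler step of finite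
  length needs.\<close>

locale lagrangian_system = alignment_force +
  fixes \<psi> :: "real \<Rightarrow> real" and Pb :: real
  assumes invariant: "\<And>Y \<alpha> \<beta>. Y \<in> S \<Longrightarrow> \<alpha> \<in> \<Omega> \<Longrightarrow> \<beta> \<in> \<Omega> \<Longrightarrow> \<alpha> < \<beta> \<Longrightarrow>
        Y \<beta> - Y \<alpha> \<le> 2 * e (\<beta> - \<alpha>) \<Longrightarrow> F Y \<beta> - F Y \<alpha> \<le> \<psi> \<beta> - \<psi> \<alpha>"
    and e_le: "\<And>\<alpha> \<beta>. \<alpha> \<in> \<Omega> \<Longrightarrow> \<beta> \<in> \<Omega> \<Longrightarrow> \<alpha> < \<beta> \<Longrightarrow> e (\<beta> - \<alpha>) \<le> \<beta> - \<alpha>"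
    and \<psi>_mono: "\<And>\<alpha> \<beta>. \<alpha> \<in> \<Omega> \<Longrightarrow> \<beta> \<in> \<Omega> \<Longrightarrow> \<alpha> \<le> \<beta> \<Longrightarrow> \<psi> \<alpha> \<le> \<psi> \<beta>"
    and \<psi>_bounded: "\<And>\<alpha>. \<alpha> \<in> \<Omega> \<Longrightarrow> \<bar>\<psi> \<alpha>\<bar> \<le> Pb"
begin

text \<open>An Euler step of length 1/L shrinks a distance D by at most
  \<open>K * D / L = D / 2\<close>, which matches the factor 2 in \<open>invariant\<close>.\<close>

definition L :: real where "L = 2 * K"

lemma L_pos: "0 < L" using K_pos by (simp add: L_def)

text \<open>An explicit Euler step of length \<open>1 / L\<close>. Since it maps the convex set \<open>S\<close> to itself, the
  equation in the form \<open>X' = L (G X - X)\<close> has Duhamel iterates that stay in \<open>S\<close>.\<close>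
definition G :: "(real \<Rightarrow> real) \<Rightarrow> real \<Rightarrow> real" where
  "G Y \<alpha> = (if \<alpha> \<in> \<Omega> then Y \<alpha> + (\<psi> \<alpha> - F Y \<alpha>) / L else 0)"

lemma G_in_S: assumes "Y \<in> S" shows "G Y \<in> S"
proof -
  have "bounded (G Y ` \<Omega>)"
  proof -
    obtain b where b: "\<And>\<gamma>. \<bar>Y \<gamma>\<bar> \<le> b" using S_bound[OF assms] by blast
    obtain C where C: "\<forall>\<alpha>\<in>\<Omega>. \<bar>F Y \<alpha>\<bar> \<le> C" using F_bounded[OF assms] by blast
    have "\<bar>G Y \<alpha>\<bar> \<le> b + (Pb + C) / L" if "\<alpha> \<in> \<Omega>" for \<alpha>
    proof -
      have "\<bar>\<psi> \<alpha> - F Y \<alpha>\<bar> \<le> Pb + C"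
        using C[rule_format, OF that] \<psi>_bounded[OF that] by linarith
      then have "\<bar>(\<psi> \<alpha> - F Y \<alpha>) / L\<bar> \<le> (Pb + C) / L"
        using L_pos by (simp only: abs_divide abs_of_pos divide_right_mono less_imp_le)
      then have "\<bar>Y \<alpha> + (\<psi> \<alpha> - F Y \<alpha>) / L\<bar> \<le> b + (Pb + C) / L"
        using b[of \<alpha>] abs_triangle_ineq[of "Y \<alpha>" "(\<psi> \<alpha> - F Y \<alpha>) / L"] by linarith
      then show ?thesis using that by (simp only: G_def if_True)
    qed
    then show ?thesis unfolding bounded_iff by (intro exI[of _ "b + (Pb + C) / L"]) simp
  qed
  moreover have "e (\<beta> - \<alpha>) \<le> G Y \<beta> - G Y \<alpha>" if "\<alpha> \<in> \<Omega>" "\<beta> \<in> \<Omega>" "\<alpha> < \<beta>" for \<alpha> \<beta>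
  proof -
    define D where "D = Y \<beta> - Y \<alpha>"
    have D: "e (\<beta> - \<alpha>) \<le> D" "0 < e (\<beta> - \<alpha>)"
      using S_sep[OF assms that] e_pos[of "\<beta> - \<alpha>"] that by (auto simp: D_def)
    have eq: "G Y \<beta> - G Y \<alpha> = D + ((\<psi> \<beta> - \<psi> \<alpha>) - (F Y \<beta> - F Y \<alpha>)) / L"
      using that by (simp add: G_def D_def diff_divide_distrib)
    show ?thesis
    \<comment> \<open>Near the minimal distance the step does not decrease D, by the barrier
      condition; otherwise the step leaves at least D / 2, which still exceeds the minimum.\<close>
    proof (cases "D \<le> 2 * e (\<beta> - \<alpha>)")
      case True
      then have "F Y \<beta> - F Y \<alpha> \<le> \<psi> \<beta> - \<psi> \<alpha>"
        using invariant[OF assms that] by (simp add: D_def)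
      then show ?thesis using D L_pos eq by (simp add: add_increasing2)
    next
      case False
      have "F Y \<beta> - F Y \<alpha> \<le> K * D"
        using F_diff[OF assms that(1,2)] D by (simp add: D_def)
      moreover have "\<psi> \<alpha> \<le> \<psi> \<beta>" using \<psi>_mono that by simp
      ultimately have "- (K * D) / L \<le> ((\<psi> \<beta> - \<psi> \<alpha>) - (F Y \<beta> - F Y \<alpha>)) / L"
        using L_pos by (intro divide_right_mono) auto
      moreover have "- (K * D) / L = - D / 2" using K_pos by (simp add: L_def)
      ultimately have "- D / 2 \<le> ((\<psi> \<beta> - \<psi> \<alpha>) - (F Y \<beta> - F Y \<alpha>)) / L" by linarith
      moreover have "e (\<beta> - \<alpha>) \<le> D + - D / 2" using False by simp
      ultimately show ?thesis unfolding eq by (meson add_left_mono order_trans)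
    qed
  qed
  ultimately show ?thesis by (auto simp: separated_def G_def)
qed

text \<open>One d comes from the identity part of the step, the other from
  \<open>2 * d * K / L\<close>.\<close>

lemma G_lip:
  assumes "Y \<in> S" "Z \<in> S" "\<alpha> \<in> \<Omega>" "\<And>\<gamma>. \<gamma> \<in> \<Omega> \<Longrightarrow> \<bar>Y \<gamma> - Z \<gamma>\<bar> \<le> d"
  shows "\<bar>G Y \<alpha> - G Z \<alpha>\<bar> \<le> 2 * d"
proof -
  have "\<bar>(F Z \<alpha> - F Y \<alpha>) / L\<bar> \<le> d"
    using F_lip[OF assms] K_pos by (simp add: L_def abs_minus_commute pos_divide_le_eq algebra_simps)
  moreover have "G Y \<alpha> - G Z \<alpha> = (Y \<alpha> - Z \<alpha>) + (F Z \<alpha> - F Y \<alpha>) / L"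
    using assms(3) by (simp add: G_def diff_divide_distrib)
  ultimately show ?thesis using assms(4)[OF assms(3)] by linarith
qed

text \<open>Displacements are measured in a Bielecki norm with weight
  \<open>exp (3 * L * t)\<close>, in which the Picard map contracts for all times at once, with no
  need to glue local solutions.\<close>

definition admissible :: "(real \<Rightarrow> real \<Rightarrow> real) \<Rightarrow> bool" where
  "admissible X \<longleftrightarrow> (\<forall>t\<ge>0. (\<lambda>\<alpha>. X \<alpha> t) \<in> S) \<and> (\<forall>\<alpha>\<in>\<Omega>. continuous_on {0..} (X \<alpha>)) \<and>
     (\<exists>A\<ge>0. \<forall>\<alpha>\<in>\<Omega>. \<forall>t\<ge>0. \<bar>X \<alpha> t - \<alpha>\<bar> \<le> A * exp (3 * L * t))"

lemma admissible_S: "admissible X \<Longrightarrow> 0 \<le> t \<Longrightarrow> (\<lambda>\<alpha>. X \<alpha> t) \<in> S"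
  and admissible_cont: "admissible X \<Longrightarrow> \<alpha> \<in> \<Omega> \<Longrightarrow> continuous_on {0..} (X \<alpha>)"
  by (simp_all add: admissible_def)

lemma admissible_bound:
  assumes "admissible X" shows "\<exists>b. \<forall>\<alpha>\<in>\<Omega>. \<forall>t\<in>{0..T}. \<bar>X \<alpha> t\<bar> \<le> b"
proof -
  obtain A where A: "0 \<le> A" "\<forall>\<alpha>\<in>\<Omega>. \<forall>t\<ge>0. \<bar>X \<alpha> t - \<alpha>\<bar> \<le> A * exp (3 * L * t)"
    using assms unfolding admissible_def by metis
  have "\<bar>X \<alpha> t\<bar> \<le> Rb + A * exp (3 * L * T)" if "\<alpha> \<in> \<Omega>" "t \<in> {0..T}" for \<alpha> t
  proof -
    have "A * exp (3 * L * t) \<le> A * exp (3 * L * T)"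
      using A(1) L_pos that by (intro mult_left_mono) auto
    moreover have "\<bar>X \<alpha> t - \<alpha>\<bar> \<le> A * exp (3 * L * t)" using A(2) that by simp
    ultimately show ?thesis using bounded_\<Omega>[OF that(1)] by linarith
  qed
  then show ?thesis by blast
qed

lemma continuous_F:
  assumes "admissible X" "\<alpha> \<in> \<Omega>"
  shows "continuous_on {0..} (\<lambda>t. F (\<lambda>\<gamma>. X \<gamma> t) \<alpha>)"
proof (rule continuous_on_sequentiallyI)
  fix u :: "nat \<Rightarrow> real" and a
  assume u: "\<forall>n. u n \<in> {0..}" "a \<in> {0..}" "u \<longlonglongrightarrow> a"
  obtain T where T: "\<And>n. \<bar>u n\<bar> \<le> T"
    using Bseq_def[of u] convergent_imp_Bseq[of u] u(3) unfolding convergent_def by fastforce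
  obtain b where b: "\<forall>\<alpha>\<in>\<Omega>. \<forall>t\<in>{0..T}. \<bar>X \<alpha> t\<bar> \<le> b"
    using admissible_bound[OF assms(1)] by blast
  have lim: "(\<lambda>n. X \<gamma> (u n)) \<longlonglongrightarrow> X \<gamma> a" if "\<gamma> \<in> \<Omega>" for \<gamma>
    using admissible_cont[OF assms(1) that] u unfolding continuous_on_sequentially comp_def by blast
  have unT: "u n \<in> {0..T}" for n using T[of n] u(1) by (auto simp: abs_le_iff)
  show "(\<lambda>n. F (\<lambda>\<gamma>. X \<gamma> (u n)) \<alpha>) \<longlonglongrightarrow> F (\<lambda>\<gamma>. X \<gamma> a) \<alpha>"
    unfolding F_def
  proof (rule integral_dominated_convergence[where w = "\<lambda>_. \<bar>\<Phi> (2 * b)\<bar> + \<bar>\<Phi> (- (2 * b))\<bar>"])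
    show "(\<lambda>\<gamma>. \<Phi> (X \<alpha> a - X \<gamma> a)) \<in> borel_measurable m"
      by (rule \<Phi>_diff_measurable[OF admissible_S[OF assms(1)]]) (use u in simp)
    show "(\<lambda>\<gamma>. \<Phi> (X \<alpha> (u n) - X \<gamma> (u n))) \<in> borel_measurable m" for n
      by (rule \<Phi>_diff_measurable[OF admissible_S[OF assms(1)]]) (use u in simp)
    show "integrable m (\<lambda>_. \<bar>\<Phi> (2 * b)\<bar> + \<bar>\<Phi> (- (2 * b))\<bar>)"
      by (rule finite_measure.integrable_const[OF finite_m])
    show "AE \<gamma> in m. (\<lambda>n. \<Phi> (X \<alpha> (u n) - X \<gamma> (u n))) \<longlonglongrightarrow> \<Phi> (X \<alpha> a - X \<gamma> a)"
      using m_\<Omega> by eventually_elim (intro isCont_tendsto_compose[OF cont_\<Phi>] tendsto_diff lim assms(2))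
    show "AE \<gamma> in m. norm (\<Phi> (X \<alpha> (u n) - X \<gamma> (u n))) \<le> \<bar>\<Phi> (2 * b)\<bar> + \<bar>\<Phi> (- (2 * b))\<bar>" for n
      using m_\<Omega>
    proof eventually_elim
      case (elim \<gamma>)
      have "\<bar>X \<alpha> (u n)\<bar> \<le> b" "\<bar>X \<gamma> (u n)\<bar> \<le> b" using b unT assms(2) elim by blast+
      then show ?case unfolding real_norm_def by (intro \<Phi>_abs_le) linarith
    qed
  qed
qed

lemma continuous_G:
  assumes "admissible X" "\<alpha> \<in> \<Omega>"
  shows "continuous_on {0..} (\<lambda>t. G (\<lambda>\<gamma>. X \<gamma> t) \<alpha>)"
  using assms(2) L_pos continuous_F[OF assms] admissible_cont[OF assms]
  unfolding G_def by (simp add: continuous_on_add continuous_on_divide continuous_on_diff)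

text \<open>Variation of constants. The weight \<open>exp (- L * t)\<close> of the initial label and
  the weights of the values of G have total mass 1, so the result is a convex average of separated
  configurations.\<close>

definition picard :: "(real \<Rightarrow> real \<Rightarrow> real) \<Rightarrow> real \<Rightarrow> real \<Rightarrow> real" where
  "picard X \<alpha> t = (if \<alpha> \<in> \<Omega> then
     exp (- L * t) * (\<alpha> + integral {0..t} (\<lambda>\<tau>. L * exp (L * \<tau>) * G (\<lambda>\<gamma>. X \<gamma> \<tau>) \<alpha>)) else 0)"

lemma picard_integrable:
  assumes "admissible X" "\<alpha> \<in> \<Omega>"
  shows "(\<lambda>\<tau>. L * exp (L * \<tau>) * G (\<lambda>\<gamma>. X \<gamma> \<tau>) \<alpha>) integrable_on {0..t}"
  by (intro integrable_continuous_interval continuous_intros continuous_on_subset[OF continuous_G[OF assms]]) auto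

lemma weight_integral: "0 \<le> t \<Longrightarrow> integral {0..t} (\<lambda>\<tau>. L * exp (L * \<tau>)) = exp (L * t) - 1"
  using integral_unique[OF has_integral_exp_scaled[of L t L]] L_pos by simp

lemma weight_integral_const:
  "0 \<le> t \<Longrightarrow> integral {0..t} (\<lambda>\<tau>. L * exp (L * \<tau>) * c) = (exp (L * t) - 1) * c"
  using weight_integral[of t] by simp

lemma weight_integrable: "(\<lambda>\<tau>. L * exp (L * \<tau>) * c) integrable_on {0..t}"
  by (intro integrable_continuous_interval continuous_intros)

lemma picard_has_derivative:
  assumes "admissible X" "\<alpha> \<in> \<Omega>" "0 \<le> t"
  shows "(picard X \<alpha> has_real_derivative L * (G (\<lambda>\<gamma>. X \<gamma> t) \<alpha> - picard X \<alpha> t)) (at t within {0..})"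
proof -
  let ?g = "\<lambda>\<tau>. L * exp (L * \<tau>) * G (\<lambda>\<gamma>. X \<gamma> \<tau>) \<alpha>"
  have "continuous_on {0..} ?g"
    by (intro continuous_intros continuous_G[OF assms(1,2)])
  then have "((\<lambda>t. integral {0..t} ?g) has_real_derivative ?g t) (at t within {0..})"
    by (rule has_real_derivative_integral_within_Ici[OF _ assms(3)])
  then have "((\<lambda>t. exp (- L * t) * (\<alpha> + integral {0..t} ?g)) has_real_derivative
      exp (- L * t) * (- L) * (\<alpha> + integral {0..t} ?g) + exp (- L * t) * ?g t) (at t within {0..})"
    by (auto intro!: derivative_eq_intros)
  moreover have "exp (- L * t) * ?g t = L * G (\<lambda>\<gamma>. X \<gamma> t) \<alpha>"
    using exp_add[of "- L * t" "L * t"] by (simp add: mult.assoc[symmetric])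
  moreover have P: "picard X \<alpha> = (\<lambda>t. exp (- L * t) * (\<alpha> + integral {0..t} ?g))"
    using assms(2) by (auto simp: picard_def)
  moreover have "exp (- L * t) * (- L) * (\<alpha> + integral {0..t} ?g) = - (L * picard X \<alpha> t)"
    unfolding P by simp
  ultimately show ?thesis by (simp only: right_diff_distrib) (simp only: add.commute minus_add_distrib diff_conv_add_uminus)
qed

text \<open>The comparison function g is left free: the values of G along a second flow give the
  contraction, and the constant \<alpha> gives the displacement bound.\<close>

lemma picard_diff:
  assumes "0 \<le> t" "\<alpha> \<in> \<Omega>" "admissible X" "continuous_on {0..} g"
    and "\<And>\<tau>. 0 \<le> \<tau> \<Longrightarrow> \<bar>G (\<lambda>\<gamma>. X \<gamma> \<tau>) \<alpha> - g \<tau>\<bar> \<le> A * exp (3 * L * \<tau>)" "0 \<le> A"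
  shows "\<bar>picard X \<alpha> t - exp (- L * t) * (\<alpha> + integral {0..t} (\<lambda>\<tau>. L * exp (L * \<tau>) * g \<tau>))\<bar>
      \<le> A / 4 * exp (3 * L * t)"
proof -
  let ?f = "\<lambda>\<tau>. G (\<lambda>\<gamma>. X \<gamma> \<tau>) \<alpha>"
  have "integral {0..t} (\<lambda>\<tau>. L * exp (L * \<tau>) * (?f \<tau> - g \<tau>)) =
      integral {0..t} (\<lambda>\<tau>. L * exp (L * \<tau>) * ?f \<tau>) - integral {0..t} (\<lambda>\<tau>. L * exp (L * \<tau>) * g \<tau>)"
    unfolding right_diff_distrib
    by (intro Henstock_Kurzweil_Integration.integral_diff picard_integrable assms
        integrable_continuous_interval continuous_intros continuous_on_subset[OF assms(4)]) auto
  note eq = this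
  have "picard X \<alpha> t - exp (- L * t) * (\<alpha> + integral {0..t} (\<lambda>\<tau>. L * exp (L * \<tau>) * g \<tau>)) =
      exp (- L * t) * integral {0..t} (\<lambda>\<tau>. L * exp (L * \<tau>) * (?f \<tau> - g \<tau>))"
    unfolding picard_def if_P[OF assms(2)] eq by (simp only: distrib_left right_diff_distrib)
  then show ?thesis
    using weighted_integral_bound[OF L_pos assms(1) continuous_on_diff[OF continuous_G[OF assms(3,2)] assms(4)] assms(5,6)]
    by simp
qed

lemma picard_contraction:
  assumes "admissible X" "admissible Y" "0 \<le> A" "\<alpha> \<in> \<Omega>" "0 \<le> t"
    and "\<And>\<alpha> t. \<alpha> \<in> \<Omega> \<Longrightarrow> 0 \<le> t \<Longrightarrow> \<bar>X \<alpha> t - Y \<alpha> t\<bar> \<le> A * exp (3 * L * t)"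
  shows "\<bar>picard X \<alpha> t - picard Y \<alpha> t\<bar> \<le> A / 2 * exp (3 * L * t)"
proof -
  have "\<bar>picard X \<alpha> t - exp (- L * t) *
      (\<alpha> + integral {0..t} (\<lambda>\<tau>. L * exp (L * \<tau>) * G (\<lambda>\<gamma>. Y \<gamma> \<tau>) \<alpha>))\<bar> \<le> (2 * A) / 4 * exp (3 * L * t)"
  proof (rule picard_diff[OF assms(5,4,1) continuous_G[OF assms(2,4)]])
    fix \<tau> :: real assume "0 \<le> \<tau>"
    then show "\<bar>G (\<lambda>\<gamma>. X \<gamma> \<tau>) \<alpha> - G (\<lambda>\<gamma>. Y \<gamma> \<tau>) \<alpha>\<bar> \<le> 2 * A * exp (3 * L * \<tau>)"
      using G_lip[OF admissible_S[OF assms(1)] admissible_S[OF assms(2)] assms(4), of \<tau> \<tau> "A * exp (3 * L * \<tau>)"]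
        assms(6) by simp
  qed (use assms(3) in simp)
  then show ?thesis using assms(4) by (simp add: picard_def)
qed

definition X0 :: "real \<Rightarrow> real \<Rightarrow> real" where "X0 \<alpha> t = (if \<alpha> \<in> \<Omega> then \<alpha> else 0)"

lemma admissible_X0: "admissible X0"
proof -
  have "bounded ((\<lambda>\<alpha>. if \<alpha> \<in> \<Omega> then \<alpha> else 0) ` \<Omega>)"
    unfolding bounded_iff using bounded_\<Omega> by (intro exI[of _ Rb]) simp
  then have "(\<lambda>\<alpha>. X0 \<alpha> t) \<in> S" for t
    using e_le by (simp add: separated_def X0_def)
  moreover have "continuous_on {0..} (X0 \<alpha>)" if "\<alpha> \<in> \<Omega>" for \<alpha>
    using that by (simp add: X0_def[abs_def])
  moreover have "\<exists>A\<ge>0. \<forall>\<alpha>\<in>\<Omega>. \<forall>t\<ge>0. \<bar>X0 \<alpha> t - \<alpha>\<bar> \<le> A * exp (3 * L * t)"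
    by (rule exI[of _ 0]) (simp add: X0_def)
  ultimately show ?thesis by (simp add: admissible_def)
qed

lemma picard_initial_bound:
  assumes "admissible X"
  shows "\<exists>A\<ge>0. \<forall>\<alpha>\<in>\<Omega>. \<forall>t\<ge>0. \<bar>picard X \<alpha> t - \<alpha>\<bar> \<le> A * exp (3 * L * t)"
proof -
  obtain A where A: "0 \<le> A" "\<forall>\<alpha>\<in>\<Omega>. \<forall>t\<ge>0. \<bar>X \<alpha> t - \<alpha>\<bar> \<le> A * exp (3 * L * t)"
    using assms unfolding admissible_def by metis
  let ?Z = "\<lambda>\<gamma>. X0 \<gamma> 0"
  have Z: "?Z \<in> S" using admissible_S[OF admissible_X0, of 0] by simp
  obtain C where C: "\<forall>\<alpha>\<in>\<Omega>. \<bar>F ?Z \<alpha>\<bar> \<le> C" using F_bounded[OF Z] by blast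
  define C' where "C' = (\<bar>Pb\<bar> + \<bar>C\<bar>) / L"
  have "0 \<le> C'" using L_pos by (simp add: C'_def)
  have GZ: "\<bar>G ?Z \<alpha> - \<alpha>\<bar> \<le> C'" if "\<alpha> \<in> \<Omega>" for \<alpha>
  proof -
    have "\<bar>\<psi> \<alpha> - F ?Z \<alpha>\<bar> \<le> \<bar>Pb\<bar> + \<bar>C\<bar>"
      using C[rule_format, OF that] \<psi>_bounded[OF that] by linarith
    then have "\<bar>\<psi> \<alpha> - F ?Z \<alpha>\<bar> / L \<le> C'" unfolding C'_def
      using L_pos by (intro divide_right_mono) auto
    then show ?thesis using that L_pos by (simp add: G_def X0_def)
  qed
  have "\<bar>picard X \<alpha> t - \<alpha>\<bar> \<le> (2 * A + C') / 4 * exp (3 * L * t)" if "\<alpha> \<in> \<Omega>" "0 \<le> t" for \<alpha> t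
  proof -
    \<comment> \<open>The Duhamel formula applied to the constant \<alpha> returns \<alpha>, so this
      estimates the displacement from the label.\<close>
    have "\<bar>picard X \<alpha> t - exp (- L * t) *
      (\<alpha> + integral {0..t} (\<lambda>\<tau>. L * exp (L * \<tau>) * \<alpha>))\<bar> \<le> (2 * A + C') / 4 * exp (3 * L * t)"
    proof (rule picard_diff[OF that(2,1) assms continuous_on_const])
      fix \<tau> :: real assume \<tau>: "0 \<le> \<tau>"
      have "\<bar>G (\<lambda>\<gamma>. X \<gamma> \<tau>) \<alpha> - G ?Z \<alpha>\<bar> \<le> 2 * (A * exp (3 * L * \<tau>))"
        by (rule G_lip[OF admissible_S[OF assms \<tau>] Z that(1)]) (use A(2) \<tau> in \<open>simp add: X0_def\<close>)
      moreover have "C' \<le> C' * exp (3 * L * \<tau>)"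
        using \<open>0 \<le> C'\<close> L_pos \<tau> by (simp add: mult_le_cancel_left1)
      ultimately show "\<bar>G (\<lambda>\<gamma>. X \<gamma> \<tau>) \<alpha> - \<alpha>\<bar> \<le> (2 * A + C') * exp (3 * L * \<tau>)"
        using GZ[OF that(1)] unfolding distrib_right by linarith
    qed (use A \<open>0 \<le> C'\<close> in simp)
    moreover have "exp (- L * t) * (\<alpha> + integral {0..t} (\<lambda>\<tau>. L * exp (L * \<tau>) * \<alpha>)) = \<alpha>"
      using weight_integral_const[OF that(2), of \<alpha>] exp_add[of "- L * t" "L * t"]
      by (simp add: algebra_simps)
    ultimately show ?thesis by simp
  qed
  moreover have "0 \<le> (2 * A + C') / 4" using A \<open>0 \<le> C'\<close> by simp
  ultimately show ?thesis by blast
qed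

lemma picard_admissible:
  assumes "admissible X" shows "admissible (picard X)"
proof -
  obtain A where A: "0 \<le> A" "\<forall>\<alpha>\<in>\<Omega>. \<forall>t\<ge>0. \<bar>picard X \<alpha> t - \<alpha>\<bar> \<le> A * exp (3 * L * t)"
    using picard_initial_bound[OF assms] by metis
  have "(\<lambda>\<alpha>. picard X \<alpha> t) \<in> S" if "0 \<le> t" for t
  proof -
    have "\<bar>picard X \<alpha> t\<bar> \<le> Rb + A * exp (3 * L * t)" if "\<alpha> \<in> \<Omega>" for \<alpha>
      using A(2)[rule_format, OF that \<open>0 \<le> t\<close>] bounded_\<Omega>[OF that] by linarith
    then have "bounded ((\<lambda>\<alpha>. picard X \<alpha> t) ` \<Omega>)"
      unfolding bounded_iff by (intro exI[of _ "Rb + A * exp (3 * L * t)"]) simp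
    moreover have "e (\<beta> - \<alpha>) \<le> picard X \<beta> t - picard X \<alpha> t" if ab: "\<alpha> \<in> \<Omega>" "\<beta> \<in> \<Omega>" "\<alpha> < \<beta>" for \<alpha> \<beta>
    proof -
      let ?g = "\<lambda>\<alpha> \<tau>. L * exp (L * \<tau>) * G (\<lambda>\<gamma>. X \<gamma> \<tau>) \<alpha>"
      \<comment> \<open>The lower bound passes through the convex average: the integral contributes
        exp(L t) - 1 times the minimal distance, the initial labels contribute the missing single
        copy.\<close>
      have "(exp (L * t) - 1) * e (\<beta> - \<alpha>) = integral {0..t} (\<lambda>\<tau>. L * exp (L * \<tau>) * e (\<beta> - \<alpha>))"
        by (rule weight_integral_const[OF \<open>0 \<le> t\<close>, symmetric])
      also have "\<dots> \<le> integral {0..t} (\<lambda>\<tau>. ?g \<beta> \<tau> - ?g \<alpha> \<tau>)"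
      proof (rule integral_le[OF weight_integrable])
        show "(\<lambda>\<tau>. ?g \<beta> \<tau> - ?g \<alpha> \<tau>) integrable_on {0..t}"
          by (intro integrable_diff picard_integrable assms ab)
        fix \<tau> assume "\<tau> \<in> {0..t}"
        then have "e (\<beta> - \<alpha>) \<le> G (\<lambda>\<gamma>. X \<gamma> \<tau>) \<beta> - G (\<lambda>\<gamma>. X \<gamma> \<tau>) \<alpha>"
          by (intro S_sep[OF G_in_S[OF admissible_S[OF assms]] ab]) simp
        then have "L * exp (L * \<tau>) * e (\<beta> - \<alpha>) \<le>
            L * exp (L * \<tau>) * (G (\<lambda>\<gamma>. X \<gamma> \<tau>) \<beta> - G (\<lambda>\<gamma>. X \<gamma> \<tau>) \<alpha>)"
          using L_pos by (intro mult_left_mono) auto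
        then show "L * exp (L * \<tau>) * e (\<beta> - \<alpha>) \<le> ?g \<beta> \<tau> - ?g \<alpha> \<tau>"
          by (simp only: right_diff_distrib)
      qed
      also have "\<dots> = integral {0..t} (?g \<beta>) - integral {0..t} (?g \<alpha>)"
        by (intro Henstock_Kurzweil_Integration.integral_diff picard_integrable assms ab)
      finally have "exp (L * t) * e (\<beta> - \<alpha>) \<le> \<beta> - \<alpha> + (integral {0..t} (?g \<beta>) - integral {0..t} (?g \<alpha>))"
        using e_le[OF ab] by (simp add: algebra_simps)
      then have "exp (- L * t) * (exp (L * t) * e (\<beta> - \<alpha>)) \<le>
          exp (- L * t) * (\<beta> - \<alpha> + (integral {0..t} (?g \<beta>) - integral {0..t} (?g \<alpha>)))"
        by (intro mult_left_mono) auto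
      also have "exp (- L * t) * (exp (L * t) * e (\<beta> - \<alpha>)) = e (\<beta> - \<alpha>)"
        using exp_add[of "- L * t" "L * t"] by (simp add: mult.assoc[symmetric])
      also have "exp (- L * t) * (\<beta> - \<alpha> + (integral {0..t} (?g \<beta>) - integral {0..t} (?g \<alpha>))) =
          picard X \<beta> t - picard X \<alpha> t"
        using ab by (simp add: picard_def algebra_simps)
      finally show ?thesis .
    qed
    ultimately show ?thesis by (simp add: separated_def) (simp add: picard_def)
  qed
  moreover have "continuous_on {0..} (picard X \<alpha>)" if "\<alpha> \<in> \<Omega>" for \<alpha>
    by (rule DERIV_continuous_on, rule picard_has_derivative[OF assms that]) simp
  ultimately show ?thesis unfolding admissible_def using A by blast
qed

lemma separated_limit:
  assumes "\<And>n. Y n \<in> S" "\<And>\<alpha>. \<alpha> \<in> \<Omega> \<Longrightarrow> (\<lambda>n. Y n \<alpha>) \<longlonglongrightarrow> Z \<alpha>" "\<And>\<alpha>. \<alpha> \<in> \<Omega> \<Longrightarrow> \<bar>Z \<alpha>\<bar> \<le> b"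
    and "\<And>\<alpha>. \<alpha> \<notin> \<Omega> \<Longrightarrow> Z \<alpha> = 0"
  shows "Z \<in> S"
proof -
  have "bounded (Z ` \<Omega>)" unfolding bounded_iff using assms(3) by (intro exI[of _ b]) simp
  moreover have "e (\<beta> - \<alpha>) \<le> Z \<beta> - Z \<alpha>" if "\<alpha> \<in> \<Omega>" "\<beta> \<in> \<Omega>" "\<alpha> < \<beta>" for \<alpha> \<beta>
    by (rule LIMSEQ_le_const[OF tendsto_diff[OF assms(2)[OF that(2)] assms(2)[OF that(1)]]])
      (use S_sep[OF assms(1) that] in blast)
  ultimately show ?thesis using assms(4) by (simp add: separated_def)
qed

theorem global_flow_exists:
  obtains X where "admissible X" "\<And>\<alpha>. \<alpha> \<in> \<Omega> \<Longrightarrow> X \<alpha> 0 = \<alpha>"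
    "\<And>\<alpha> t. \<alpha> \<in> \<Omega> \<Longrightarrow> 0 \<le> t \<Longrightarrow>
       (X \<alpha> has_real_derivative \<psi> \<alpha> - F (\<lambda>\<gamma>. X \<gamma> t) \<alpha>) (at t within {0..})"
proof -
  define Xn where "Xn n = (picard ^^ n) X0" for n
  have Xn_Suc: "Xn (Suc n) = picard (Xn n)" for n by (simp add: Xn_def)
  have adm: "admissible (Xn n)" for n
    by (induction n) (simp_all add: Xn_Suc picard_admissible, simp add: Xn_def admissible_X0)
  obtain A where A: "0 \<le> A" "\<forall>\<alpha>\<in>\<Omega>. \<forall>t\<ge>0. \<bar>picard X0 \<alpha> t - \<alpha>\<bar> \<le> A * exp (3 * L * t)"
    using picard_initial_bound[OF admissible_X0] by metis
  have step: "\<bar>Xn (Suc n) \<alpha> t - Xn n \<alpha> t\<bar> \<le> A * (1/2) ^ n * exp (3 * L * t)" if "\<alpha> \<in> \<Omega>" "0 \<le> t" for n \<alpha> t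
    using that
  proof (induction n arbitrary: \<alpha> t)
    case 0
    then show ?case using A(2) by (simp add: Xn_def X0_def)
  next
    case (Suc n)
    then show ?case
      using picard_contraction[OF adm[of "Suc n"] adm[of n], of "A * (1/2) ^ n" \<alpha> t] A(1)
      by (simp add: Xn_Suc)
  qed
  \<comment> \<open>The last factor is the exact partial geometric sum, which lets the induction on
    k close.\<close>
  have far: "\<bar>Xn (n + k) \<alpha> t - Xn n \<alpha> t\<bar> \<le> 2 * A * (1/2) ^ n * exp (3 * L * t) * (1 - (1/2) ^ k)"
    if "\<alpha> \<in> \<Omega>" "0 \<le> t" for n k \<alpha> t
  proof (induction k)
    case (Suc k)
    have "A * (1/2) ^ (n + k) * exp (3 * L * t) =
        2 * A * (1/2) ^ n * exp (3 * L * t) * (1 - (1/2) ^ Suc k) - 2 * A * (1/2) ^ n * exp (3 * L * t) * (1 - (1/2) ^ k)"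
      by (simp add: power_add algebra_simps)
    then show ?case using Suc step[OF that, of "n + k"] by simp
  qed simp
  have far': "\<bar>Xn (n + k) \<alpha> t - Xn n \<alpha> t\<bar> \<le> 2 * A * (1/2) ^ n * exp (3 * L * t)"
    if "\<alpha> \<in> \<Omega>" "0 \<le> t" for n k \<alpha> t
  proof -
    have "2 * A * (1/2) ^ n * exp (3 * L * t) * (1 - (1/2) ^ k) \<le> 2 * A * (1/2) ^ n * exp (3 * L * t) * 1"
      using A(1) by (intro mult_left_mono) auto
    then show ?thesis using far[OF that, of n k] by simp
  qed
  have half0: "(\<lambda>n. c * (1/2) ^ n * d) \<longlonglongrightarrow> 0" for c d :: real
    by (intro tendsto_mult_left_zero tendsto_mult_right_zero LIMSEQ_power_zero) simp
  define X where "X \<alpha> t = (if \<alpha> \<in> \<Omega> then lim (\<lambda>n. Xn n \<alpha> t) else 0)" for \<alpha> t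
  have lim: "(\<lambda>n. Xn n \<alpha> t) \<longlonglongrightarrow> X \<alpha> t" if "\<alpha> \<in> \<Omega>" "0 \<le> t" for \<alpha> t
  proof -
    have "Cauchy (\<lambda>n. Xn n \<alpha> t)"
    proof (rule metric_CauchyI)
      fix r :: real assume "0 < r"
      then obtain N where N: "norm (2 * A * (1/2) ^ N * exp (3 * L * t) - 0) < r / 2"
        using LIMSEQ_D[OF half0[of "2 * A" "exp (3 * L * t)"], of "r / 2"] by auto
      have close: "\<bar>Xn n \<alpha> t - Xn N \<alpha> t\<bar> < r / 2" if "N \<le> n" for n
        using far'[OF \<open>\<alpha> \<in> \<Omega>\<close> \<open>0 \<le> t\<close>, of N "n - N"] that N by simp
      have "dist (Xn i \<alpha> t) (Xn j \<alpha> t) < r" if "N \<le> i" "N \<le> j" for i j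
        using close[OF that(1)] close[OF that(2)] unfolding dist_real_def by linarith
      then show "\<exists>M. \<forall>m\<ge>M. \<forall>n\<ge>M. dist (Xn m \<alpha> t) (Xn n \<alpha> t) < r" by blast
    qed
    then show ?thesis using that by (simp add: X_def Cauchy_convergent_iff convergent_LIMSEQ_iff)
  qed
  have X_close: "\<bar>X \<alpha> t - Xn n \<alpha> t\<bar> \<le> 2 * A * (1/2) ^ n * exp (3 * L * t)" if "\<alpha> \<in> \<Omega>" "0 \<le> t" for n \<alpha> t
  proof (rule LIMSEQ_le_const2)
    show "(\<lambda>k. \<bar>Xn (k + n) \<alpha> t - Xn n \<alpha> t\<bar>) \<longlonglongrightarrow> \<bar>X \<alpha> t - Xn n \<alpha> t\<bar>"
      by (intro tendsto_rabs tendsto_diff tendsto_const LIMSEQ_ignore_initial_segment lim that)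
    show "\<exists>N. \<forall>k\<ge>N. \<bar>Xn (k + n) \<alpha> t - Xn n \<alpha> t\<bar> \<le> 2 * A * (1/2) ^ n * exp (3 * L * t)"
      using far'[OF that, of n] by (simp add: add.commute)
  qed
  have X_bound: "\<bar>X \<alpha> t - \<alpha>\<bar> \<le> 2 * A * exp (3 * L * t)" if "\<alpha> \<in> \<Omega>" "0 \<le> t" for \<alpha> t
    using X_close[OF that, of 0] that(1) by (simp add: Xn_def X0_def)
  have X_S: "(\<lambda>\<alpha>. X \<alpha> t) \<in> S" if "0 \<le> t" for t
  proof (rule separated_limit)
    show "(\<lambda>\<alpha>. Xn n \<alpha> t) \<in> S" for n by (rule admissible_S[OF adm that])
    show "(\<lambda>n. Xn n \<alpha> t) \<longlonglongrightarrow> X \<alpha> t" if "\<alpha> \<in> \<Omega>" for \<alpha> by (rule lim[OF that \<open>0 \<le> t\<close>])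
    show "\<bar>X \<alpha> t\<bar> \<le> Rb + 2 * A * exp (3 * L * t)" if "\<alpha> \<in> \<Omega>" for \<alpha>
      using X_bound[OF that \<open>0 \<le> t\<close>] bounded_\<Omega>[OF that] by linarith
    show "X \<alpha> t = 0" if "\<alpha> \<notin> \<Omega>" for \<alpha> using that by (simp add: X_def)
  qed
  have X_cont: "continuous_on {0..} (X \<alpha>)" if "\<alpha> \<in> \<Omega>" for \<alpha>
  proof -
    \<comment> \<open>After removal of the exponential weight the convergence is uniform on the
      whole half-line, so continuity survives the limit.\<close>
    have "continuous_on {0..} (\<lambda>t. exp (- 3 * L * t) * X \<alpha> t)"
    proof (rule uniform_limit_theorem)
      show "\<forall>\<^sub>F n in sequentially. continuous_on {0..} (\<lambda>t. exp (- 3 * L * t) * Xn n \<alpha> t)"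
        by (intro always_eventually allI continuous_intros admissible_cont[OF adm that])
      show "uniform_limit {0..} (\<lambda>n t. exp (- 3 * L * t) * Xn n \<alpha> t) (\<lambda>t. exp (- 3 * L * t) * X \<alpha> t) sequentially"
      proof (rule uniform_limitI)
        fix r :: real assume "0 < r"
        then have "\<forall>\<^sub>F n in sequentially. 2 * A * (1/2) ^ n * 1 < r"
          using order_tendstoD(2)[OF half0[of "2 * A" 1]] by blast
        then show "\<forall>\<^sub>F n in sequentially. \<forall>t\<in>{0..}. dist (exp (- 3 * L * t) * Xn n \<alpha> t) (exp (- 3 * L * t) * X \<alpha> t) < r"
        proof eventually_elim
          case (elim n)
          show ?case
          proof
            fix t :: real assume "t \<in> {0..}"
            then have "exp (- 3 * L * t) * \<bar>X \<alpha> t - Xn n \<alpha> t\<bar> \<le>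
                exp (- 3 * L * t) * (2 * A * (1/2) ^ n * exp (3 * L * t))"
              using X_close[OF that, of t n] by (intro mult_left_mono) auto
            also have "\<dots> = 2 * A * (1/2) ^ n"
              using exp_add[of "- 3 * L * t" "3 * L * t"] by simp
            also have "\<dots> < r" using elim by simp
            finally show "dist (exp (- 3 * L * t) * Xn n \<alpha> t) (exp (- 3 * L * t) * X \<alpha> t) < r"
              by (simp add: dist_real_def abs_mult right_diff_distrib[symmetric] abs_minus_commute)
          qed
        qed
      qed
    qed simp
    then have "continuous_on {0..} (\<lambda>t. exp (3 * L * t) * (exp (- 3 * L * t) * X \<alpha> t))"
      by (rule continuous_on_mult[rotated]) (intro continuous_intros)
    moreover have "exp (3 * L * t) * (exp (- 3 * L * t) * X \<alpha> t) = X \<alpha> t" for t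
      using exp_add[of "3 * L * t" "- 3 * L * t"] by (simp add: mult.assoc[symmetric])
    ultimately show ?thesis by (simp only:)
  qed
  have X_adm: "admissible X"
    unfolding admissible_def using X_S X_cont X_bound A(1) by (auto intro!: exI[of _ "2 * A"])
  have fixpoint: "picard X \<alpha> t = X \<alpha> t" if "\<alpha> \<in> \<Omega>" "0 \<le> t" for \<alpha> t
  proof (rule LIMSEQ_unique)
    show "(\<lambda>n. Xn (Suc n) \<alpha> t) \<longlonglongrightarrow> X \<alpha> t"
      using lim[OF that] by (rule LIMSEQ_Suc)
    have "(\<lambda>n. picard X \<alpha> t - Xn (Suc n) \<alpha> t) \<longlonglongrightarrow> 0"
    proof (rule Lim_null_comparison[OF _ half0[of A "exp (3 * L * t)"]], intro always_eventually allI)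
      fix n
      show "norm (picard X \<alpha> t - Xn (Suc n) \<alpha> t) \<le> A * (1/2) ^ n * exp (3 * L * t)"
        using picard_contraction[OF X_adm adm[of n], of "2 * A * (1/2) ^ n" \<alpha> t] X_close A(1) that
        by (simp add: Xn_Suc)
    qed
    then show "(\<lambda>n. Xn (Suc n) \<alpha> t) \<longlonglongrightarrow> picard X \<alpha> t"
      using tendsto_diff[OF tendsto_const[of "picard X \<alpha> t"]] by fastforce
  qed
  show thesis
  proof (rule that[OF X_adm])
    show "X \<alpha> 0 = \<alpha>" if "\<alpha> \<in> \<Omega>" for \<alpha>
      using fixpoint[OF that, of 0] that by (simp add: picard_def)
    fix \<alpha> t assume a: "\<alpha> \<in> \<Omega>" and t: "(0::real) \<le> t"
    have "(picard X \<alpha> has_real_derivative L * (G (\<lambda>\<gamma>. X \<gamma> t) \<alpha> - picard X \<alpha> t)) (at t within {0..})"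
      by (rule picard_has_derivative[OF X_adm a t])
    moreover have "L * (G (\<lambda>\<gamma>. X \<gamma> t) \<alpha> - picard X \<alpha> t) = \<psi> \<alpha> - F (\<lambda>\<gamma>. X \<gamma> t) \<alpha>"
      using a L_pos fixpoint[OF a t] by (simp add: G_def)
    ultimately have "(picard X \<alpha> has_real_derivative \<psi> \<alpha> - F (\<lambda>\<gamma>. X \<gamma> t) \<alpha>) (at t within {0..})" by simp
    then show "(X \<alpha> has_real_derivative \<psi> \<alpha> - F (\<lambda>\<gamma>. X \<gamma> t) \<alpha>) (at t within {0..})"
      by (rule has_field_derivative_transform_within[where d = 1]) (use a t fixpoint in auto)
  qed
qed

end

section \<open>Differentiability of the flow in the label\<close>

text \<open>Integrating factor: H is constant. The closed formula involves q only through integrals,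
  so limits of bounded, pointwise convergent coefficients can be taken in it by dominated
  convergence.\<close>

lemma linear_ode_solution:
  fixes R q :: "real \<Rightarrow> real"
  assumes q: "continuous_on {0..} q"
    and R: "\<And>t. 0 \<le> t \<Longrightarrow> (R has_real_derivative c - q t * R t) (at t within {0..})" and "R 0 = 1" "0 \<le> t"
  shows "R t = exp (- integral {0..t} q) * (1 + c * integral {0..t} (\<lambda>\<tau>. exp (integral {0..\<tau>} q)))"
proof -
  define I where "I t = integral {0..t} q" for t
  have dI: "(I has_real_derivative q t) (at t within {0..})" if "0 \<le> t" for t
    unfolding I_def[abs_def] by (rule has_real_derivative_integral_within_Ici[OF q that])
  have "continuous_on {0..} I"
    by (rule DERIV_continuous_on, rule dI) simp
  then have cE: "continuous_on {0..} (\<lambda>\<tau>. exp (I \<tau>))" by (rule continuous_on_exp)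
  define H where "H t = exp (I t) * R t - c * integral {0..t} (\<lambda>\<tau>. exp (I \<tau>))" for t
  have "(H has_real_derivative 0) (at t within {0..})" if "0 \<le> t" for t
  proof -
    have "(H has_real_derivative (exp (I t) * q t) * R t + (c - q t * R t) * exp (I t) - c * exp (I t)) (at t within {0..})"
      unfolding H_def[abs_def]
      by (intro DERIV_diff DERIV_mult DERIV_cmult has_real_derivative_integral_within_Ici[OF cE that]
          R[OF that] DERIV_chain2[OF DERIV_exp] dI[OF that])
    then show ?thesis by (simp add: algebra_simps)
  qed
  then obtain k where k: "\<forall>x\<in>{0..}. H x = k"
    using has_field_derivative_zero_constant[of "{0::real..}" H] by auto
  have "H t = H 0" using k assms(4) by simp
  then have "exp (I t) * R t = 1 + c * integral {0..t} (\<lambda>\<tau>. exp (I \<tau>))"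
    using assms(3) by (simp add: H_def I_def)
  then have "exp (- I t) * (exp (I t) * R t) = exp (- I t) * (1 + c * integral {0..t} (\<lambda>\<tau>. exp (I \<tau>)))" by simp
  moreover have "exp (- I t) * (exp (I t) * R t) = R t"
    using exp_add[of "- I t" "I t"] by (simp add: mult.assoc[symmetric])
  ultimately show ?thesis by (simp add: I_def)
qed

locale lagrangian_flow = lagrangian_system +
  fixes \<phi> \<psi>' :: "real \<Rightarrow> real" and X :: "real \<Rightarrow> real \<Rightarrow> real"
  assumes adm: "admissible X" and X_0: "\<And>\<alpha>. \<alpha> \<in> \<Omega> \<Longrightarrow> X \<alpha> 0 = \<alpha>"
    and X_ode: "\<And>\<alpha> t. \<alpha> \<in> \<Omega> \<Longrightarrow> 0 \<le> t \<Longrightarrow>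
       (X \<alpha> has_real_derivative \<psi> \<alpha> - F (\<lambda>\<gamma>. X \<gamma> t) \<alpha>) (at t within {0..})"
    and \<phi>_measurable: "\<phi> \<in> borel_measurable borel" and \<phi>_discont: "countable {z. \<not> isCont \<phi> z}"
    and \<phi>_deriv: "\<And>z. isCont \<phi> z \<Longrightarrow> (\<Phi> has_real_derivative \<phi> z) (at z)"
    and \<phi>_nonneg: "\<And>z. z \<noteq> 0 \<Longrightarrow> 0 \<le> \<phi> z" and \<phi>_le: "\<And>z. z \<noteq> 0 \<Longrightarrow> \<phi> z \<le> B z"
    and \<psi>_deriv: "\<And>\<alpha>. \<alpha> \<in> \<Omega> \<Longrightarrow> (\<psi> has_real_derivative \<psi>' \<alpha>) (at \<alpha>)"
begin

definition V :: "real \<Rightarrow> real \<Rightarrow> real" where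
  "V \<alpha> t = (if \<alpha> \<in> \<Omega> then \<psi> \<alpha> - F (\<lambda>\<gamma>. X \<gamma> t) \<alpha> else 0)"

text \<open>The convolution of kernel and density at the particle \<alpha>; it is the damping rate
  in the equation for the deformation of the flow.\<close>

definition q :: "real \<Rightarrow> real \<Rightarrow> real" where
  "q \<alpha> t = (\<integral>\<gamma>. \<phi> (X \<alpha> t - X \<gamma> t) \<partial>m)"

lemma X_S: "0 \<le> t \<Longrightarrow> (\<lambda>\<alpha>. X \<alpha> t) \<in> S"
  by (rule admissible_S[OF adm])

lemma X_measurable: "0 \<le> t \<Longrightarrow> (\<lambda>\<alpha>. X \<alpha> t) \<in> borel_measurable borel"
  by (rule S_measurable[OF X_S])

lemma X_less: "0 \<le> t \<Longrightarrow> \<alpha> \<in> \<Omega> \<Longrightarrow> \<beta> \<in> \<Omega> \<Longrightarrow> \<alpha> < \<beta> \<Longrightarrow> X \<alpha> t < X \<beta> t"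
  using S_less[OF X_S] by simp

lemma X_inj: "0 \<le> t \<Longrightarrow> \<alpha> \<in> \<Omega> \<Longrightarrow> \<beta> \<in> \<Omega> \<Longrightarrow> X \<alpha> t = X \<beta> t \<Longrightarrow> \<alpha> = \<beta>"
  using S_inj[OF X_S] by blast

lemma X_V: "\<alpha> \<in> \<Omega> \<Longrightarrow> 0 \<le> t \<Longrightarrow> (X \<alpha> has_real_derivative V \<alpha> t) (at t within {0..})"
  using X_ode by (simp add: V_def)

text \<open>For fixed \<alpha> the map \<gamma> \<mapsto> \<open>X \<alpha> t - X \<gamma> t\<close>
  is injective on \<Omega>, so only countably many labels hit a discontinuity of the kernel, and m
  has no atoms.\<close>

lemma AE_good:
  assumes "\<alpha> \<in> \<Omega>" "0 \<le> t"
  shows "AE \<gamma> in m. \<gamma> \<in> \<Omega> \<and> X \<alpha> t - X \<gamma> t \<noteq> 0 \<and> isCont \<phi> (X \<alpha> t - X \<gamma> t)"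
proof -
  let ?N = "{\<gamma> \<in> \<Omega>. \<not> isCont \<phi> (X \<alpha> t - X \<gamma> t)}"
  have "countable ((\<lambda>\<gamma>. X \<alpha> t - X \<gamma> t) ` ?N)"
    by (rule countable_subset[OF _ \<phi>_discont]) auto
  moreover have "inj_on (\<lambda>\<gamma>. X \<alpha> t - X \<gamma> t) ?N"
    by (intro inj_onI) (use X_inj[OF assms(2)] in auto)
  ultimately have "countable ?N" by (rule countable_image_inj_on)
  then have "AE \<gamma> in m. \<forall>y\<in>?N. \<gamma> \<noteq> y"
    using m_diffuse by (subst AE_ball_countable) auto
  with AE_ne[OF X_S[OF assms(2)] assms(1)] show ?thesis
    by eventually_elim auto
qed

lemma B_integrable: "\<alpha> \<in> \<Omega> \<Longrightarrow> 0 \<le> t \<Longrightarrow> integrable m (\<lambda>\<gamma>. B (X \<alpha> t - X \<gamma> t))"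
  using B_int[OF X_S] by simp

lemma \<phi>_diff_measurable: "0 \<le> t \<Longrightarrow> (\<lambda>\<gamma>. \<phi> (x - X \<gamma> t)) \<in> borel_measurable m"
  by (intro measurable_m measurable_compose[OF _ \<phi>_measurable] borel_measurable_diff
      borel_measurable_const X_measurable)

lemma \<phi>_integrable:
  assumes "\<alpha> \<in> \<Omega>" "0 \<le> t" shows "integrable m (\<lambda>\<gamma>. \<phi> (X \<alpha> t - X \<gamma> t))"
proof (rule Bochner_Integration.integrable_bound[OF B_integrable[OF assms] \<phi>_diff_measurable[OF assms(2)]])
  show "AE \<gamma> in m. norm (\<phi> (X \<alpha> t - X \<gamma> t)) \<le> norm (B (X \<alpha> t - X \<gamma> t))"
    using AE_good[OF assms]
  proof eventually_elim
    case (elim \<gamma>)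
    then show ?case using \<phi>_nonneg[of "X \<alpha> t - X \<gamma> t"] \<phi>_le[of "X \<alpha> t - X \<gamma> t"] by auto
  qed
qed

lemma convolution_has_derivative:
  assumes "\<alpha> \<in> \<Omega>" "0 \<le> t"
  shows "((\<lambda>x. \<integral>\<gamma>. \<Phi> (x - X \<gamma> t) \<partial>m) has_real_derivative q \<alpha> t) (at (X \<alpha> t))"
  unfolding q_def
proof (rule has_real_derivative_integral[where T = UNIV and g = "\<lambda>\<gamma>. B (X \<alpha> t - X \<gamma> t)"])
  show "integrable m (\<lambda>\<gamma>. \<Phi> (y - X \<gamma> t))" for y
    using \<Phi>_integrable[OF X_S[OF assms(2)]] by simp
  show "AE \<gamma> in m. ((\<lambda>y. \<Phi> (y - X \<gamma> t)) has_real_derivative \<phi> (X \<alpha> t - X \<gamma> t)) (at (X \<alpha> t))"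
    using AE_good[OF assms]
  proof eventually_elim
    case (elim \<gamma>)
    have "((\<lambda>y. y - X \<gamma> t) has_real_derivative 1) (at (X \<alpha> t))"
      by (auto intro!: derivative_eq_intros)
    with \<phi>_deriv[of "X \<alpha> t - X \<gamma> t"] elim
    have "((\<lambda>y. \<Phi> (y - X \<gamma> t)) has_real_derivative \<phi> (X \<alpha> t - X \<gamma> t) * 1) (at (X \<alpha> t))"
      by (intro DERIV_chain2[where f = \<Phi> and g = "\<lambda>y. y - X \<gamma> t"]) simp_all
    then show ?case by simp
  qed
  show "AE \<gamma> in m. \<bar>\<Phi> (y - X \<gamma> t) - \<Phi> (X \<alpha> t - X \<gamma> t)\<bar> \<le> \<bar>y - X \<alpha> t\<bar> * B (X \<alpha> t - X \<gamma> t)" for y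
    using AE_good[OF assms]
  proof eventually_elim
    case (elim \<gamma>)
    then show ?case using lip_\<Phi>[of "X \<alpha> t - X \<gamma> t" "y - X \<alpha> t"] by simp
  qed
qed (use B_integrable[OF assms] \<phi>_diff_measurable[OF assms(2)] in auto)

text \<open>The force is increasing along the configuration and enters with a minus sign, so it can
  only slow the separation: a distance grows at most at rate \<psi> \<beta> - \<psi> \<alpha>. This
  gives continuity of the flow in the label.\<close>

lemma X_diff_le:
  assumes "\<alpha> \<in> \<Omega>" "0 \<le> t" "\<beta> \<in> \<Omega>"
  shows "\<bar>X \<beta> t - X \<alpha> t\<bar> \<le> \<bar>\<beta> - \<alpha>\<bar> + \<bar>\<psi> \<beta> - \<psi> \<alpha>\<bar> * t"
proof -
  have *: "X \<beta> t - X \<alpha> t \<le> (\<beta> - \<alpha>) + (\<psi> \<beta> - \<psi> \<alpha>) * t" if ab: "\<alpha> \<in> \<Omega>" "\<beta> \<in> \<Omega>" "\<alpha> \<le> \<beta>" for \<alpha> \<beta>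
  proof -
    define H where "H \<tau> = (\<psi> \<beta> - \<psi> \<alpha>) * \<tau> - (X \<beta> \<tau> - X \<alpha> \<tau>)" for \<tau>
    have "H 0 \<le> H t"
    proof (rule DERIV_nonneg_imp_increasing_open[OF assms(2)])
      fix \<tau> assume \<tau>: "0 < \<tau>" "\<tau> < t"
      have "at \<tau> within {0..} = at \<tau>" using \<tau> by (intro at_within_interior) (auto simp: interior_Ici[of "-1"])
      then have "(H has_real_derivative (\<psi> \<beta> - \<psi> \<alpha>) * 1 - (V \<beta> \<tau> - V \<alpha> \<tau>)) (at \<tau>)"
        unfolding H_def[abs_def]
        using X_V[OF ab(1), of \<tau>] X_V[OF ab(2), of \<tau>] \<tau>
        by (intro DERIV_diff DERIV_cmult DERIV_ident) auto
      moreover have "0 \<le> (\<psi> \<beta> - \<psi> \<alpha>) * 1 - (V \<beta> \<tau> - V \<alpha> \<tau>)"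
        using F_mono[OF X_S[of \<tau>] ab] \<tau> ab by (simp add: V_def)
      ultimately show "\<exists>y. (H has_real_derivative y) (at \<tau>) \<and> 0 \<le> y" by blast
    next
      show "continuous_on {0..t} H"
        unfolding H_def[abs_def]
        by (intro continuous_intros continuous_on_subset[OF admissible_cont[OF adm]] ab) auto
    qed
    then show ?thesis using X_0 ab by (simp add: H_def)
  qed
  consider "\<alpha> < \<beta>" | "\<beta> < \<alpha>" | "\<alpha> = \<beta>" by linarith
  then show ?thesis
  proof cases
    case 1
    then show ?thesis
      using *[OF assms(1,3)] X_less[OF assms(2,1,3)] \<psi>_mono[OF assms(1,3)] assms(2) by simp
  next
    case 2
    then show ?thesis
      using *[OF assms(3,1)] X_less[OF assms(2,3,1)] \<psi>_mono[OF assms(3,1)] assms(2) by simp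
  qed simp
qed

text \<open>Divided differences: of the force in the position (\<open>Q\<close>), of the flow in the
  label (\<open>R\<close>), of \<psi> in the label (\<open>slope\<close>). They obey the exact
  linear equation \<open>R' = slope - Q * R\<close>, whose limit \<beta> \<rightarrow> \<alpha>
  governs the label derivative.\<close>

definition Q :: "real \<Rightarrow> real \<Rightarrow> real \<Rightarrow> real" where
  "Q \<alpha> \<beta> t = (F (\<lambda>\<gamma>. X \<gamma> t) \<beta> - F (\<lambda>\<gamma>. X \<gamma> t) \<alpha>) / (X \<beta> t - X \<alpha> t)"

definition R :: "real \<Rightarrow> real \<Rightarrow> real \<Rightarrow> real" where
  "R \<alpha> \<beta> t = (X \<beta> t - X \<alpha> t) / (\<beta> - \<alpha>)"

definition slope :: "real \<Rightarrow> real \<Rightarrow> real" where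
  "slope \<alpha> \<beta> = (\<psi> \<beta> - \<psi> \<alpha>) / (\<beta> - \<alpha>)"

lemma slope_nonneg:
  assumes "\<alpha> \<in> \<Omega>" "\<beta> \<in> \<Omega>" shows "0 \<le> slope \<alpha> \<beta>"
  using \<psi>_mono[OF assms] \<psi>_mono[OF assms(2,1)] unfolding slope_def
  by (cases "\<alpha> \<le> \<beta>") (auto simp: zero_le_divide_iff)

lemma Q_bounds:
  assumes "\<alpha> \<in> \<Omega>" "\<beta> \<in> \<Omega>" "\<alpha> \<noteq> \<beta>" "0 \<le> t" shows "0 \<le> Q \<alpha> \<beta> t" "Q \<alpha> \<beta> t \<le> K"
proof -
  have *: "0 \<le> Q \<alpha> \<beta> t \<and> Q \<alpha> \<beta> t \<le> K" if ab: "\<alpha> \<in> \<Omega>" "\<beta> \<in> \<Omega>" "\<alpha> < \<beta>" for \<alpha> \<beta>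
  proof -
    have "0 < X \<beta> t - X \<alpha> t" using X_less[OF assms(4) ab] by simp
    moreover have "0 \<le> F (\<lambda>\<gamma>. X \<gamma> t) \<beta> - F (\<lambda>\<gamma>. X \<gamma> t) \<alpha>"
      using F_mono[OF X_S[OF assms(4)] ab(1,2)] ab(3) by simp
    moreover have "F (\<lambda>\<gamma>. X \<gamma> t) \<beta> - F (\<lambda>\<gamma>. X \<gamma> t) \<alpha> \<le> K * (X \<beta> t - X \<alpha> t)"
      using F_diff[OF X_S[OF assms(4)] ab(1,2)] calculation by simp
    ultimately show ?thesis by (simp add: Q_def divide_le_eq)
  qed
  have sym: "Q \<alpha> \<beta> t = Q \<beta> \<alpha> t"
    unfolding Q_def using minus_divide_divide[of "F (\<lambda>\<gamma>. X \<gamma> t) \<alpha> - F (\<lambda>\<gamma>. X \<gamma> t) \<beta>" "X \<alpha> t - X \<beta> t"] by simp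
  have "0 \<le> Q \<alpha> \<beta> t \<and> Q \<alpha> \<beta> t \<le> K"
    using *[OF assms(1,2)] *[OF assms(2,1)] assms(3) sym by (cases "\<alpha> < \<beta>") auto
  then show "0 \<le> Q \<alpha> \<beta> t" "Q \<alpha> \<beta> t \<le> K" by auto
qed

lemma Q_continuous:
  assumes "\<alpha> \<in> \<Omega>" "\<beta> \<in> \<Omega>" "\<alpha> \<noteq> \<beta>" shows "continuous_on {0..} (Q \<alpha> \<beta>)"
  unfolding Q_def[abs_def]
proof (intro continuous_on_divide continuous_on_diff continuous_F[OF adm] admissible_cont[OF adm] assms ballI)
  show "X \<beta> t - X \<alpha> t \<noteq> 0" if "t \<in> {0..}" for t
    using X_inj[of t \<alpha> \<beta>] that assms by auto
qed

lemma R_ode: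
  assumes "\<alpha> \<in> \<Omega>" "\<beta> \<in> \<Omega>" "\<alpha> \<noteq> \<beta>" "0 \<le> t"
  shows "(R \<alpha> \<beta> has_real_derivative slope \<alpha> \<beta> - Q \<alpha> \<beta> t * R \<alpha> \<beta> t) (at t within {0..})"
proof -
  have "(R \<alpha> \<beta> has_real_derivative (V \<beta> t - V \<alpha> t) / (\<beta> - \<alpha>)) (at t within {0..})"
    unfolding R_def[abs_def] by (intro DERIV_cdivide DERIV_diff X_V assms)
  moreover have "V \<beta> t - V \<alpha> t = (\<psi> \<beta> - \<psi> \<alpha>) - (F (\<lambda>\<gamma>. X \<gamma> t) \<beta> - F (\<lambda>\<gamma>. X \<gamma> t) \<alpha>)"
    using assms by (simp add: V_def)
  moreover have "X \<beta> t - X \<alpha> t \<noteq> 0" using X_inj[OF assms(4,1,2)] assms(3) by auto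
  then have "Q \<alpha> \<beta> t * R \<alpha> \<beta> t = (F (\<lambda>\<gamma>. X \<gamma> t) \<beta> - F (\<lambda>\<gamma>. X \<gamma> t) \<alpha>) / (\<beta> - \<alpha>)"
    by (simp add: Q_def R_def)
  ultimately show ?thesis by (simp add: slope_def diff_divide_distrib)
qed

lemma R_formula:
  assumes "\<alpha> \<in> \<Omega>" "\<beta> \<in> \<Omega>" "\<alpha> \<noteq> \<beta>" "0 \<le> t"
  shows "R \<alpha> \<beta> t = exp (- integral {0..t} (Q \<alpha> \<beta>)) *
      (1 + slope \<alpha> \<beta> * integral {0..t} (\<lambda>\<tau>. exp (integral {0..\<tau>} (Q \<alpha> \<beta>))))"
  by (rule linear_ode_solution[OF Q_continuous[OF assms(1-3)] R_ode[OF assms(1-3)] _ assms(4)])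
    (use assms X_0 in \<open>simp_all add: R_def\<close>)

lemma Q_integrable_on:
  assumes "\<alpha> \<in> \<Omega>" "\<beta> \<in> \<Omega>" "\<alpha> \<noteq> \<beta>" shows "Q \<alpha> \<beta> integrable_on {0..t}"
  by (intro integrable_continuous_interval continuous_on_subset[OF Q_continuous[OF assms]]) auto

lemma Q_integral_bounds:
  assumes "\<alpha> \<in> \<Omega>" "\<beta> \<in> \<Omega>" "\<alpha> \<noteq> \<beta>" "0 \<le> t"
  shows "0 \<le> integral {0..t} (Q \<alpha> \<beta>)" "integral {0..t} (Q \<alpha> \<beta>) \<le> K * t"
proof -
  show "0 \<le> integral {0..t} (Q \<alpha> \<beta>)"
    by (rule integral_nonneg[OF Q_integrable_on[OF assms(1-3)]]) (use Q_bounds[OF assms(1-3)] in simp)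
  have "integral {0..t} (Q \<alpha> \<beta>) \<le> K * (t - 0)"
    by (rule has_integral_le[OF integrable_integral[OF Q_integrable_on[OF assms(1-3)]]
          has_integral_const_interval[OF assms(4)]]) (use Q_bounds[OF assms(1-3)] in simp)
  then show "integral {0..t} (Q \<alpha> \<beta>) \<le> K * t" by simp
qed

lemma exp_Q_continuous:
  assumes "\<alpha> \<in> \<Omega>" "\<beta> \<in> \<Omega>" "\<alpha> \<noteq> \<beta>"
  shows "continuous_on {0..} (\<lambda>\<tau>. exp (integral {0..\<tau>} (Q \<alpha> \<beta>)))"
  by (rule continuous_on_exp, rule DERIV_continuous_on,
      rule has_real_derivative_integral_within_Ici[OF Q_continuous[OF assms]]) simp

lemma exp_Q_integrable:
  assumes "\<alpha> \<in> \<Omega>" "\<beta> \<in> \<Omega>" "\<alpha> \<noteq> \<beta>"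
  shows "(\<lambda>\<tau>. exp (integral {0..\<tau>} (Q \<alpha> \<beta>))) integrable_on {0..t}"
  by (intro integrable_continuous_interval continuous_on_subset[OF exp_Q_continuous[OF assms]]) auto

text \<open>The source term \<open>slope\<close> is nonnegative because \<psi> is monotone, so at
  least the pure decay of the initial value 1 remains. The bound does not depend on \<beta>, hence
  survives the limit even where the derivative of \<psi> vanishes.\<close>

lemma R_lower:
  assumes "\<alpha> \<in> \<Omega>" "\<beta> \<in> \<Omega>" "\<alpha> \<noteq> \<beta>" "0 \<le> t"
  shows "exp (- (K * t)) \<le> R \<alpha> \<beta> t"
proof -
  have "0 \<le> slope \<alpha> \<beta> * integral {0..t} (\<lambda>\<tau>. exp (integral {0..\<tau>} (Q \<alpha> \<beta>)))"
    by (intro mult_nonneg_nonneg slope_nonneg assms integral_nonneg exp_Q_integrable) simp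
  then have "exp (- integral {0..t} (Q \<alpha> \<beta>)) * 1 \<le> R \<alpha> \<beta> t"
    unfolding R_formula[OF assms] by (intro mult_left_mono) auto
  moreover have "exp (- (K * t)) \<le> exp (- integral {0..t} (Q \<alpha> \<beta>))"
    using Q_integral_bounds[OF assms] by simp
  ultimately show ?thesis by linarith
qed

lemma R_upper:
  assumes "\<alpha> \<in> \<Omega>" "\<beta> \<in> \<Omega>" "\<alpha> \<noteq> \<beta>" "0 \<le> t"
  shows "R \<alpha> \<beta> t \<le> 1 + slope \<alpha> \<beta> * t"
proof -
  have "\<bar>X \<beta> t - X \<alpha> t\<bar> / \<bar>\<beta> - \<alpha>\<bar> \<le> (\<bar>\<beta> - \<alpha>\<bar> + \<bar>\<psi> \<beta> - \<psi> \<alpha>\<bar> * t) / \<bar>\<beta> - \<alpha>\<bar>"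
    using X_diff_le[OF assms(1,4,2)] by (rule divide_right_mono) simp
  also have "\<dots> = 1 + \<bar>slope \<alpha> \<beta>\<bar> * t"
    using assms(3) by (simp add: slope_def add_divide_distrib)
  finally have "\<bar>R \<alpha> \<beta> t\<bar> \<le> 1 + \<bar>slope \<alpha> \<beta>\<bar> * t"
    by (simp add: R_def)
  then show ?thesis using slope_nonneg[OF assms(1,2)] by simp
qed

text \<open>By continuity in the label, \<open>X (b n) t\<close> approaches
  \<open>X \<alpha> t\<close>, so Q is a difference quotient of the convolution x \<mapsto>
  \<open>\<integral>\<gamma>. \<Phi> (x - X \<gamma> t) \<partial>m\<close> at that point.\<close>

lemma Q_tendsto:
  assumes "\<alpha> \<in> \<Omega>" "0 \<le> t" "\<And>n. b n \<in> \<Omega> - {\<alpha>}" "b \<longlonglongrightarrow> \<alpha>"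
  shows "(\<lambda>n. Q \<alpha> (b n) t) \<longlonglongrightarrow> q \<alpha> t"
proof -
  have "isCont \<psi> \<alpha>" by (rule DERIV_isCont[OF \<psi>_deriv[OF assms(1)]])
  then have "(\<lambda>n. \<psi> (b n)) \<longlonglongrightarrow> \<psi> \<alpha>" by (rule isCont_tendsto_compose[OF _ assms(4)])
  then have "(\<lambda>n. \<bar>b n - \<alpha>\<bar> + \<bar>\<psi> (b n) - \<psi> \<alpha>\<bar> * t) \<longlonglongrightarrow> \<bar>\<alpha> - \<alpha>\<bar> + \<bar>\<psi> \<alpha> - \<psi> \<alpha>\<bar> * t"
    by (intro tendsto_intros assms(4))
  then have null: "(\<lambda>n. \<bar>b n - \<alpha>\<bar> + \<bar>\<psi> (b n) - \<psi> \<alpha>\<bar> * t) \<longlonglongrightarrow> 0" by simp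
  have "(\<lambda>n. X (b n) t - X \<alpha> t) \<longlonglongrightarrow> 0"
  proof (rule Lim_null_comparison[OF _ null], intro always_eventually allI)
    show "norm (X (b n) t - X \<alpha> t) \<le> \<bar>b n - \<alpha>\<bar> + \<bar>\<psi> (b n) - \<psi> \<alpha>\<bar> * t" for n
      unfolding real_norm_def by (rule X_diff_le[OF assms(1,2)]) (use assms(3)[of n] in simp)
  qed
  then have lim: "(\<lambda>n. X (b n) t) \<longlonglongrightarrow> X \<alpha> t" by (rule LIM_zero_cancel)
  have ne: "X (b n) t \<in> UNIV - {X \<alpha> t}" for n
  proof -
    have "b n \<in> \<Omega>" "b n \<noteq> \<alpha>" using assms(3)[of n] by simp_all
    then show ?thesis using X_inj[OF assms(2) _ assms(1), of "b n"] by blast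
  qed
  have "((\<lambda>x. ((\<integral>\<gamma>. \<Phi> (x - X \<gamma> t) \<partial>m) - (\<integral>\<gamma>. \<Phi> (X \<alpha> t - X \<gamma> t) \<partial>m)) / (x - X \<alpha> t)) \<longlongrightarrow> q \<alpha> t) (at (X \<alpha> t))"
    using convolution_has_derivative[OF assms(1,2)] unfolding has_field_derivative_iff .
  from this[unfolded tendsto_at_iff_sequentially, rule_format, of "\<lambda>n. X (b n) t", OF ne lim]
  have "((\<lambda>x. ((\<integral>\<gamma>. \<Phi> (x - X \<gamma> t) \<partial>m) - (\<integral>\<gamma>. \<Phi> (X \<alpha> t - X \<gamma> t) \<partial>m)) / (x - X \<alpha> t)) \<circ> (\<lambda>n. X (b n) t)) \<longlonglongrightarrow> q \<alpha> t" .
  then show ?thesis by (simp add: comp_def Q_def F_def)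
qed

text \<open>\<open>R_formula\<close> with Q and \<open>slope\<close> replaced by their limits; it
  turns out to be the label derivative of X.\<close>

definition Z :: "real \<Rightarrow> real \<Rightarrow> real" where
  "Z \<alpha> t = exp (- integral {0..t} (q \<alpha>)) * (1 + \<psi>' \<alpha> * integral {0..t} (\<lambda>\<tau>. exp (integral {0..\<tau>} (q \<alpha>))))"

lemma R_tendsto:
  assumes "\<alpha> \<in> \<Omega>" "0 \<le> t" "\<And>n. b n \<in> \<Omega> - {\<alpha>}" "b \<longlonglongrightarrow> \<alpha>"
  shows "(\<lambda>n. R \<alpha> (b n) t) \<longlonglongrightarrow> Z \<alpha> t"
proof -
  have b: "b n \<in> \<Omega>" "\<alpha> \<noteq> b n" for n using assms(3)[of n] by auto
  have I: "(\<lambda>n. integral {0..\<tau>} (Q \<alpha> (b n))) \<longlonglongrightarrow> integral {0..\<tau>} (q \<alpha>)" for \<tau>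
  proof (rule dominated_convergence(2)[where h = "\<lambda>_. K"])
    show "Q \<alpha> (b n) integrable_on {0..\<tau>}" for n by (rule Q_integrable_on[OF assms(1) b])
    show "norm (Q \<alpha> (b n) x) \<le> K" if "x \<in> {0..\<tau>}" for n x
      using Q_bounds[OF assms(1) b, of x n] that by simp
    show "(\<lambda>n. Q \<alpha> (b n) x) \<longlonglongrightarrow> q \<alpha> x" if "x \<in> {0..\<tau>}" for x
      by (rule Q_tendsto[OF assms(1) _ assms(3,4)]) (use that in simp)
  qed (rule integrable_const_ivl)
  have E: "(\<lambda>n. integral {0..t} (\<lambda>\<tau>. exp (integral {0..\<tau>} (Q \<alpha> (b n))))) \<longlonglongrightarrow>
      integral {0..t} (\<lambda>\<tau>. exp (integral {0..\<tau>} (q \<alpha>)))"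
  proof (rule dominated_convergence(2)[where h = "\<lambda>_. exp (K * t)"])
    show "(\<lambda>\<tau>. exp (integral {0..\<tau>} (Q \<alpha> (b n)))) integrable_on {0..t}" for n
      by (rule exp_Q_integrable[OF assms(1) b])
    show "norm (exp (integral {0..\<tau>} (Q \<alpha> (b n)))) \<le> exp (K * t)" if "\<tau> \<in> {0..t}" for n \<tau>
    proof -
      have "integral {0..\<tau>} (Q \<alpha> (b n)) \<le> K * \<tau>" using Q_integral_bounds(2)[OF assms(1) b, of \<tau> n] that by simp
      also have "\<dots> \<le> K * t" using that K_pos by simp
      finally show ?thesis by simp
    qed
    show "(\<lambda>n. exp (integral {0..\<tau>} (Q \<alpha> (b n)))) \<longlonglongrightarrow> exp (integral {0..\<tau>} (q \<alpha>))" for \<tau>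
      by (rule tendsto_exp[OF I])
  qed (rule integrable_const_ivl)
  have s: "(\<lambda>n. slope \<alpha> (b n)) \<longlonglongrightarrow> \<psi>' \<alpha>"
    using \<psi>_deriv[OF assms(1)] assms(3,4)
    unfolding has_field_derivative_iff tendsto_at_iff_sequentially comp_def slope_def by simp
  have "(\<lambda>n. exp (- integral {0..t} (Q \<alpha> (b n))) *
      (1 + slope \<alpha> (b n) * integral {0..t} (\<lambda>\<tau>. exp (integral {0..\<tau>} (Q \<alpha> (b n)))))) \<longlonglongrightarrow> Z \<alpha> t"
    unfolding Z_def by (intro tendsto_mult tendsto_add tendsto_exp tendsto_minus tendsto_const I E s)
  then show ?thesis by (simp add: R_formula[OF assms(1) b assms(2)])
qed

lemma X_has_derivative:
  assumes "\<alpha> \<in> \<Omega>" "0 \<le> t" shows "((\<lambda>a. X a t) has_real_derivative Z \<alpha> t) (at \<alpha>)"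
proof -
  have "((\<lambda>a. X a t) has_real_derivative Z \<alpha> t) (at \<alpha> within \<Omega>)"
    unfolding has_field_derivative_iff tendsto_at_iff_sequentially comp_def
  proof (intro allI impI)
    fix b assume "\<forall>n. b n \<in> \<Omega> - {\<alpha>}" "b \<longlonglongrightarrow> \<alpha>"
    then show "(\<lambda>n. (X (b n) t - X \<alpha> t) / (b n - \<alpha>)) \<longlonglongrightarrow> Z \<alpha> t"
      using R_tendsto[OF assms, of b] by (simp add: R_def)
  qed
  then show ?thesis using at_within_open[OF assms(1) open_\<Omega>] by simp
qed

lemma Z_lower:
  assumes "\<alpha> \<in> \<Omega>" "0 \<le> t" shows "exp (- (K * t)) \<le> Z \<alpha> t"
proof -
  have "((\<lambda>\<beta>. R \<alpha> \<beta> t) \<longlongrightarrow> Z \<alpha> t) (at \<alpha> within \<Omega>)"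
    unfolding tendsto_at_iff_sequentially comp_def by (intro allI impI R_tendsto[OF assms]) simp_all
  moreover have "at \<alpha> within \<Omega> \<noteq> bot" using at_within_open[OF assms(1) open_\<Omega>] by simp
  moreover have "\<forall>\<^sub>F \<beta> in at \<alpha> within \<Omega>. exp (- (K * t)) \<le> R \<alpha> \<beta> t"
    using R_lower[OF assms(1)] assms(2) by (auto simp: eventually_at_filter)
  ultimately show ?thesis by (intro tendsto_lowerbound)
qed

lemma Z_pos: "\<alpha> \<in> \<Omega> \<Longrightarrow> 0 \<le> t \<Longrightarrow> 0 < Z \<alpha> t"
  using Z_lower[of \<alpha> t] exp_gt_zero[of "- (K * t)"] by linarith

end

section \<open>The inverse flow and Eulerian variables\<close>

context lagrangian_flow begin

lemma V_bound: "\<exists>C. \<forall>\<gamma>. \<forall>\<tau>\<in>{0..T}. \<bar>V \<gamma> \<tau>\<bar> \<le> C"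
proof -
  obtain b where b: "\<forall>\<alpha>\<in>\<Omega>. \<forall>t\<in>{0..T}. \<bar>X \<alpha> t\<bar> \<le> b"
    using admissible_bound[OF adm] by blast
  define c where "c = \<bar>\<Phi> (2 * b)\<bar> + \<bar>\<Phi> (- (2 * b))\<bar>"
  have "\<bar>V \<gamma> \<tau>\<bar> \<le> \<bar>Pb\<bar> + c * measure m (space m)" if \<tau>: "\<tau> \<in> {0..T}" for \<gamma> \<tau>
  proof (cases "\<gamma> \<in> \<Omega>")
    case True
    have "\<bar>F (\<lambda>\<gamma>. X \<gamma> \<tau>) \<gamma>\<bar> \<le> (\<integral>x. c \<partial>m)"
      unfolding F_def
    proof (rule order_trans[OF integral_abs_bound], rule integral_mono_AE)
      show "integrable m (\<lambda>x. \<bar>\<Phi> (X \<gamma> \<tau> - X x \<tau>)\<bar>)"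
        using \<Phi>_integrable[OF X_S[of \<tau>], of "X \<gamma> \<tau>"] \<tau> by simp
      show "integrable m (\<lambda>x. c)" by (rule finite_measure.integrable_const[OF finite_m])
      show "AE x in m. \<bar>\<Phi> (X \<gamma> \<tau> - X x \<tau>)\<bar> \<le> c"
        using m_\<Omega>
      proof eventually_elim
        case (elim x)
        have "\<bar>X \<gamma> \<tau>\<bar> \<le> b" "\<bar>X x \<tau>\<bar> \<le> b" using b \<tau> True elim by blast+
        then show ?case unfolding c_def by (intro \<Phi>_abs_le) linarith
      qed
    qed
    then have "\<bar>F (\<lambda>\<gamma>. X \<gamma> \<tau>) \<gamma>\<bar> \<le> c * measure m (space m)" by (simp add: mult.commute)
    then show ?thesis using \<psi>_bounded[OF True] unfolding V_def if_P[OF True] by linarith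
  qed (simp add: V_def c_def)
  then show ?thesis by blast
qed

lemma X_time_lipschitz:
  "\<exists>C. \<forall>\<gamma>\<in>\<Omega>. \<forall>\<tau>\<in>{0..T}. \<forall>t\<in>{0..T}. \<bar>X \<gamma> \<tau> - X \<gamma> t\<bar> \<le> C * \<bar>\<tau> - t\<bar>"
proof -
  obtain C where C: "\<forall>\<gamma>. \<forall>\<tau>\<in>{0..T}. \<bar>V \<gamma> \<tau>\<bar> \<le> C" using V_bound by blast
  have "\<bar>X \<gamma> \<tau> - X \<gamma> t\<bar> \<le> C * \<bar>\<tau> - t\<bar>" if "\<gamma> \<in> \<Omega>" "\<tau> \<in> {0..T}" "t \<in> {0..T}" for \<gamma> \<tau> t
  proof -
    have "norm (X \<gamma> \<tau> - X \<gamma> t) \<le> C * norm (\<tau> - t)"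
    proof (rule field_differentiable_bound[of "{0..T}"])
      show "(X \<gamma> has_real_derivative V \<gamma> z) (at z within {0..T})" if "z \<in> {0..T}" for z
        by (rule has_field_derivative_subset[OF X_V[OF \<open>\<gamma> \<in> \<Omega>\<close>]]) (use that in auto)
    qed (use C that in auto)
    then show ?thesis by simp
  qed
  then show ?thesis by blast
qed

text \<open>Joint convergence in label and time, needed because the time derivative of the inverse
  flow samples R at a label and a time that move together. Convergence in \<beta> at the fixed time
  t is combined with a Lipschitz bound in time that is uniform in \<beta> near \<alpha>.\<close>

lemma R_close:
  assumes "\<alpha> \<in> \<Omega>" "0 \<le> t" "0 < r"
  shows "\<exists>d>0. \<forall>\<beta>\<in>\<Omega>. \<forall>\<tau>\<ge>0. \<beta> \<noteq> \<alpha> \<longrightarrow> \<bar>\<beta> - \<alpha>\<bar> < d \<longrightarrow> \<bar>\<tau> - t\<bar> < d \<longrightarrow> \<bar>R \<alpha> \<beta> \<tau> - Z \<alpha> t\<bar> < r"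
proof -
  obtain d1 where d1: "0 < d1" "\<And>\<beta>. \<beta> \<noteq> \<alpha> \<Longrightarrow> \<bar>\<beta> - \<alpha>\<bar> < d1 \<Longrightarrow> \<bar>R \<alpha> \<beta> t - Z \<alpha> t\<bar> < r / 2"
  proof -
    have "((\<lambda>\<beta>. R \<alpha> \<beta> t) \<longlongrightarrow> Z \<alpha> t) (at \<alpha>)"
      using X_has_derivative[OF assms(1,2)] unfolding has_field_derivative_iff R_def .
    from LIM_D[OF this, of "r / 2"] show ?thesis using assms(3) that by auto
  qed
  obtain d2 where d2: "0 < d2" "\<And>\<beta>. \<beta> \<noteq> \<alpha> \<Longrightarrow> \<bar>\<beta> - \<alpha>\<bar> < d2 \<Longrightarrow> \<bar>slope \<alpha> \<beta> - \<psi>' \<alpha>\<bar> < 1"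
  proof -
    have "(slope \<alpha> \<longlongrightarrow> \<psi>' \<alpha>) (at \<alpha>)"
      using \<psi>_deriv[OF assms(1)] unfolding has_field_derivative_iff slope_def[abs_def] .
    from LIM_D[OF this, of 1] show ?thesis using that by auto
  qed
  define s where "s = \<bar>\<psi>' \<alpha>\<bar> + 1"
  \<comment> \<open>Bounds the time derivative \<open>slope - Q * R\<close> of R on [0, t + 1], from
    slope \<le> s, Q \<le> K and R \<le> 1 + s (t + 1).\<close>
  define C where "C = s + K * (1 + s * (t + 1))"
  have s: "0 < s" by (simp add: s_def)
  have "0 \<le> s * (t + 1)" using s assms(2) by simp
  then have "0 < K * (1 + s * (t + 1))" using K_pos by simp
  then have C: "0 < C" unfolding C_def using s by simp
  have lip: "\<bar>R \<alpha> \<beta> \<tau> - R \<alpha> \<beta> t\<bar> \<le> C * \<bar>\<tau> - t\<bar>"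
    if b: "\<beta> \<in> \<Omega>" "\<beta> \<noteq> \<alpha>" "\<bar>\<beta> - \<alpha>\<bar> < d2" and \<tau>: "\<tau> \<in> {0..t + 1}" for \<beta> \<tau>
  proof -
    have sl: "0 \<le> slope \<alpha> \<beta>" "slope \<alpha> \<beta> \<le> s"
      using slope_nonneg[OF assms(1) b(1)] d2(2)[OF b(2,3)] by (auto simp: s_def)
    have "norm (R \<alpha> \<beta> \<tau> - R \<alpha> \<beta> t) \<le> C * norm (\<tau> - t)"
    proof (rule field_differentiable_bound[of "{0..t + 1}" _ "\<lambda>z. slope \<alpha> \<beta> - Q \<alpha> \<beta> z * R \<alpha> \<beta> z"])
      fix z assume z: "z \<in> {0..t + 1}"
      have ne: "\<alpha> \<noteq> \<beta>" using b by simp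
      show "(R \<alpha> \<beta> has_real_derivative slope \<alpha> \<beta> - Q \<alpha> \<beta> z * R \<alpha> \<beta> z) (at z within {0..t + 1})"
        by (rule has_field_derivative_subset[OF R_ode[OF assms(1) b(1) ne]]) (use z in auto)
      have "0 \<le> R \<alpha> \<beta> z" using R_lower[OF assms(1) b(1) ne, of z] exp_ge_zero[of "- (K * z)"] z by (meson atLeastAtMost_iff order_trans)
      moreover have "R \<alpha> \<beta> z \<le> 1 + s * (t + 1)"
      proof -
        have "R \<alpha> \<beta> z \<le> 1 + slope \<alpha> \<beta> * z" using R_upper[OF assms(1) b(1) ne] z by simp
        also have "\<dots> \<le> 1 + s * (t + 1)" using sl z by (intro add_left_mono mult_mono) auto
        finally show ?thesis .
      qed
      moreover have "0 \<le> Q \<alpha> \<beta> z" "Q \<alpha> \<beta> z \<le> K" using Q_bounds[OF assms(1) b(1) ne] z by auto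
      ultimately have "Q \<alpha> \<beta> z * R \<alpha> \<beta> z \<le> K * (1 + s * (t + 1))" "0 \<le> Q \<alpha> \<beta> z * R \<alpha> \<beta> z"
        using K_pos by (auto intro!: mult_mono)
      then show "norm (slope \<alpha> \<beta> - Q \<alpha> \<beta> z * R \<alpha> \<beta> z) \<le> C"
        using sl unfolding C_def real_norm_def by linarith
    qed (use \<tau> assms(2) in auto)
    then show ?thesis by simp
  qed
  define d where "d = min (min d1 d2) (min 1 (r / (2 * C)))"
  have "0 < d" using d1(1) d2(1) C assms(3) by (simp add: d_def)
  moreover have "\<bar>R \<alpha> \<beta> \<tau> - Z \<alpha> t\<bar> < r" if "\<beta> \<in> \<Omega>" "0 \<le> \<tau>" "\<beta> \<noteq> \<alpha>" "\<bar>\<beta> - \<alpha>\<bar> < d" "\<bar>\<tau> - t\<bar> < d" for \<beta> \<tau>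
  proof -
    have "C * \<bar>\<tau> - t\<bar> < C * (r / (2 * C))"
      using that(5) C by (intro mult_strict_left_mono) (auto simp: d_def)
    then have "C * \<bar>\<tau> - t\<bar> < r / 2" using C by simp
    moreover have "\<bar>R \<alpha> \<beta> \<tau> - R \<alpha> \<beta> t\<bar> \<le> C * \<bar>\<tau> - t\<bar>"
      by (rule lip) (use that in \<open>auto simp: d_def\<close>)
    moreover have "\<bar>R \<alpha> \<beta> t - Z \<alpha> t\<bar> < r / 2"
      by (rule d1(2)) (use that in \<open>auto simp: d_def\<close>)
    ultimately show ?thesis by linarith
  qed
  ultimately show ?thesis by blast
qed

section \<open>The inverse flow map and its derivatives\<close>

definition g :: "real \<Rightarrow> real \<Rightarrow> real" where "g x t = inv_into \<Omega> (\<lambda>\<alpha>. X \<alpha> t) x"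

lemma inj_X: "0 \<le> t \<Longrightarrow> inj_on (\<lambda>\<alpha>. X \<alpha> t) \<Omega>"
  by (rule inj_onI) (use X_inj in blast)

lemma g_X: "\<alpha> \<in> \<Omega> \<Longrightarrow> 0 \<le> t \<Longrightarrow> g (X \<alpha> t) t = \<alpha>"
  unfolding g_def by (rule inv_into_f_f[OF inj_X])

lemma X_continuous_label: "0 \<le> t \<Longrightarrow> A \<subseteq> \<Omega> \<Longrightarrow> continuous_on A (\<lambda>\<alpha>. X \<alpha> t)"
  using X_has_derivative[THEN DERIV_isCont] by (intro continuous_at_imp_continuous_on) auto

lemma g_between:
  assumes "a \<le> b" "{a..b} \<subseteq> \<Omega>" "0 \<le> \<tau>" "X a \<tau> < y" "y < X b \<tau>"
  shows "a < g y \<tau>" "g y \<tau> < b" "g y \<tau> \<in> \<Omega>" "X (g y \<tau>) \<tau> = y"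
proof -
  obtain c where c: "a \<le> c" "c \<le> b" "X c \<tau> = y"
    using IVT'[of "\<lambda>\<alpha>. X \<alpha> \<tau>" a y b] assms X_continuous_label[OF assms(3,2)] by auto
  have "c \<in> \<Omega>" using c assms(2) by auto
  then have "g y \<tau> = c" using g_X[of c \<tau>] assms(3) c(3) by simp
  moreover have "c \<noteq> a" "c \<noteq> b" using c(3) assms(4,5) by auto
  ultimately show "a < g y \<tau>" "g y \<tau> < b" "g y \<tau> \<in> \<Omega>" "X (g y \<tau>) \<tau> = y"
    using c \<open>c \<in> \<Omega>\<close> by auto
qed

lemma small_interval:
  assumes "\<alpha> \<in> \<Omega>" "0 < r"
  obtains \<epsilon> where "0 < \<epsilon>" "\<epsilon> < r" "{\<alpha> - \<epsilon>..\<alpha> + \<epsilon>} \<subseteq> \<Omega>"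
proof -
  obtain d where d: "0 < d" "cball \<alpha> d \<subseteq> \<Omega>" using open_\<Omega> assms(1) open_contains_cball by blast
  show thesis
  proof (rule that[of "min d (r / 2)"])
    show "{\<alpha> - min d (r / 2)..\<alpha> + min d (r / 2)} \<subseteq> \<Omega>"
    proof
      fix x assume "x \<in> {\<alpha> - min d (r / 2)..\<alpha> + min d (r / 2)}"
      then have "x \<in> cball \<alpha> d" by (simp add: dist_real_def abs_le_iff) linarith
      then show "x \<in> \<Omega>" using d(2) by blast
    qed
  qed (use d assms(2) in auto)
qed

text \<open>The trajectories of two neighbouring labels still enclose the fixed position for nearby
  times. The neighbours span an interval inside \<Omega>, which may be disconnected, so the
  intermediate value theorem applies.\<close>

lemma g_eventually_time:
  assumes "\<alpha> \<in> \<Omega>" "0 \<le> t" "0 < r"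
  shows "\<forall>\<^sub>F \<tau> in at t within {0..}. 0 \<le> \<tau> \<and> g (X \<alpha> t) \<tau> \<in> \<Omega> \<and> \<bar>g (X \<alpha> t) \<tau> - \<alpha>\<bar> < r \<and>
     X (g (X \<alpha> t) \<tau>) \<tau> = X \<alpha> t"
proof -
  obtain \<epsilon> where \<epsilon>: "0 < \<epsilon>" "\<epsilon> < r" "{\<alpha> - \<epsilon>..\<alpha> + \<epsilon>} \<subseteq> \<Omega>" using small_interval[OF assms(1,3)] by blast
  have mem: "\<alpha> - \<epsilon> \<in> \<Omega>" "\<alpha> + \<epsilon> \<in> \<Omega>" using \<epsilon> by auto
  have lim: "(X \<beta> \<longlongrightarrow> X \<beta> t) (at t within {0..})" if "\<beta> \<in> \<Omega>" for \<beta>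
    using DERIV_continuous[OF X_V[OF that assms(2)]] by (simp add: continuous_within)
  have "\<forall>\<^sub>F \<tau> in at t within {0..}. X (\<alpha> - \<epsilon>) \<tau> < X \<alpha> t"
    by (rule order_tendstoD(2)[OF lim[OF mem(1)]]) (use X_less[OF assms(2) mem(1) assms(1)] \<epsilon> in simp)
  moreover have "\<forall>\<^sub>F \<tau> in at t within {0..}. X \<alpha> t < X (\<alpha> + \<epsilon>) \<tau>"
    by (rule order_tendstoD(1)[OF lim[OF mem(2)]]) (use X_less[OF assms(2) assms(1) mem(2)] \<epsilon> in simp)
  moreover have "\<forall>\<^sub>F \<tau> in at t within {0..}. 0 \<le> \<tau>"
    by (simp add: eventually_at_filter)
  ultimately show ?thesis
  proof eventually_elim
    case (elim \<tau>)
    then show ?case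
      using g_between[of "\<alpha> - \<epsilon>" "\<alpha> + \<epsilon>" \<tau> "X \<alpha> t"] \<epsilon> by (auto simp: abs_less_iff)
  qed
qed

text \<open>From x = X (g x \<tau>) \<tau> follows R (g x \<tau> - \<alpha>) = x - X \<alpha>
  \<tau>, so the quotient of g is minus that of the trajectory divided by R. This replaces an
  implicit function theorem, for which no joint continuous differentiability is at hand.\<close>

lemma g_time_derivative:
  assumes "\<alpha> \<in> \<Omega>" "0 \<le> t"
  shows "(g (X \<alpha> t) has_real_derivative - V \<alpha> t / Z \<alpha> t) (at t within {0..})"
proof -
  let ?x = "X \<alpha> t"
  \<comment> \<open>At coinciding labels R is 0 / 0, hence 0; the limit value is inserted
    instead.\<close>
  define Rt where "Rt \<tau> = (if g ?x \<tau> = \<alpha> then Z \<alpha> t else R \<alpha> (g ?x \<tau>) \<tau>)" for \<tau>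
  have "(Rt \<longlongrightarrow> Z \<alpha> t) (at t within {0..})"
  proof (rule tendstoI)
    fix r :: real assume "0 < r"
    then obtain d where d: "0 < d" "\<forall>\<beta>\<in>\<Omega>. \<forall>\<tau>\<ge>0. \<beta> \<noteq> \<alpha> \<longrightarrow> \<bar>\<beta> - \<alpha>\<bar> < d \<longrightarrow> \<bar>\<tau> - t\<bar> < d \<longrightarrow> \<bar>R \<alpha> \<beta> \<tau> - Z \<alpha> t\<bar> < r"
      using R_close[OF assms] by blast
    have "\<forall>\<^sub>F \<tau> in at t within {0..}. \<bar>\<tau> - t\<bar> < d"
      unfolding eventually_at using d(1) by (auto simp: dist_real_def)
    with g_eventually_time[OF assms d(1)] show "\<forall>\<^sub>F \<tau> in at t within {0..}. dist (Rt \<tau>) (Z \<alpha> t) < r"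
    proof eventually_elim
      case (elim \<tau>)
      then show ?case using d(2) \<open>0 < r\<close> by (simp add: Rt_def dist_real_def)
    qed
  qed
  moreover have "((\<lambda>\<tau>. (X \<alpha> \<tau> - ?x) / (\<tau> - t)) \<longlongrightarrow> V \<alpha> t) (at t within {0..})"
    using X_V[OF assms] unfolding has_field_derivative_iff .
  ultimately have "((\<lambda>\<tau>. - ((X \<alpha> \<tau> - ?x) / (\<tau> - t)) / Rt \<tau>) \<longlongrightarrow> - V \<alpha> t / Z \<alpha> t) (at t within {0..})"
    using Z_pos[OF assms] by (intro tendsto_divide tendsto_minus) auto
  moreover have "\<forall>\<^sub>F \<tau> in at t within {0..}. - ((X \<alpha> \<tau> - ?x) / (\<tau> - t)) / Rt \<tau> = (g ?x \<tau> - g ?x t) / (\<tau> - t)"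
    using g_eventually_time[OF assms, of 1, OF zero_less_one]
  proof eventually_elim
    case (elim \<tau>)
    show ?case
    proof (cases "g ?x \<tau> = \<alpha>")
      case True
      then show ?thesis using elim g_X[OF assms] by simp
    next
      case False
      let ?\<beta> = "g ?x \<tau>"
      have R: "0 < R \<alpha> ?\<beta> \<tau>"
        by (rule less_le_trans[OF exp_gt_zero R_lower[OF assms(1)]]) (use elim False in auto)
      have "R \<alpha> ?\<beta> \<tau> * (?\<beta> - \<alpha>) = ?x - X \<alpha> \<tau>" using False elim by (simp add: R_def)
      then have "(?x - X \<alpha> \<tau>) / R \<alpha> ?\<beta> \<tau> = ?\<beta> - \<alpha>" using R by (simp add: field_simps)
      moreover have "- ((X \<alpha> \<tau> - ?x) / (\<tau> - t)) / Rt \<tau> = ((?x - X \<alpha> \<tau>) / R \<alpha> ?\<beta> \<tau>) / (\<tau> - t)"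
        using False by (simp add: Rt_def minus_divide_left)
      ultimately show ?thesis using g_X[OF assms] by simp
    qed
  qed
  ultimately show ?thesis
    unfolding has_field_derivative_iff by (rule Lim_transform_eventually)
qed

lemma g_space:
  assumes "\<alpha> \<in> \<Omega>" "0 \<le> t" "0 < r"
  shows "\<exists>a b. a < X \<alpha> t \<and> X \<alpha> t < b \<and>
    (\<forall>y. a < y \<longrightarrow> y < b \<longrightarrow> g y t \<in> \<Omega> \<and> X (g y t) t = y \<and> \<bar>g y t - \<alpha>\<bar> < r)"
proof -
  obtain \<epsilon> where \<epsilon>: "0 < \<epsilon>" "\<epsilon> < r" "{\<alpha> - \<epsilon>..\<alpha> + \<epsilon>} \<subseteq> \<Omega>" using small_interval[OF assms(1,3)] by blast
  have mem: "\<alpha> - \<epsilon> \<in> \<Omega>" "\<alpha> + \<epsilon> \<in> \<Omega>" using \<epsilon> by auto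
  show ?thesis
  proof (intro exI conjI allI impI)
    show "X (\<alpha> - \<epsilon>) t < X \<alpha> t" using X_less[OF assms(2) mem(1) assms(1)] \<epsilon> by simp
    show "X \<alpha> t < X (\<alpha> + \<epsilon>) t" using X_less[OF assms(2) assms(1) mem(2)] \<epsilon> by simp
    fix y assume "X (\<alpha> - \<epsilon>) t < y" "y < X (\<alpha> + \<epsilon>) t"
    then show "g y t \<in> \<Omega>" "X (g y t) t = y" "\<bar>g y t - \<alpha>\<bar> < r"
      using g_between[of "\<alpha> - \<epsilon>" "\<alpha> + \<epsilon>" t y] \<epsilon> assms(2) by (auto simp: abs_less_iff)
  qed
qed

lemma g_space_derivative:
  assumes "\<alpha> \<in> \<Omega>" "0 \<le> t"
  shows "((\<lambda>y. g y t) has_real_derivative 1 / Z \<alpha> t) (at (X \<alpha> t))"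
proof -
  have "isCont (\<lambda>y. g y t) (X \<alpha> t)"
    unfolding isCont_def g_X[OF assms]
  proof (rule tendstoI)
    fix r :: real assume "0 < r"
    then obtain a b where "a < X \<alpha> t" "X \<alpha> t < b"
      and ab: "\<forall>y. a < y \<longrightarrow> y < b \<longrightarrow> g y t \<in> \<Omega> \<and> X (g y t) t = y \<and> \<bar>g y t - \<alpha>\<bar> < r"
      using g_space[OF assms] by blast
    then have "\<forall>\<^sub>F y in at (X \<alpha> t). y \<in> {a<..<b}"
      by (intro eventually_at_in_open') auto
    then show "\<forall>\<^sub>F y in at (X \<alpha> t). dist (g y t) \<alpha> < r"
      by eventually_elim (use ab in \<open>auto simp: dist_real_def\<close>)
  qed
  moreover obtain a b where "a < X \<alpha> t" "X \<alpha> t < b"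
    and ab: "\<forall>y. a < y \<longrightarrow> y < b \<longrightarrow> g y t \<in> \<Omega> \<and> X (g y t) t = y \<and> \<bar>g y t - \<alpha>\<bar> < 1"
    using g_space[OF assms zero_less_one] by blast
  moreover have "((\<lambda>\<alpha>. X \<alpha> t) has_real_derivative Z \<alpha> t) (at (g (X \<alpha> t) t))"
    using X_has_derivative[OF assms] by (simp add: g_X[OF assms])
  ultimately have "((\<lambda>y. g y t) has_real_derivative inverse (Z \<alpha> t)) (at (X \<alpha> t))"
    using Z_pos[OF assms] ab by (intro DERIV_inverse_function[of "\<lambda>\<alpha>. X \<alpha> t"]) auto
  then show ?thesis by (simp add: inverse_eq_divide)
qed

text \<open>A limit of forward difference quotients of measurable configurations; forward, because
  times must stay nonnegative. Off \<Omega> the quotients vanish.\<close>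

lemma V_measurable: assumes "0 \<le> t" shows "(\<lambda>\<gamma>. V \<gamma> t) \<in> borel_measurable borel"
proof (rule borel_measurable_LIMSEQ_real)
  let ?h = "\<lambda>n. inverse (real (Suc n))"
  show "(\<lambda>\<gamma>. (X \<gamma> (t + ?h n) - X \<gamma> t) / ?h n) \<in> borel_measurable borel" for n
    using assms by (intro borel_measurable_divide borel_measurable_diff X_measurable borel_measurable_const) auto
  show "(\<lambda>n. (X \<gamma> (t + ?h n) - X \<gamma> t) / ?h n) \<longlonglongrightarrow> V \<gamma> t" for \<gamma>
  proof (cases "\<gamma> \<in> \<Omega>")
    case True
    have lim: "(\<lambda>n. t + ?h n) \<longlonglongrightarrow> t"
      using tendsto_add[OF tendsto_const LIMSEQ_inverse_real_of_nat] by simp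
    have ne: "t + ?h n \<in> {0..} - {t}" for n using assms by (simp add: add_nonneg_nonneg)
    have "((\<lambda>\<tau>. (X \<gamma> \<tau> - X \<gamma> t) / (\<tau> - t)) \<longlongrightarrow> V \<gamma> t) (at t within {0..})"
      using X_V[OF True assms] unfolding has_field_derivative_iff .
    from this[unfolded tendsto_at_iff_sequentially comp_def, rule_format, of "\<lambda>n. t + ?h n", OF ne lim]
    show ?thesis by (simp only: add_diff_cancel_left')
  next
    case False
    have "0 \<le> t + ?h n" for n using assms by (simp add: add_nonneg_nonneg)
    then show ?thesis using False S_off[OF X_S] assms by (simp add: V_def)
  qed
qed

section \<open>The Eulerian velocity and the momentum balance\<close>

definition W :: "real \<Rightarrow> real \<Rightarrow> real" where "W x t = (\<integral>\<gamma>. \<Phi> (x - X \<gamma> t) \<partial>m)"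

lemma V_W: "\<alpha> \<in> \<Omega> \<Longrightarrow> V \<alpha> t = \<psi> \<alpha> - W (X \<alpha> t) t"
  by (simp add: V_def W_def F_def)

lemma \<phi>_V_integrable:
  assumes "\<alpha> \<in> \<Omega>" "0 \<le> t" shows "integrable m (\<lambda>\<gamma>. \<phi> (X \<alpha> t - X \<gamma> t) * V \<gamma> t)"
proof -
  obtain C where C: "\<forall>\<gamma>. \<forall>\<tau>\<in>{0..t}. \<bar>V \<gamma> \<tau>\<bar> \<le> C" using V_bound by blast
  show ?thesis
  proof (rule Bochner_Integration.integrable_bound[OF integrable_mult_right[OF \<phi>_integrable[OF assms], of C]])
    show "(\<lambda>\<gamma>. \<phi> (X \<alpha> t - X \<gamma> t) * V \<gamma> t) \<in> borel_measurable m"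
      by (intro borel_measurable_times \<phi>_diff_measurable measurable_m V_measurable assms)
    show "AE \<gamma> in m. norm (\<phi> (X \<alpha> t - X \<gamma> t) * V \<gamma> t) \<le> norm (C * \<phi> (X \<alpha> t - X \<gamma> t))"
    proof (rule AE_I2)
      fix \<gamma>
      have "\<bar>V \<gamma> t\<bar> \<le> \<bar>C\<bar>" using C assms(2) by (meson abs_ge_self atLeastAtMost_iff order_refl order_trans)
      then show "norm (\<phi> (X \<alpha> t - X \<gamma> t) * V \<gamma> t) \<le> norm (C * \<phi> (X \<alpha> t - X \<gamma> t))"
        by (simp add: abs_mult mult.commute mult_right_mono)
    qed
  qed
qed

lemma W_time_derivative:
  assumes "\<alpha> \<in> \<Omega>" "0 \<le> t"
  shows "(W (X \<alpha> t) has_real_derivative - (\<integral>\<gamma>. \<phi> (X \<alpha> t - X \<gamma> t) * V \<gamma> t \<partial>m)) (at t within {0..})"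
proof -
  let ?x = "X \<alpha> t"
  obtain C where C: "\<forall>\<gamma>\<in>\<Omega>. \<forall>\<tau>\<in>{0..t + 1}. \<forall>t'\<in>{0..t + 1}. \<bar>X \<gamma> \<tau> - X \<gamma> t'\<bar> \<le> C * \<bar>\<tau> - t'\<bar>"
    using X_time_lipschitz by blast
  have "((\<lambda>\<tau>. \<integral>\<gamma>. \<Phi> (?x - X \<gamma> \<tau>) \<partial>m) has_real_derivative
      (\<integral>\<gamma>. - (\<phi> (X \<alpha> t - X \<gamma> t) * V \<gamma> t) \<partial>m)) (at t within {0..t + 1})"
  proof (rule has_real_derivative_integral[where g = "\<lambda>\<gamma>. C * B (?x - X \<gamma> t)"])
    show "t \<in> {0..t + 1}" using assms by simp
    show "integrable m (\<lambda>\<gamma>. \<Phi> (?x - X \<gamma> \<tau>))" if "\<tau> \<in> {0..t + 1}" for \<tau>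
      using \<Phi>_integrable[OF X_S, of \<tau> ?x] that by simp
    show "AE \<gamma> in m. ((\<lambda>\<tau>. \<Phi> (?x - X \<gamma> \<tau>)) has_real_derivative - (\<phi> (?x - X \<gamma> t) * V \<gamma> t)) (at t within {0..t + 1})"
      using AE_good[OF assms]
    proof eventually_elim
      case (elim \<gamma>)
      have "(X \<gamma> has_real_derivative V \<gamma> t) (at t within {0..t + 1})"
        by (rule has_field_derivative_subset[OF X_V]) (use elim assms in auto)
      then have "((\<lambda>\<tau>. ?x - X \<gamma> \<tau>) has_real_derivative 0 - V \<gamma> t) (at t within {0..t + 1})"
        by (intro DERIV_diff DERIV_const)
      then have "((\<lambda>\<tau>. \<Phi> (?x - X \<gamma> \<tau>)) has_real_derivative \<phi> (?x - X \<gamma> t) * (0 - V \<gamma> t)) (at t within {0..t + 1})"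
        using \<phi>_deriv[of "?x - X \<gamma> t"] elim
        by (intro DERIV_chain2[where f = \<Phi> and g = "\<lambda>\<tau>. ?x - X \<gamma> \<tau>"]) simp_all
      then show ?case by simp
    qed
    show "AE \<gamma> in m. \<bar>\<Phi> (?x - X \<gamma> \<tau>) - \<Phi> (?x - X \<gamma> t)\<bar> \<le> \<bar>\<tau> - t\<bar> * (C * B (?x - X \<gamma> t))"
      if \<tau>: "\<tau> \<in> {0..t + 1}" for \<tau>
      using AE_good[OF assms]
    proof eventually_elim
      case (elim \<gamma>)
      have "\<bar>\<Phi> (?x - X \<gamma> \<tau>) - \<Phi> (?x - X \<gamma> t)\<bar> \<le> \<bar>X \<gamma> t - X \<gamma> \<tau>\<bar> * B (?x - X \<gamma> t)"
        using lip_\<Phi>[of "?x - X \<gamma> t" "X \<gamma> t - X \<gamma> \<tau>"] elim by simp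
      also have "\<dots> \<le> (C * \<bar>\<tau> - t\<bar>) * B (?x - X \<gamma> t)"
      proof (rule mult_right_mono[OF _ B_nonneg])
        show "\<bar>X \<gamma> t - X \<gamma> \<tau>\<bar> \<le> C * \<bar>\<tau> - t\<bar>"
          using C elim \<tau> assms(2) by (subst abs_minus_commute) simp
      qed
      finally show ?case by (simp add: mult_ac)
    qed
    show "(\<lambda>\<gamma>. - (\<phi> (X \<alpha> t - X \<gamma> t) * V \<gamma> t)) \<in> borel_measurable m"
      by (intro borel_measurable_uminus borel_measurable_times \<phi>_diff_measurable measurable_m V_measurable assms)
  qed (rule integrable_mult_right[OF B_integrable[OF assms]])
  moreover have "at t within {0..t + 1} = at t within {0..}"
    by (rule at_within_nhd[of _ "{t - 1<..<t + 1}"]) auto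
  ultimately show ?thesis by (simp add: W_def[abs_def])
qed

definition u :: "real \<Rightarrow> real \<Rightarrow> real" where "u x t = V (g x t) t"

lemma u_X: "\<alpha> \<in> \<Omega> \<Longrightarrow> 0 \<le> t \<Longrightarrow> u (X \<alpha> t) t = V \<alpha> t"
  by (simp add: u_def g_X)

text \<open>On the occupied region u is \<psi> composed with the inverse flow, minus the convolution
  W; both parts are differentiated at a fixed position.\<close>

lemma u_time_derivative:
  assumes "\<alpha> \<in> \<Omega>" "0 \<le> t"
  shows "(u (X \<alpha> t) has_real_derivative
     \<psi>' \<alpha> * (- V \<alpha> t / Z \<alpha> t) + (\<integral>\<gamma>. \<phi> (X \<alpha> t - X \<gamma> t) * V \<gamma> t \<partial>m)) (at t within {0..})"
proof -
  let ?x = "X \<alpha> t"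
  have "((\<lambda>\<tau>. \<psi> (g ?x \<tau>)) has_real_derivative \<psi>' \<alpha> * (- V \<alpha> t / Z \<alpha> t)) (at t within {0..})"
    by (rule DERIV_chain2[where f = \<psi>, OF _ g_time_derivative[OF assms]])
      (simp add: g_X[OF assms] \<psi>_deriv[OF assms(1)])
  then have d: "((\<lambda>\<tau>. \<psi> (g ?x \<tau>) - W ?x \<tau>) has_real_derivative
     \<psi>' \<alpha> * (- V \<alpha> t / Z \<alpha> t) - - (\<integral>\<gamma>. \<phi> (X \<alpha> t - X \<gamma> t) * V \<gamma> t \<partial>m)) (at t within {0..})"
    by (intro DERIV_diff W_time_derivative[OF assms])
  have u_eq: "\<psi> (g ?x \<tau>) - W ?x \<tau> = u ?x \<tau>" if "g ?x \<tau> \<in> \<Omega>" "X (g ?x \<tau>) \<tau> = ?x" for \<tau>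
    using V_W[OF that(1), of \<tau>] that(2) by (simp add: u_def)
  obtain r where r: "0 < r" "\<forall>\<tau>\<in>{0..}. \<tau> \<noteq> t \<and> dist \<tau> t < r \<longrightarrow> g ?x \<tau> \<in> \<Omega> \<and> X (g ?x \<tau>) \<tau> = ?x"
    using g_eventually_time[OF assms zero_less_one] unfolding eventually_at by blast
  have "(u ?x has_real_derivative
     \<psi>' \<alpha> * (- V \<alpha> t / Z \<alpha> t) - - (\<integral>\<gamma>. \<phi> (X \<alpha> t - X \<gamma> t) * V \<gamma> t \<partial>m)) (at t within {0..})"
  proof (rule has_field_derivative_transform_within[OF d r(1)])
    show "t \<in> {0..}" using assms by simp
    fix \<tau> :: real assume "\<tau> \<in> {0..}" "dist \<tau> t < r"
    then show "\<psi> (g ?x \<tau>) - W ?x \<tau> = u ?x \<tau>"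
      using u_eq[of \<tau>] r(2) g_X[OF assms] assms(1) by (cases "\<tau> = t") auto
  qed
  then show ?thesis by simp
qed

lemma u_space_derivative:
  assumes "\<alpha> \<in> \<Omega>" "0 \<le> t"
  shows "((\<lambda>y. u y t) has_real_derivative \<psi>' \<alpha> / Z \<alpha> t - q \<alpha> t) (at (X \<alpha> t))"
proof -
  let ?x = "X \<alpha> t"
  have "((\<lambda>y. \<psi> (g y t)) has_real_derivative \<psi>' \<alpha> * (1 / Z \<alpha> t)) (at ?x)"
    by (rule DERIV_chain2[where f = \<psi> and g = "\<lambda>y. g y t", OF _ g_space_derivative[OF assms]])
      (simp add: g_X[OF assms] \<psi>_deriv[OF assms(1)])
  moreover have "((\<lambda>y. W y t) has_real_derivative q \<alpha> t) (at ?x)"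
    unfolding W_def by (rule convolution_has_derivative[OF assms])
  ultimately have d: "((\<lambda>y. \<psi> (g y t) - W y t) has_real_derivative \<psi>' \<alpha> * (1 / Z \<alpha> t) - q \<alpha> t) (at ?x)"
    by (rule DERIV_diff)
  obtain a b where x: "a < ?x" "?x < b"
    and ab: "\<forall>y. a < y \<longrightarrow> y < b \<longrightarrow> g y t \<in> \<Omega> \<and> X (g y t) t = y \<and> \<bar>g y t - \<alpha>\<bar> < 1"
    using g_space[OF assms zero_less_one] by blast
  have "((\<lambda>y. u y t) has_real_derivative \<psi>' \<alpha> * (1 / Z \<alpha> t) - q \<alpha> t) (at ?x)"
  proof (rule has_field_derivative_transform_within_open[OF d])
    fix y assume "y \<in> {a<..<b}"
    then have "g y t \<in> \<Omega>" "X (g y t) t = y" using ab by auto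
    then show "\<psi> (g y t) - W y t = u y t" using V_W[of "g y t" t] by (simp add: u_def)
  qed (use x in auto)
  then show ?thesis by simp
qed

text \<open>In the material derivative the two terms with
  \<open>\<psi>' \<alpha> / Z \<alpha> t\<close> cancel, and q turns \<open>V \<alpha> t\<close>
  into the subtracted part of the alignment integral.\<close>

lemma momentum_equation:
  assumes "\<alpha> \<in> \<Omega>" "0 \<le> t"
  shows "integrable m (\<lambda>\<gamma>. \<phi> (X \<alpha> t - X \<gamma> t) * (V \<gamma> t - V \<alpha> t))"
    and "(\<psi>' \<alpha> * (- V \<alpha> t / Z \<alpha> t) + (\<integral>\<gamma>. \<phi> (X \<alpha> t - X \<gamma> t) * V \<gamma> t \<partial>m)) + V \<alpha> t * (\<psi>' \<alpha> / Z \<alpha> t - q \<alpha> t)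
      = (\<integral>\<gamma>. \<phi> (X \<alpha> t - X \<gamma> t) * (V \<gamma> t - V \<alpha> t) \<partial>m)"
proof -
  have i: "integrable m (\<lambda>\<gamma>. \<phi> (X \<alpha> t - X \<gamma> t) * V \<alpha> t)"
    by (rule integrable_mult_left[OF \<phi>_integrable[OF assms]])
  show "integrable m (\<lambda>\<gamma>. \<phi> (X \<alpha> t - X \<gamma> t) * (V \<gamma> t - V \<alpha> t))"
    unfolding right_diff_distrib by (rule Bochner_Integration.integrable_diff[OF \<phi>_V_integrable[OF assms] i])
  have "(\<integral>\<gamma>. \<phi> (X \<alpha> t - X \<gamma> t) * (V \<gamma> t - V \<alpha> t) \<partial>m) =
      (\<integral>\<gamma>. \<phi> (X \<alpha> t - X \<gamma> t) * V \<gamma> t \<partial>m) - q \<alpha> t * V \<alpha> t"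
    unfolding right_diff_distrib Bochner_Integration.integral_diff[OF \<phi>_V_integrable[OF assms] i]
    by (simp add: q_def)
  then show "(\<psi>' \<alpha> * (- V \<alpha> t / Z \<alpha> t) + (\<integral>\<gamma>. \<phi> (X \<alpha> t - X \<gamma> t) * V \<gamma> t \<partial>m)) + V \<alpha> t * (\<psi>' \<alpha> / Z \<alpha> t - q \<alpha> t)
      = (\<integral>\<gamma>. \<phi> (X \<alpha> t - X \<gamma> t) * (V \<gamma> t - V \<alpha> t) \<partial>m)"
    by (simp add: algebra_simps)
qed

end

section \<open>The Euler Alignment equations\<close>

locale eulerian_flow = lagrangian_flow +
  fixes \<rho>\<^sub>0 :: "real \<Rightarrow> real"
  assumes m_eq: "m = density lborel (\<lambda>x. ennreal (\<rho>\<^sub>0 x))" and \<rho>\<^sub>0_measurable: "\<rho>\<^sub>0 \<in> borel_measurable borel"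
    and \<rho>\<^sub>0_pos: "\<And>x. x \<in> \<Omega> \<Longrightarrow> 0 < \<rho>\<^sub>0 x" and \<rho>\<^sub>0_off: "\<And>x. x \<notin> \<Omega> \<Longrightarrow> \<rho>\<^sub>0 x = 0"
begin

lemma \<rho>\<^sub>0_nonneg: "0 \<le> \<rho>\<^sub>0 x"
  using \<rho>\<^sub>0_pos[of x] \<rho>\<^sub>0_off[of x] by (cases "x \<in> \<Omega>") auto

lemma \<rho>\<^sub>0_integrable: "integrable lborel \<rho>\<^sub>0"
proof (rule integrableI_nonneg)
  have "emeasure m UNIV = (\<integral>\<^sup>+ x. ennreal (\<rho>\<^sub>0 x) \<partial>lborel)"
    unfolding m_eq using \<rho>\<^sub>0_measurable by (subst emeasure_density) auto
  moreover have "emeasure m UNIV < \<infinity>"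
    using finite_measure.emeasure_finite[OF finite_m, of UNIV] by (simp add: less_top)
  ultimately show "(\<integral>\<^sup>+ x. ennreal (\<rho>\<^sub>0 x) \<partial>lborel) < \<infinity>" by simp
qed (use \<rho>\<^sub>0_measurable \<rho>\<^sub>0_nonneg in auto)

lemma m_integrable_iff:
  "f \<in> borel_measurable borel \<Longrightarrow> integrable m f \<longleftrightarrow> integrable lborel (\<lambda>x. \<rho>\<^sub>0 x * f x)"
  unfolding m_eq using \<rho>\<^sub>0_measurable \<rho>\<^sub>0_nonneg by (subst integrable_real_density) auto

lemma m_integral:
  "f \<in> borel_measurable borel \<Longrightarrow> (\<integral>x. f x \<partial>m) = (\<integral>x. \<rho>\<^sub>0 x * f x \<partial>lborel)"
  unfolding m_eq using \<rho>\<^sub>0_measurable \<rho>\<^sub>0_nonneg by (subst integral_real_density) auto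

section \<open>The density as push-forward of the initial mass\<close>

definition U :: "real \<Rightarrow> real set" where "U t = (\<lambda>\<alpha>. X \<alpha> t) ` \<Omega>"

definition \<rho> :: "real \<Rightarrow> real \<Rightarrow> real" where
  "\<rho> x t = (if x \<in> U t then \<rho>\<^sub>0 (g x t) / Z (g x t) t else 0)"

lemma g_U: "x \<in> U t \<Longrightarrow> 0 \<le> t \<Longrightarrow> g x t \<in> \<Omega>" "x \<in> U t \<Longrightarrow> 0 \<le> t \<Longrightarrow> X (g x t) t = x"
  by (auto simp: U_def g_X)

lemma \<rho>_X: "\<alpha> \<in> \<Omega> \<Longrightarrow> 0 \<le> t \<Longrightarrow> \<rho> (X \<alpha> t) t = \<rho>\<^sub>0 \<alpha> / Z \<alpha> t"
  by (simp add: \<rho>_def U_def g_X)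

lemma \<rho>_pos: "x \<in> U t \<Longrightarrow> 0 \<le> t \<Longrightarrow> 0 < \<rho> x t"
  using \<rho>\<^sub>0_pos Z_pos g_U by (simp add: \<rho>_def)

lemma \<rho>_nonneg: "0 \<le> t \<Longrightarrow> 0 \<le> \<rho> x t"
  using \<rho>_pos[of x t] by (cases "x \<in> U t") (auto simp: \<rho>_def)

lemma fluid_domain_eq: "0 \<le> t \<Longrightarrow> fluid_domain \<rho> t = U t"
  using \<rho>_pos unfolding fluid_domain_def by (auto simp: \<rho>_def split: if_splits)

lemma Z_0: "Z \<alpha> 0 = 1" by (simp add: Z_def)

lemma \<rho>_initial: "\<rho> x 0 = \<rho>\<^sub>0 x"
proof (cases "x \<in> \<Omega>")
  case True
  then show ?thesis using \<rho>_X[OF True, of 0] X_0[OF True] Z_0 by simp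
next
  case False
  have "U 0 = \<Omega>" using X_0 by (simp add: U_def)
  then show ?thesis using False \<rho>\<^sub>0_off by (simp add: \<rho>_def)
qed

lemma open_U: assumes "0 \<le> t" shows "open (U t)"
proof (subst open_subopen, intro ballI)
  fix x assume "x \<in> U t"
  then obtain \<alpha> where \<alpha>: "\<alpha> \<in> \<Omega>" "x = X \<alpha> t" by (auto simp: U_def)
  obtain a b where ab: "a < X \<alpha> t" "X \<alpha> t < b"
    "\<forall>y. a < y \<longrightarrow> y < b \<longrightarrow> g y t \<in> \<Omega> \<and> X (g y t) t = y \<and> \<bar>g y t - \<alpha>\<bar> < 1"
    using g_space[OF \<alpha>(1) assms zero_less_one] by blast
  have "{a<..<b} \<subseteq> U t"
  proof
    fix y assume "y \<in> {a<..<b}"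
    then have "g y t \<in> \<Omega>" "y = X (g y t) t" using ab(3) by auto
    then show "y \<in> U t" unfolding U_def by (rule rev_image_eqI)
  qed
  then show "\<exists>T. open T \<and> x \<in> T \<and> T \<subseteq> U t"
    using ab \<alpha> by (intro exI[of _ "{a<..<b}"]) simp
qed

text \<open>Outside the image \<open>inv_into\<close> returns unspecified values; truncation gives a
  function whose Borel measurability can be proved from monotonicity on \<open>U t\<close>.\<close>

definition g\<^sub>0 :: "real \<Rightarrow> real \<Rightarrow> real" where "g\<^sub>0 t x = indicator (U t) x *\<^sub>R g x t"

lemma g\<^sub>0_measurable: assumes "0 \<le> t" shows "g\<^sub>0 t \<in> borel_measurable borel"
proof -
  have "mono_on (U t) (\<lambda>x. g x t)"
  proof (rule mono_onI)
    fix x y assume xy: "x \<in> U t" "y \<in> U t" "x \<le> y"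
    show "g x t \<le> g y t"
    proof (rule ccontr)
      assume "\<not> g x t \<le> g y t"
      then have "X (g y t) t < X (g x t) t"
        by (intro X_less[OF assms] g_U xy assms) simp
      then show False using g_U(2) xy assms by simp
    qed
  qed
  then have "(\<lambda>x. g x t) \<in> borel_measurable (restrict_space borel (U t))"
    by (rule borel_measurable_mono_on_fnc)
  then show ?thesis
    unfolding g\<^sub>0_def[abs_def]
    using borel_measurable_restrict_space_iff[of "U t" borel "\<lambda>x. g x t"] open_U[OF assms] by simp
qed

lemma Z_measurable: assumes "0 \<le> t" shows "(\<lambda>\<gamma>. indicator \<Omega> \<gamma> * Z \<gamma> t) \<in> borel_measurable borel"
proof (rule borel_measurable_LIMSEQ_real)
  let ?h = "\<lambda>n. inverse (real (Suc n))"
  have X: "(\<lambda>\<alpha>. X \<alpha> t) \<in> borel_measurable borel" by (rule X_measurable[OF assms])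
  have I: "indicator \<Omega> \<in> borel_measurable borel" using open_\<Omega> by simp
  show "(\<lambda>\<gamma>. indicator \<Omega> \<gamma> * ((X (\<gamma> + ?h n) t - X \<gamma> t) / ?h n)) \<in> borel_measurable borel" for n
    by (intro borel_measurable_times I borel_measurable_divide borel_measurable_diff X borel_measurable_const
        measurable_compose[OF _ X] borel_measurable_add) simp_all
  show "(\<lambda>n. indicator \<Omega> \<gamma> * ((X (\<gamma> + ?h n) t - X \<gamma> t) / ?h n)) \<longlonglongrightarrow> indicator \<Omega> \<gamma> * Z \<gamma> t" for \<gamma>
  proof (cases "\<gamma> \<in> \<Omega>")
    case True
    have lim: "(\<lambda>n. \<gamma> + ?h n) \<longlonglongrightarrow> \<gamma>"
      using tendsto_add[OF tendsto_const LIMSEQ_inverse_real_of_nat] by simp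
    have ne: "\<gamma> + ?h n \<in> UNIV - {\<gamma>}" for n by simp
    have "((\<lambda>\<beta>. (X \<beta> t - X \<gamma> t) / (\<beta> - \<gamma>)) \<longlongrightarrow> Z \<gamma> t) (at \<gamma>)"
      using X_has_derivative[OF True assms] unfolding has_field_derivative_iff .
    from this[unfolded tendsto_at_iff_sequentially comp_def, rule_format, of "\<lambda>n. \<gamma> + ?h n", OF ne lim]
    have "(\<lambda>n. (X (\<gamma> + ?h n) t - X \<gamma> t) / ?h n) \<longlonglongrightarrow> Z \<gamma> t" by (simp only: add_diff_cancel_left')
    then show ?thesis using True by simp
  qed simp
qed

lemma \<rho>_measurable: assumes "0 \<le> t" shows "(\<lambda>x. \<rho> x t) \<in> borel_measurable borel"
proof -
  have "(\<lambda>x. \<rho> x t) = (\<lambda>x. indicator (U t) x * (\<rho>\<^sub>0 (g\<^sub>0 t x) / (indicator \<Omega> (g\<^sub>0 t x) * Z (g\<^sub>0 t x) t)))"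
    using g_U(1)[OF _ assms] by (auto simp: \<rho>_def g\<^sub>0_def fun_eq_iff)
  moreover have "indicator (U t) \<in> borel_measurable borel" using open_U[OF assms] by simp
  ultimately show ?thesis
    by (simp only:) (intro borel_measurable_times borel_measurable_divide
      measurable_compose[OF g\<^sub>0_measurable[OF assms] \<rho>\<^sub>0_measurable]
      measurable_compose[OF g\<^sub>0_measurable[OF assms] Z_measurable[OF assms]])
qed

text \<open>The Jacobian cancels the denominator in the density: on \<Omega>,
  \<open>Z \<gamma> t\<close> times the density at \<open>X \<gamma> t\<close> is
  \<open>\<rho>\<^sub>0 \<gamma>\<close>. The vanishing of both densities off their domains turns
  set integrals into integrals over the line.\<close>

lemma change_of_variables_indicator:
  assumes t: "0 \<le> t" and A: "A \<in> sets borel"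
  shows "integrable lborel (\<lambda>y. \<rho> y t * indicator A y)"
    and "(\<integral>y. \<rho> y t * indicator A y \<partial>lborel) = (\<integral>\<gamma>. \<rho>\<^sub>0 \<gamma> * indicator A (X \<gamma> t) \<partial>lborel)"
proof -
  let ?f = "\<lambda>y. \<rho> y t * indicator A y" and ?h = "\<lambda>\<gamma>. \<rho>\<^sub>0 \<gamma> * indicator A (X \<gamma> t)"
  have hm: "?h \<in> borel_measurable borel"
    by (intro borel_measurable_times \<rho>\<^sub>0_measurable measurable_compose[OF X_measurable[OF t]]
        borel_measurable_indicator A)
  have hi: "integrable lborel ?h"
    by (rule Bochner_Integration.integrable_bound[OF \<rho>\<^sub>0_integrable]) (use hm in \<open>auto simp: indicator_def\<close>)
  have off: "indicator \<Omega> \<gamma> *\<^sub>R ?h \<gamma> = ?h \<gamma>" for \<gamma> using \<rho>\<^sub>0_off[of \<gamma>] by (cases "\<gamma> \<in> \<Omega>") auto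
  have foff: "indicator (U t) y *\<^sub>R ?f y = ?f y" for y by (cases "y \<in> U t") (auto simp: \<rho>_def)
  have fm: "?f \<in> borel_measurable borel"
    by (intro borel_measurable_times \<rho>_measurable[OF t] borel_measurable_indicator A)
  have "set_integrable lebesgue \<Omega> ?h"
    unfolding set_integrable_def off by (subst integrable_completion) (use hm hi in auto)
  moreover have "integral \<Omega> ?h = (\<integral>\<gamma>. ?h \<gamma> \<partial>lborel)"
  proof -
    have "integral \<Omega> ?h = (LINT \<gamma>:\<Omega>|lebesgue. ?h \<gamma>)"
      using set_lebesgue_integral_eq_integral(2)[OF \<open>set_integrable lebesgue \<Omega> ?h\<close>] by simp
    also have "\<dots> = (\<integral>\<gamma>. ?h \<gamma> \<partial>lborel)"
      unfolding set_lebesgue_integral_def off by (rule integral_completion) (use hm in simp)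
    finally show ?thesis .
  qed
  moreover have e: "\<bar>Z \<gamma> t\<bar> * ?f (X \<gamma> t) = ?h \<gamma>" if "\<gamma> \<in> \<Omega>" for \<gamma>
    using \<rho>_X[OF that t] Z_pos[OF that t] by simp
  ultimately have "(\<lambda>\<gamma>. \<bar>Z \<gamma> t\<bar> * ?f (X \<gamma> t)) absolutely_integrable_on \<Omega>"
    "integral \<Omega> (\<lambda>\<gamma>. \<bar>Z \<gamma> t\<bar> * ?f (X \<gamma> t)) = (\<integral>\<gamma>. ?h \<gamma> \<partial>lborel)"
    using set_integrable_cong[OF refl refl e, of \<Omega> "\<lambda>x. x" lebesgue]
      Henstock_Kurzweil_Integration.integral_cong[OF e, of \<Omega> "\<lambda>x. x"] by simp_all
  then have f: "?f absolutely_integrable_on ((\<lambda>\<alpha>. X \<alpha> t) ` \<Omega>)"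
    "integral ((\<lambda>\<alpha>. X \<alpha> t) ` \<Omega>) ?f = (\<integral>\<gamma>. ?h \<gamma> \<partial>lborel)"
    using has_absolute_integral_change_of_variables_1'[of \<Omega> "\<lambda>\<alpha>. X \<alpha> t" "\<lambda>\<alpha>. Z \<alpha> t" ?f "\<integral>\<gamma>. ?h \<gamma> \<partial>lborel"]
      inj_X[OF t] X_has_derivative[OF _ t] open_\<Omega> by (auto intro: has_field_derivative_at_within)
  from f(1) show "integrable lborel ?f"
    unfolding U_def[symmetric] set_integrable_def foff by (subst (asm) integrable_completion) (use fm in auto)
  have "(\<integral>\<gamma>. ?h \<gamma> \<partial>lborel) = (LINT y:U t|lebesgue. ?f y)"
    using set_lebesgue_integral_eq_integral(2)[OF f(1)] f(2) by (simp add: U_def)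
  also have "\<dots> = (\<integral>y. ?f y \<partial>lborel)"
    unfolding set_lebesgue_integral_def foff by (rule integral_completion) (use fm in simp)
  finally show "(\<integral>y. ?f y \<partial>lborel) = (\<integral>\<gamma>. ?h \<gamma> \<partial>lborel)" by simp
qed

text \<open>Conservation of mass as an identity of measures, from which every Eulerian integral
  becomes one over labels.\<close>

lemma push_forward:
  assumes t: "0 \<le> t"
  shows "distr m borel (\<lambda>\<alpha>. X \<alpha> t) = density lborel (\<lambda>y. ennreal (\<rho> y t))"
proof (rule measure_eqI)
  have Xm: "(\<lambda>\<alpha>. X \<alpha> t) \<in> measurable m borel"
    by (rule measurable_m[OF X_measurable[OF t]])
  fix A assume "A \<in> sets (distr m borel (\<lambda>\<alpha>. X \<alpha> t))"
  then have A: "A \<in> sets borel" by simp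
  have pre: "(\<lambda>\<alpha>. X \<alpha> t) -` A \<in> sets borel"
    using measurable_sets[OF X_measurable[OF t] A] by simp
  have "emeasure (distr m borel (\<lambda>\<alpha>. X \<alpha> t)) A = emeasure m ((\<lambda>\<alpha>. X \<alpha> t) -` A)"
    using emeasure_distr[OF Xm A] by simp
  also have "\<dots> = (\<integral>\<^sup>+ \<gamma>. ennreal (\<rho>\<^sub>0 \<gamma>) * indicator ((\<lambda>\<alpha>. X \<alpha> t) -` A) \<gamma> \<partial>lborel)"
    unfolding m_eq by (rule emeasure_density) (use \<rho>\<^sub>0_measurable pre in auto)
  also have "\<dots> = (\<integral>\<^sup>+ \<gamma>. ennreal (\<rho>\<^sub>0 \<gamma> * indicator A (X \<gamma> t)) \<partial>lborel)"
    by (intro nn_integral_cong) (auto simp: indicator_def)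
  also have "\<dots> = ennreal (\<integral>\<gamma>. \<rho>\<^sub>0 \<gamma> * indicator A (X \<gamma> t) \<partial>lborel)"
  proof (rule nn_integral_eq_integral)
    show "integrable lborel (\<lambda>\<gamma>. \<rho>\<^sub>0 \<gamma> * indicator A (X \<gamma> t))"
    proof (rule Bochner_Integration.integrable_bound[OF \<rho>\<^sub>0_integrable])
      have "(\<lambda>\<gamma>. \<rho>\<^sub>0 \<gamma> * indicator A (X \<gamma> t)) \<in> borel_measurable borel"
        by (intro borel_measurable_times \<rho>\<^sub>0_measurable measurable_compose[OF X_measurable[OF t]]
            borel_measurable_indicator A)
      then show "(\<lambda>\<gamma>. \<rho>\<^sub>0 \<gamma> * indicator A (X \<gamma> t)) \<in> borel_measurable lborel" by simp
    qed (auto simp: indicator_def)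
  qed (simp add: \<rho>\<^sub>0_nonneg)
  also have "\<dots> = ennreal (\<integral>y. \<rho> y t * indicator A y \<partial>lborel)"
    using change_of_variables_indicator(2)[OF t A] by simp
  also have "\<dots> = (\<integral>\<^sup>+ y. ennreal (\<rho> y t * indicator A y) \<partial>lborel)"
    by (rule nn_integral_eq_integral[symmetric])
      (use change_of_variables_indicator(1)[OF t A] \<rho>_nonneg[OF t] in auto)
  also have "\<dots> = (\<integral>\<^sup>+ y. ennreal (\<rho> y t) * indicator A y \<partial>lborel)"
    by (intro nn_integral_cong) (auto simp: indicator_def)
  also have "\<dots> = emeasure (density lborel (\<lambda>y. ennreal (\<rho> y t))) A"
    by (rule emeasure_density[symmetric]) (use \<rho>_measurable[OF t] A in auto)
  finally show "emeasure (distr m borel (\<lambda>\<alpha>. X \<alpha> t)) A = emeasure (density lborel (\<lambda>y. ennreal (\<rho> y t))) A" .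
qed simp

lemma eulerian_integral:
  assumes t: "0 \<le> t" and f: "f \<in> borel_measurable borel"
  shows "integrable lborel (\<lambda>y. \<rho> y t * f y) \<longleftrightarrow> integrable m (\<lambda>\<gamma>. f (X \<gamma> t))"
    and "(\<integral>y. \<rho> y t * f y \<partial>lborel) = (\<integral>\<gamma>. f (X \<gamma> t) \<partial>m)"
proof -
  have Xm: "(\<lambda>\<alpha>. X \<alpha> t) \<in> measurable m borel"
    by (rule measurable_m[OF X_measurable[OF t]])
  have "integrable lborel (\<lambda>y. \<rho> y t * f y) \<longleftrightarrow> integrable (density lborel (\<lambda>y. ennreal (\<rho> y t))) f"
    by (rule integrable_real_density[symmetric]) (use f \<rho>_measurable[OF t] \<rho>_nonneg[OF t] in auto)
  also have "\<dots> \<longleftrightarrow> integrable m (\<lambda>\<gamma>. f (X \<gamma> t))"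
    unfolding push_forward[OF t, symmetric] by (rule integrable_distr_eq[OF Xm f])
  finally show "integrable lborel (\<lambda>y. \<rho> y t * f y) \<longleftrightarrow> integrable m (\<lambda>\<gamma>. f (X \<gamma> t))" .
  have "(\<integral>y. \<rho> y t * f y \<partial>lborel) = (\<integral>y. f y \<partial>density lborel (\<lambda>y. ennreal (\<rho> y t)))"
    by (rule integral_real_density[symmetric]) (use f \<rho>_measurable[OF t] \<rho>_nonneg[OF t] in auto)
  also have "\<dots> = (\<integral>\<gamma>. f (X \<gamma> t) \<partial>m)"
    unfolding push_forward[OF t, symmetric] by (rule integral_distr[OF Xm f])
  finally show "(\<integral>y. \<rho> y t * f y \<partial>lborel) = (\<integral>\<gamma>. f (X \<gamma> t) \<partial>m)" .
qed

text \<open>A Borel representative of u, equal to it on the fluid domain; elsewhere the factor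
  \<rho> = 0 hides the difference.\<close>

definition u_ext :: "real \<Rightarrow> real \<Rightarrow> real" where "u_ext t x = V (g\<^sub>0 t x) t"

lemma u_ext_measurable: "0 \<le> t \<Longrightarrow> u_ext t \<in> borel_measurable borel"
  unfolding u_ext_def[abs_def] by (rule measurable_compose[OF g\<^sub>0_measurable V_measurable])

lemma u_ext_eq: "x \<in> U t \<Longrightarrow> u_ext t x = u x t"
  by (simp add: u_ext_def u_def g\<^sub>0_def)

lemma \<rho>_u: "\<rho> x t * u x t = \<rho> x t * u_ext t x"
  using u_ext_eq[of x t] by (cases "x \<in> U t") (auto simp: \<rho>_def)

lemma u_ext_X: "\<alpha> \<in> \<Omega> \<Longrightarrow> 0 \<le> t \<Longrightarrow> u_ext t (X \<alpha> t) = V \<alpha> t"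
  using u_X u_ext_eq[of "X \<alpha> t" t] by (simp add: U_def)

lemma V_integrable: assumes "0 \<le> t" shows "integrable m (\<lambda>\<gamma>. V \<gamma> t)"
proof -
  obtain C where C: "\<forall>\<gamma>. \<forall>\<tau>\<in>{0..t}. \<bar>V \<gamma> \<tau>\<bar> \<le> C" using V_bound by blast
  show ?thesis
    by (rule finite_measure.integrable_const_bound[OF finite_m _ measurable_m[OF V_measurable[OF assms]], of C])
      (use C assms in auto)
qed

lemma test_function_derivative:
  assumes "test_function UNIV \<eta>"
  shows "(\<eta> has_real_derivative deriv \<eta> x) (at x)" "continuous_on UNIV (deriv \<eta>)"
    "\<exists>C. \<forall>x. \<bar>\<eta> x\<bar> \<le> C" "\<exists>C. \<forall>x. \<bar>deriv \<eta> x\<bar> \<le> C"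
proof -
  have d: "(deriv ^^ n) \<eta> differentiable (at x)" for n x using assms by (simp add: test_function_def)
  show d0: "(\<eta> has_real_derivative deriv \<eta> x) (at x)" for x
    using d[of 0 x] by (simp add: DERIV_deriv_iff_real_differentiable)
  have c1: "isCont (deriv \<eta>) x" for x
    using differentiable_imp_continuous_within[OF d[of 1 x]] by simp
  then show c: "continuous_on UNIV (deriv \<eta>)" by (intro continuous_at_imp_continuous_on) simp
  obtain K where K: "compact K" "\<forall>x. x \<notin> K \<longrightarrow> \<eta> x = 0" using assms by (auto simp: test_function_def)
  have deriv0: "deriv \<eta> x = 0" if "x \<notin> K" for x
  proof -
    have "((\<lambda>x. 0) has_real_derivative 0) (at x)" by simp
    then have "(\<eta> has_real_derivative 0) (at x)"
      by (rule has_field_derivative_transform_within_open[of _ _ _ "- K"])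
        (use K compact_imp_closed that in auto)
    then show ?thesis by (rule DERIV_imp_deriv)
  qed
  have bdd: "\<exists>C. \<forall>x. \<bar>f x\<bar> \<le> C" if f: "continuous_on UNIV f" "\<And>x. x \<notin> K \<Longrightarrow> f x = 0" for f :: "real \<Rightarrow> real"
  proof -
    have "bounded (f ` K)"
      by (intro compact_imp_bounded compact_continuous_image K(1) continuous_on_subset[OF f(1)]) simp
    then obtain C where C: "\<forall>y\<in>f ` K. norm y \<le> C" unfolding bounded_iff by blast
    have "\<bar>f x\<bar> \<le> max C 0" for x using C f(2)[of x] by (cases "x \<in> K") (auto simp: max.coboundedI1)
    then show ?thesis by blast
  qed
  show "\<exists>C. \<forall>x. \<bar>\<eta> x\<bar> \<le> C"
    by (rule bdd) (use K(2) DERIV_isCont[OF d0] in \<open>simp_all add: continuous_at_imp_continuous_on\<close>)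
  show "\<exists>C. \<forall>x. \<bar>deriv \<eta> x\<bar> \<le> C" by (rule bdd[OF c deriv0])
qed

text \<open>In label variables the tested density is the integral of \<eta> (X \<gamma> \<tau>)
  against the time-independent measure m, so only the chain rule along trajectories is left.\<close>

lemma weak_continuity:
  assumes "test_function UNIV \<eta>" and t: "0 \<le> t"
  shows "((\<lambda>\<tau>. LBINT x. \<rho> x \<tau> * \<eta> x) has_real_derivative (LBINT x. \<rho> x t * u x t * deriv \<eta> x)) (at t within {0..})"
proof -
  note \<eta> = test_function_derivative[OF assms(1)]
  have \<eta>m: "\<eta> \<in> borel_measurable borel"
    by (rule borel_measurable_continuous_onI, rule continuous_at_imp_continuous_on)
      (use DERIV_isCont[OF \<eta>(1)] in simp)
  have \<eta>'m: "deriv \<eta> \<in> borel_measurable borel" by (rule borel_measurable_continuous_onI[OF \<eta>(2)])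
  obtain C0 where C0: "\<forall>x. \<bar>\<eta> x\<bar> \<le> C0" using \<eta>(3) by blast
  obtain C1 where C1: "\<forall>x. \<bar>deriv \<eta> x\<bar> \<le> C1" using \<eta>(4) by blast
  obtain C where C: "\<forall>\<gamma>\<in>\<Omega>. \<forall>\<tau>\<in>{0..t + 1}. \<forall>t'\<in>{0..t + 1}. \<bar>X \<gamma> \<tau> - X \<gamma> t'\<bar> \<le> C * \<bar>\<tau> - t'\<bar>"
    using X_time_lipschitz by blast
  have lip: "\<bar>\<eta> a - \<eta> b\<bar> \<le> C1 * \<bar>a - b\<bar>" for a b
    using field_differentiable_bound[of UNIV \<eta> "deriv \<eta>" C1 a b] \<eta>(1) C1 by simp
  have meas: "(\<lambda>\<gamma>. deriv \<eta> (X \<gamma> t) * V \<gamma> t) \<in> borel_measurable m"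
    by (intro measurable_m borel_measurable_times V_measurable measurable_compose[OF X_measurable \<eta>'m] t)
  have "((\<lambda>\<tau>. \<integral>\<gamma>. \<eta> (X \<gamma> \<tau>) \<partial>m) has_real_derivative (\<integral>\<gamma>. deriv \<eta> (X \<gamma> t) * V \<gamma> t \<partial>m)) (at t within {0..t + 1})"
  proof (rule has_real_derivative_integral[where g = "\<lambda>_. C1 * C"])
    show "integrable m (\<lambda>\<gamma>. \<eta> (X \<gamma> \<tau>))" if "\<tau> \<in> {0..t + 1}" for \<tau>
      by (rule finite_measure.integrable_const_bound[OF finite_m, of _ C0])
        (use C0 that in \<open>auto intro!: measurable_m measurable_compose[OF X_measurable \<eta>m]\<close>)
    show "AE \<gamma> in m. ((\<lambda>\<tau>. \<eta> (X \<gamma> \<tau>)) has_real_derivative deriv \<eta> (X \<gamma> t) * V \<gamma> t) (at t within {0..t + 1})"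
      using m_\<Omega>
    proof eventually_elim
      case (elim \<gamma>)
      have "(X \<gamma> has_real_derivative V \<gamma> t) (at t within {0..t + 1})"
        by (rule has_field_derivative_subset[OF X_V[OF elim t]]) auto
      then show ?case by (rule DERIV_chain2[where f = \<eta>, OF \<eta>(1)])
    qed
    show "AE \<gamma> in m. \<bar>\<eta> (X \<gamma> \<tau>) - \<eta> (X \<gamma> t)\<bar> \<le> \<bar>\<tau> - t\<bar> * (C1 * C)" if \<tau>: "\<tau> \<in> {0..t + 1}" for \<tau>
      using m_\<Omega>
    proof eventually_elim
      case (elim \<gamma>)
      have "\<bar>X \<gamma> \<tau> - X \<gamma> t\<bar> \<le> C * \<bar>\<tau> - t\<bar>" using C elim \<tau> t by simp
      moreover have "0 \<le> C1" using C1[rule_format, of 0] by linarith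
      ultimately have "C1 * \<bar>X \<gamma> \<tau> - X \<gamma> t\<bar> \<le> C1 * (C * \<bar>\<tau> - t\<bar>)" by (rule mult_left_mono)
      then show ?case using lip[of "X \<gamma> \<tau>" "X \<gamma> t"] by (simp add: mult_ac)
    qed
  qed (use t meas finite_measure.integrable_const[OF finite_m] in auto)
  moreover have "at t within {0..t + 1} = at t within {0..}"
    by (rule at_within_nhd[of _ "{t - 1<..<t + 1}"]) auto
  ultimately have d: "((\<lambda>\<tau>. \<integral>\<gamma>. \<eta> (X \<gamma> \<tau>) \<partial>m) has_real_derivative
      (\<integral>\<gamma>. deriv \<eta> (X \<gamma> t) * V \<gamma> t \<partial>m)) (at t within {0..})" by simp
  have "(LBINT x. \<rho> x t * u x t * deriv \<eta> x) = (LBINT x. \<rho> x t * (u_ext t x * deriv \<eta> x))"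
    by (simp only: \<rho>_u mult.assoc[symmetric])
  also have "\<dots> = (\<integral>\<gamma>. u_ext t (X \<gamma> t) * deriv \<eta> (X \<gamma> t) \<partial>m)"
    by (rule eulerian_integral(2)[OF t]) (intro borel_measurable_times u_ext_measurable t \<eta>'m)
  also have "\<dots> = (\<integral>\<gamma>. deriv \<eta> (X \<gamma> t) * V \<gamma> t \<partial>m)"
  proof (rule integral_cong_AE)
    show "(\<lambda>\<gamma>. u_ext t (X \<gamma> t) * deriv \<eta> (X \<gamma> t)) \<in> borel_measurable m"
      by (intro measurable_m borel_measurable_times measurable_compose[OF X_measurable \<eta>'m]
          measurable_compose[OF X_measurable u_ext_measurable] t)
    show "AE \<gamma> in m. u_ext t (X \<gamma> t) * deriv \<eta> (X \<gamma> t) = deriv \<eta> (X \<gamma> t) * V \<gamma> t"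
      using m_\<Omega> by eventually_elim (simp add: u_ext_X t)
  qed (rule meas)
  finally have rhs: "(LBINT x. \<rho> x t * u x t * deriv \<eta> x) = (\<integral>\<gamma>. deriv \<eta> (X \<gamma> t) * V \<gamma> t \<partial>m)" .
  show ?thesis
    unfolding rhs
    by (rule has_field_derivative_transform_within[OF d zero_less_one])
      (use t eulerian_integral(2)[OF _ \<eta>m] in auto)
qed

theorem continuity_equation_flow: "continuity_equation \<rho> u"
  unfolding continuity_equation_def
proof (intro conjI allI impI)
  fix t :: real assume t: "0 \<le> t"
  show "integrable lborel (\<lambda>x. \<rho> x t)"
    using eulerian_integral(1)[OF t, of "\<lambda>_. 1"] finite_measure.integrable_const[OF finite_m] by simp
  have "integrable m (\<lambda>\<gamma>. u_ext t (X \<gamma> t))"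
  proof (rule integrable_cong_AE_imp[OF V_integrable[OF t]])
    show "(\<lambda>\<gamma>. u_ext t (X \<gamma> t)) \<in> borel_measurable m"
      by (intro measurable_m measurable_compose[OF X_measurable u_ext_measurable] t)
    show "AE \<gamma> in m. V \<gamma> t = u_ext t (X \<gamma> t)"
      using m_\<Omega> by eventually_elim (simp add: u_ext_X t)
  qed
  then show "integrable lborel (\<lambda>x. \<rho> x t * u x t)"
    using eulerian_integral(1)[OF t u_ext_measurable[OF t]] by (simp only: \<rho>_u)
qed (rule weak_continuity)

theorem velocity_equation_flow: "velocity_equation \<phi> \<rho> u"
  unfolding velocity_equation_def
proof (intro allI impI ballI conjI)
  fix t x assume t: "(0::real) \<le> t" and "x \<in> fluid_domain \<rho> t"
  then obtain \<alpha> where \<alpha>: "\<alpha> \<in> \<Omega>" and x: "x = X \<alpha> t"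
    unfolding fluid_domain_eq[OF t] by (auto simp: U_def)
  have ux: "u x t = V \<alpha> t" unfolding x by (rule u_X[OF \<alpha> t])
  let ?f = "\<lambda>y. \<phi> (x - y) * (u_ext t y - u x t)"
  have fm: "?f \<in> borel_measurable borel"
    by (intro borel_measurable_times borel_measurable_diff u_ext_measurable t borel_measurable_const
        measurable_compose[OF _ \<phi>_measurable]) simp_all
  have eq: "indicator (U t) y *\<^sub>R (\<phi> (x - y) * (u y t - u x t) * \<rho> y t) = \<rho> y t * ?f y" for y
    using u_ext_eq[of y t] by (cases "y \<in> U t") (auto simp: \<rho>_def)
  have fX: "AE \<gamma> in m. ?f (X \<gamma> t) = \<phi> (X \<alpha> t - X \<gamma> t) * (V \<gamma> t - V \<alpha> t)"
    using m_\<Omega> by eventually_elim (simp add: u_ext_X t ux x[symmetric])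
  have fXm: "(\<lambda>\<gamma>. ?f (X \<gamma> t)) \<in> borel_measurable m"
    by (rule measurable_m[OF measurable_compose[OF X_measurable[OF t] fm]])
  have "integrable m (\<lambda>\<gamma>. ?f (X \<gamma> t))"
    by (rule integrable_cong_AE_imp[OF momentum_equation(1)[OF \<alpha> t] fXm])
      (use fX in eventually_elim, simp)
  then show "set_integrable lborel (fluid_domain \<rho> t) (\<lambda>y. \<phi> (x - y) * (u y t - u x t) * \<rho> y t)"
    unfolding set_integrable_def fluid_domain_eq[OF t] eq using eulerian_integral(1)[OF t fm] by simp
  have "(LBINT y:fluid_domain \<rho> t. \<phi> (x - y) * (u y t - u x t) * \<rho> y t) = (\<integral>\<gamma>. ?f (X \<gamma> t) \<partial>m)"
    unfolding set_lebesgue_integral_def fluid_domain_eq[OF t] eq by (rule eulerian_integral(2)[OF t fm])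
  also have "\<dots> = (\<integral>\<gamma>. \<phi> (X \<alpha> t - X \<gamma> t) * (V \<gamma> t - V \<alpha> t) \<partial>m)"
    by (rule integral_cong_AE[OF fXm borel_measurable_integrable[OF momentum_equation(1)[OF \<alpha> t]] fX])
  finally have rhs: "(LBINT y:fluid_domain \<rho> t. \<phi> (x - y) * (u y t - u x t) * \<rho> y t) =
      (\<integral>\<gamma>. \<phi> (X \<alpha> t - X \<gamma> t) * (V \<gamma> t - V \<alpha> t) \<partial>m)" .
  show "\<exists>u\<^sub>t u\<^sub>x. ((\<lambda>\<tau>. u x \<tau>) has_real_derivative u\<^sub>t) (at t within {0..}) \<and>
      ((\<lambda>y. u y t) has_real_derivative u\<^sub>x) (at x) \<and>
      u\<^sub>t + u x t * u\<^sub>x = (LBINT y:fluid_domain \<rho> t. \<phi> (x - y) * (u y t - u x t) * \<rho> y t)"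
    unfolding rhs
    unfolding ux
    using u_time_derivative[OF \<alpha> t] u_space_derivative[OF \<alpha> t] momentum_equation(2)[OF \<alpha> t]
    unfolding x by blast
qed

end

lemma (in eulerian_flow) global_solution_flow:
  assumes prim: "\<Phi> = kernel_primitive \<phi>"
    and init: "\<And>\<alpha>. \<alpha> \<in> \<Omega> \<Longrightarrow> \<psi> \<alpha> = psi_init \<phi> \<Omega> \<rho>\<^sub>0 u\<^sub>0 \<alpha>"
  shows "global_solution \<phi> \<Omega> \<rho>\<^sub>0 u\<^sub>0 \<rho> u"
proof -
  have force: "(LBINT \<gamma>:\<Omega>. kernel_primitive \<phi> (X \<alpha> t - X \<gamma> t) * \<rho>\<^sub>0 \<gamma>) = F (\<lambda>\<gamma>. X \<gamma> t) \<alpha>"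
    and force_int: "set_integrable lborel \<Omega> (\<lambda>\<gamma>. kernel_primitive \<phi> (X \<alpha> t - X \<gamma> t) * \<rho>\<^sub>0 \<gamma>)"
    if "0 \<le> t" for \<alpha> t
  proof -
    have eq: "indicator \<Omega> \<gamma> *\<^sub>R (kernel_primitive \<phi> (X \<alpha> t - X \<gamma> t) * \<rho>\<^sub>0 \<gamma>) = \<rho>\<^sub>0 \<gamma> * \<Phi> (X \<alpha> t - X \<gamma> t)" for \<gamma>
      using \<rho>\<^sub>0_off[of \<gamma>] by (cases "\<gamma> \<in> \<Omega>") (simp_all add: prim)
    have meas: "(\<lambda>\<gamma>. \<Phi> (X \<alpha> t - X \<gamma> t)) \<in> borel_measurable borel"
      by (intro measurable_compose[OF _ \<Phi>_measurable] borel_measurable_diff borel_measurable_const X_measurable that)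
    show "(LBINT \<gamma>:\<Omega>. kernel_primitive \<phi> (X \<alpha> t - X \<gamma> t) * \<rho>\<^sub>0 \<gamma>) = F (\<lambda>\<gamma>. X \<gamma> t) \<alpha>"
      unfolding set_lebesgue_integral_def eq F_def by (rule m_integral[OF meas, symmetric])
    show "set_integrable lborel \<Omega> (\<lambda>\<gamma>. kernel_primitive \<phi> (X \<alpha> t - X \<gamma> t) * \<rho>\<^sub>0 \<gamma>)"
      unfolding set_integrable_def eq m_integrable_iff[OF meas, symmetric] by (rule \<Phi>_integrable[OF X_S[OF that]])
  qed
  have lagr: "lagrangian_equation \<phi> \<Omega> \<rho>\<^sub>0 u\<^sub>0 X"
    unfolding lagrangian_equation_def
    using X_0 force_int force X_ode init by simp
  \<comment> \<open>\<open>psi_init\<close> adds to \<open>u\<^sub>0\<close> exactly the force of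
    the undisplaced configuration, which the velocity at time 0 subtracts again.\<close>
  have u_0: "u x 0 = u\<^sub>0 x" if x: "x \<in> \<Omega>" for x
  proof -
    have "u x 0 = \<psi> x - F (\<lambda>\<gamma>. X \<gamma> 0) x"
      using u_X[OF x, of 0] X_0[OF x] x by (simp add: V_def)
    also have "F (\<lambda>\<gamma>. X \<gamma> 0) x = (LBINT \<gamma>:\<Omega>. kernel_primitive \<phi> (x - \<gamma>) * \<rho>\<^sub>0 \<gamma>)"
      unfolding force[of 0 x, symmetric, OF order_refl]
      by (rule set_lebesgue_integral_cong) (use X_0 x open_\<Omega> in auto)
    finally show ?thesis using init[OF x] by (simp add: psi_init_def)
  qed
  have "bij_betw (\<lambda>\<alpha>. X \<alpha> t) \<Omega> (fluid_domain \<rho> t)" if "0 \<le> t" for t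
    using inj_X[OF that] by (simp add: bij_betw_def fluid_domain_eq[OF that] U_def)
  moreover have "(\<lambda>a. X a t) differentiable (at \<alpha>) \<and> 0 < deriv (\<lambda>a. X a t) \<alpha> \<and>
      (X \<alpha> has_real_derivative u (X \<alpha> t) t) (at t within {0..}) \<and>
      \<rho> (X \<alpha> t) t = \<rho>\<^sub>0 \<alpha> / deriv (\<lambda>a. X a t) \<alpha>" if "0 \<le> t" "\<alpha> \<in> \<Omega>" for t \<alpha>
    using X_has_derivative[OF that(2,1)] Z_pos[OF that(2,1)] X_V[OF that(2,1)] u_X[OF that(2,1)] \<rho>_X[OF that(2,1)]
    by (auto simp: DERIV_imp_deriv real_differentiable_def)
  ultimately show ?thesis
    unfolding global_solution_def
    using \<rho>_initial u_0 \<rho>_nonneg continuity_equation_flow velocity_equation_flow lagr by blast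
qed

section \<open>Separation estimates\<close>

lemma integrable_riesz_kernel:
  fixes D \<sigma> :: real
  assumes "0 \<le> D" "\<sigma> < 1"
  shows "integrable lborel (\<lambda>z. indicator {-D..D} z * \<bar>z\<bar> powr (- \<sigma>))"
proof -
  let ?k = "\<lambda>z::real. indicator {0..D} z * z powr (- \<sigma>)"
  have "(\<lambda>z. z powr (- \<sigma>)) absolutely_integrable_on {0..D}"
    using has_integral_powr_from_0[of "- \<sigma>" D] assms
    by (intro nonnegative_absolutely_integrable_1) (auto simp: integrable_on_def)
  then have k: "integrable lborel ?k"
    unfolding set_integrable_def by (subst (asm) integrable_completion) auto
  have "integrable lborel (\<lambda>z. ?k (0 + (- 1) * z))"
    by (rule lborel_integrable_real_affine[OF k]) simp
  then have "integrable lborel (\<lambda>z. ?k z + ?k (- z))"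
    by (intro Bochner_Integration.integrable_add k) simp
  moreover have "?k z + ?k (- z) = indicator {-D..D} z * \<bar>z\<bar> powr (- \<sigma>)" for z
    using assms(1) by (cases "z = 0") (auto simp: indicator_def)
  ultimately show ?thesis by simp
qed

text \<open>All terms vanish as a tends to 0 from the right. The first inequality puts the initial
  configuration into the separated set, the second is the barrier condition.\<close>

lemma small_constant_exists:
  fixes A1 A2 A3 c s :: real
  assumes "s < 1" "0 < c"
  shows "\<exists>a>0. a * A1 \<le> 1 \<and> A2 * a powr (1 - s) + A3 * a \<le> c"
proof -
  have "((\<lambda>a. A2 * a powr (1 - s) + A3 * a) \<longlongrightarrow> A2 * 0 + A3 * 0) (at_right 0)"
  proof (intro tendsto_intros)
    show "((\<lambda>a. a powr (1 - s)) \<longlongrightarrow> 0) (at_right (0::real))"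
      by (rule tendsto_zero_powrI[OF tendsto_ident_at tendsto_const])
        (use assms(1) in \<open>simp_all add: eventually_at_filter\<close>)
  qed
  then have "\<forall>\<^sub>F a in at_right 0. A2 * a powr (1 - s) + A3 * a < c"
    using assms(2) by (intro order_tendstoD(2)[of _ "A2 * 0 + A3 * 0"]) simp_all
  moreover have "((\<lambda>a. a * A1) \<longlongrightarrow> 0 * A1) (at_right 0)" by (intro tendsto_intros)
  then have "\<forall>\<^sub>F a in at_right 0. a * A1 < 1"
    by (intro order_tendstoD(2)[of _ "0 * A1"]) simp_all
  moreover have "\<forall>\<^sub>F a in at_right 0. (0::real) < a" by (rule eventually_at_right_less)
  ultimately have "\<forall>\<^sub>F a in at_right 0. 0 < a \<and> a * A1 \<le> 1 \<and> A2 * a powr (1 - s) + A3 * a \<le> c"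
    by eventually_elim auto
  then show ?thesis by (rule eventually_happens'[rotated]) simp
qed

text \<open>Only pairs at distance at least R need an argument. In the closure they form a compact
  set on which the increment of the strictly increasing extension has a positive minimum v; since
  distances are at most 2b, the constant v / (2b)^\<mu> works there.\<close>

lemma powr_growth_global:
  fixes \<psi> f :: "real \<Rightarrow> real"
  assumes cont: "continuous_on (closure S) f" and mono: "strict_mono_on (closure S) f" and "bounded S"
    and eq: "\<And>x. x \<in> S \<Longrightarrow> f x = \<psi> x" and "0 < c" "0 < R" "0 \<le> \<mu>"
    and loc: "\<And>\<alpha> \<beta>. \<alpha> \<in> S \<Longrightarrow> \<beta> \<in> S \<Longrightarrow> 0 \<le> \<beta> - \<alpha> \<Longrightarrow> \<beta> - \<alpha> < R \<Longrightarrow> c * (\<beta> - \<alpha>) powr \<mu> \<le> \<psi> \<beta> - \<psi> \<alpha>"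
  shows "\<exists>c'>0. \<forall>\<alpha>\<in>S. \<forall>\<beta>\<in>S. \<alpha> \<le> \<beta> \<longrightarrow> c' * (\<beta> - \<alpha>) powr \<mu> \<le> \<psi> \<beta> - \<psi> \<alpha>"
proof -
  define P where "P = (closure S \<times> closure S) \<inter> {z. R \<le> snd z - fst z}"
  have SP: "(\<alpha>, \<beta>) \<in> P" if "\<alpha> \<in> S" "\<beta> \<in> S" "R \<le> \<beta> - \<alpha>" for \<alpha> \<beta>
    using that closure_subset[of S] by (auto simp: P_def)
  show ?thesis
  proof (cases "P = {}")
    case True
    have "c * (\<beta> - \<alpha>) powr \<mu> \<le> \<psi> \<beta> - \<psi> \<alpha>" if "\<alpha> \<in> S" "\<beta> \<in> S" "\<alpha> \<le> \<beta>" for \<alpha> \<beta>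
      using loc[OF that(1,2)] SP[OF that(1,2)] True that(3) by (cases "\<beta> - \<alpha> < R") auto
    then show ?thesis using \<open>0 < c\<close> by blast
  next
    case False
    have "closed {z :: real \<times> real. R \<le> snd z - fst z}"
      by (intro closed_Collect_le continuous_intros)
    then have "compact P"
      unfolding P_def using \<open>bounded S\<close> by (intro compact_Int_closed compact_Times) auto
    moreover have "continuous_on P (\<lambda>z. f (snd z) - f (fst z))"
      by (intro continuous_on_diff continuous_on_compose2[OF cont] continuous_on_fst continuous_on_snd continuous_on_id)
        (auto simp: P_def)
    ultimately obtain z where z: "z \<in> P" "\<forall>w\<in>P. f (snd z) - f (fst z) \<le> f (snd w) - f (fst w)"
      using continuous_attains_inf[OF _ False] by blast
    define v where "v = f (snd z) - f (fst z)"
    have "fst z < snd z" "fst z \<in> closure S" "snd z \<in> closure S" using z(1) \<open>0 < R\<close> by (auto simp: P_def)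
    then have v: "0 < v" using mono unfolding strict_mono_on_def v_def by simp
    obtain b where b: "0 < b" "\<forall>x\<in>S. norm x \<le> b" using \<open>bounded S\<close> unfolding bounded_pos by blast
    define c' where "c' = min c (v / (2 * b) powr \<mu>)"
    have c': "0 < c'" using \<open>0 < c\<close> v b by (simp add: c'_def)
    have "c' * (\<beta> - \<alpha>) powr \<mu> \<le> \<psi> \<beta> - \<psi> \<alpha>" if ab: "\<alpha> \<in> S" "\<beta> \<in> S" "\<alpha> \<le> \<beta>" for \<alpha> \<beta>
    proof (cases "\<beta> - \<alpha> < R")
      case True
      have "c' * (\<beta> - \<alpha>) powr \<mu> \<le> c * (\<beta> - \<alpha>) powr \<mu>" by (intro mult_right_mono) (auto simp: c'_def)
      also have "\<dots> \<le> \<psi> \<beta> - \<psi> \<alpha>" using loc[OF ab(1,2)] ab(3) True by simp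
      finally show ?thesis .
    next
      case False
      have "norm \<alpha> \<le> b" "norm \<beta> \<le> b" using b ab by blast+
      then have "(\<beta> - \<alpha>) powr \<mu> \<le> (2 * b) powr \<mu>"
        using ab(3) \<open>0 \<le> \<mu>\<close> by (intro powr_mono2) (auto simp: abs_le_iff)
      then have "c' * (\<beta> - \<alpha>) powr \<mu> \<le> (v / (2 * b) powr \<mu>) * (2 * b) powr \<mu>"
        using v c' by (intro mult_mono) (auto simp: c'_def)
      also have "\<dots> = v" using b by simp
      also have "\<dots> \<le> f \<beta> - f \<alpha>"
        using z(2) SP[OF ab(1,2)] False unfolding v_def by force
      finally show ?thesis using eq ab by simp
    qed
    then show ?thesis using c' by blast
  qed
qed

context alignment_kernel begin

lemma borel_measurable_envelope [measurable]: "envelope \<in> borel_measurable borel"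
  unfolding envelope_def[abs_def] by measurable

text \<open>A lower bound on distances turns into an upper bound for the decreasing power -s, and
  the exponents p and -s multiply to the integrable singularity -p s.\<close>

lemma envelope_separated_le:
  assumes "Y \<in> separated \<Omega> (\<lambda>d. a * d powr p)" "0 < a" "\<alpha> \<in> \<Omega>" "\<gamma> \<in> \<Omega>" "\<gamma> \<noteq> \<alpha>"
  shows "envelope (Y \<alpha> - Y \<gamma>) \<le> 4 * \<Lambda> / (1 - s) * (a / 2) powr (- s) * \<bar>\<alpha> - \<gamma>\<bar> powr (- (p * s)) + 4 * K\<^sub>0"
proof -
  have sep: "a * \<bar>\<alpha> - \<gamma>\<bar> powr p \<le> \<bar>Y \<alpha> - Y \<gamma>\<bar>"
    using assms by (cases "\<alpha> < \<gamma>") (force simp: separated_def abs_if)+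
  have "(\<bar>Y \<alpha> - Y \<gamma>\<bar> / 2) powr (- s) \<le> (a / 2 * \<bar>\<alpha> - \<gamma>\<bar> powr p) powr (- s)"
    using sep s assms(2,5) by (intro powr_mono2') auto
  also have "\<dots> = (a / 2) powr (- s) * \<bar>\<alpha> - \<gamma>\<bar> powr (- (p * s))"
    by (simp only: powr_mult[of "a / 2"] powr_powr mult_minus_right)
  finally show ?thesis
    unfolding envelope_def using s pos by (simp add: mult.assoc mult_left_mono divide_right_mono)
qed

end

locale alignment_data = alignment_kernel +
  fixes \<Omega> :: "real set" and \<rho>\<^sub>0 :: "real \<Rightarrow> real" and Rb :: real
  assumes open_\<Omega>: "open \<Omega>" and Rb_pos: "0 < Rb" and \<Omega>_le: "\<And>\<alpha>. \<alpha> \<in> \<Omega> \<Longrightarrow> \<bar>\<alpha>\<bar> \<le> Rb"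
    and \<rho>\<^sub>0_cont: "continuous_on UNIV \<rho>\<^sub>0"
    and \<rho>\<^sub>0_pos: "\<And>x. x \<in> \<Omega> \<Longrightarrow> 0 < \<rho>\<^sub>0 x" and \<rho>\<^sub>0_off: "\<And>x. x \<notin> \<Omega> \<Longrightarrow> \<rho>\<^sub>0 x = 0"
begin

definition mass :: "real measure" where "mass = density lborel (\<lambda>x. ennreal (\<rho>\<^sub>0 x))"

lemma \<rho>\<^sub>0_nonneg: "0 \<le> \<rho>\<^sub>0 x"
  using \<rho>\<^sub>0_pos[of x] \<rho>\<^sub>0_off[of x] by (cases "x \<in> \<Omega>") auto

lemma \<rho>\<^sub>0_measurable: "\<rho>\<^sub>0 \<in> borel_measurable borel"
  by (rule borel_measurable_continuous_onI[OF \<rho>\<^sub>0_cont])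

lemma \<rho>\<^sub>0_eq: "indicator {-Rb..Rb} x *\<^sub>R \<rho>\<^sub>0 x = \<rho>\<^sub>0 x"
  using \<Omega>_le[of x] \<rho>\<^sub>0_off[of x] by (cases "x \<in> \<Omega>") (auto simp: indicator_def abs_le_iff)

lemma \<rho>\<^sub>0_integrable: "integrable lborel \<rho>\<^sub>0"
  using borel_integrable_atLeastAtMost'[OF continuous_on_subset[OF \<rho>\<^sub>0_cont subset_UNIV], of "- Rb" Rb]
  by (simp only: set_integrable_def \<rho>\<^sub>0_eq)

lemma \<rho>\<^sub>0_bounded: "\<exists>M\<ge>0. \<forall>x. \<rho>\<^sub>0 x \<le> M"
proof -
  have "bounded (\<rho>\<^sub>0 ` {-Rb..Rb})"
    by (intro compact_imp_bounded compact_continuous_image continuous_on_subset[OF \<rho>\<^sub>0_cont]) auto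
  then obtain M where M: "\<forall>y\<in>\<rho>\<^sub>0 ` {-Rb..Rb}. norm y \<le> M" unfolding bounded_iff by blast
  have "\<rho>\<^sub>0 x \<le> max M 0" for x
  proof (cases "x \<in> {-Rb..Rb}")
    case True
    then have "norm (\<rho>\<^sub>0 x) \<le> M" using M by blast
    then show ?thesis by (simp add: abs_le_iff max.coboundedI1)
  next
    case False
    then have "x \<notin> \<Omega>" using \<Omega>_le[of x] by (auto simp: abs_le_iff)
    then show ?thesis using \<rho>\<^sub>0_off by simp
  qed
  then show ?thesis by (intro exI[of _ "max M 0"]) simp
qed

lemma finite_mass: "finite_measure mass"
proof (rule finite_measureI)
  have "emeasure mass UNIV = (\<integral>\<^sup>+ x. ennreal (\<rho>\<^sub>0 x) \<partial>lborel)"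
    unfolding mass_def using \<rho>\<^sub>0_measurable by (subst emeasure_density) auto
  also have "\<dots> = ennreal (\<integral>x. \<rho>\<^sub>0 x \<partial>lborel)"
    by (rule nn_integral_eq_integral[OF \<rho>\<^sub>0_integrable]) (simp add: \<rho>\<^sub>0_nonneg)
  finally show "emeasure mass (space mass) \<noteq> \<infinity>" by (simp add: mass_def)
qed

lemma AE_mass: "(AE x in lborel. P x) \<Longrightarrow> AE x in mass. P x"
  unfolding mass_def using \<rho>\<^sub>0_measurable by (subst AE_density) auto

lemma AE_mass_\<Omega>: "AE x in mass. x \<in> \<Omega>"
proof -
  have "x \<in> \<Omega>" if "0 < ennreal (\<rho>\<^sub>0 x)" for x
    using that \<rho>\<^sub>0_off[of x] by (cases "x \<in> \<Omega>") auto
  then show ?thesis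
    unfolding mass_def using \<rho>\<^sub>0_measurable by (subst AE_density) (auto intro!: AE_I2)
qed

lemma mass_measurable: "f \<in> borel_measurable borel \<Longrightarrow> f \<in> borel_measurable mass"
  by (simp add: mass_def)

text \<open>The density is bounded and \<Omega> lies in [-Rb, Rb], so differences of labels lie in
  [-2 Rb, 2 Rb] and translation invariance makes the bound independent of \<alpha>.\<close>

lemma riesz_potential_bound:
  assumes "\<sigma> < 1"
  shows "\<exists>Q\<ge>0. \<forall>\<alpha>\<in>\<Omega>. integrable mass (\<lambda>\<gamma>. \<bar>\<alpha> - \<gamma>\<bar> powr (- \<sigma>)) \<and>
     (\<integral>\<gamma>. \<bar>\<alpha> - \<gamma>\<bar> powr (- \<sigma>) \<partial>mass) \<le> Q"
proof -
  obtain M where M: "0 \<le> M" "\<forall>x. \<rho>\<^sub>0 x \<le> M" using \<rho>\<^sub>0_bounded by blast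
  define k where "k z = indicator {-(2 * Rb)..2 * Rb} z * \<bar>z\<bar> powr (- \<sigma>)" for z :: real
  have k: "integrable lborel k"
    unfolding k_def by (rule integrable_riesz_kernel) (use Rb_pos assms in auto)
  have k0: "0 \<le> k z" for z by (simp add: k_def)
  have "integrable mass (\<lambda>\<gamma>. \<bar>\<alpha> - \<gamma>\<bar> powr (- \<sigma>)) \<and>
     (\<integral>\<gamma>. \<bar>\<alpha> - \<gamma>\<bar> powr (- \<sigma>) \<partial>mass) \<le> M * (\<integral>z. k z \<partial>lborel)" if \<alpha>: "\<alpha> \<in> \<Omega>" for \<alpha>
  proof -
    have ki: "integrable lborel (\<lambda>\<gamma>. k (\<alpha> - \<gamma>))"
      using lborel_integrable_real_affine[OF k, of "-1" \<alpha>] by simp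
    have "(\<integral>\<gamma>. k (\<alpha> - \<gamma>) \<partial>lborel) = (\<integral>z. k z \<partial>lborel)"
      using lborel_integral_real_affine[of "-1" k \<alpha>] by simp
    then have kI: "(\<integral>\<gamma>. M * k (\<alpha> - \<gamma>) \<partial>lborel) = M * (\<integral>z. k z \<partial>lborel)" by simp
    have fm: "(\<lambda>\<gamma>. \<bar>\<alpha> - \<gamma>\<bar> powr (- \<sigma>)) \<in> borel_measurable borel" by measurable
    have le: "\<rho>\<^sub>0 \<gamma> * \<bar>\<alpha> - \<gamma>\<bar> powr (- \<sigma>) \<le> M * k (\<alpha> - \<gamma>)" for \<gamma>
    proof (cases "\<gamma> \<in> \<Omega>")
      case True
      then have "\<alpha> - \<gamma> \<in> {-(2 * Rb)..2 * Rb}" using \<Omega>_le[OF \<alpha>] \<Omega>_le[OF True] by (auto simp: abs_le_iff)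
      then show ?thesis using M(2) by (simp add: k_def mult_right_mono)
    next
      case False
      then show ?thesis using \<rho>\<^sub>0_off k0 M(1) by simp
    qed
    have fi: "integrable lborel (\<lambda>\<gamma>. \<rho>\<^sub>0 \<gamma> * \<bar>\<alpha> - \<gamma>\<bar> powr (- \<sigma>))"
    proof (rule Bochner_Integration.integrable_bound[OF integrable_mult_right[OF ki, of M]])
      show "(\<lambda>\<gamma>. \<rho>\<^sub>0 \<gamma> * \<bar>\<alpha> - \<gamma>\<bar> powr (- \<sigma>)) \<in> borel_measurable lborel"
        using borel_measurable_times[OF \<rho>\<^sub>0_measurable fm] by simp
      show "AE \<gamma> in lborel. norm (\<rho>\<^sub>0 \<gamma> * \<bar>\<alpha> - \<gamma>\<bar> powr (- \<sigma>)) \<le> norm (M * k (\<alpha> - \<gamma>))"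
        using le \<rho>\<^sub>0_nonneg k0 M(1) by (intro AE_I2) simp
    qed
    have "integrable mass (\<lambda>\<gamma>. \<bar>\<alpha> - \<gamma>\<bar> powr (- \<sigma>))"
      unfolding mass_def using fi fm \<rho>\<^sub>0_measurable \<rho>\<^sub>0_nonneg by (subst integrable_real_density) auto
    moreover have "(\<integral>\<gamma>. \<bar>\<alpha> - \<gamma>\<bar> powr (- \<sigma>) \<partial>mass) = (\<integral>\<gamma>. \<rho>\<^sub>0 \<gamma> * \<bar>\<alpha> - \<gamma>\<bar> powr (- \<sigma>) \<partial>lborel)"
      unfolding mass_def using fm \<rho>\<^sub>0_measurable \<rho>\<^sub>0_nonneg by (subst integral_real_density) auto
    moreover have "(\<integral>\<gamma>. \<rho>\<^sub>0 \<gamma> * \<bar>\<alpha> - \<gamma>\<bar> powr (- \<sigma>) \<partial>lborel) \<le> M * (\<integral>z. k z \<partial>lborel)"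
      unfolding kI[symmetric] by (rule integral_mono[OF fi integrable_mult_right[OF ki] le])
    ultimately show ?thesis by simp
  qed
  moreover have "0 \<le> M * (\<integral>z. k z \<partial>lborel)" using M(1) k0 by simp
  ultimately show ?thesis by blast
qed

text \<open>Q is chosen before a, and the dependence of K on a is kept explicit as
  \<open>(a / 2) powr (- s)\<close>: this lets a be made small afterwards. The summand 1 next to the
  mass guarantees K > 0.\<close>

lemma alignment_force_mass:
  assumes "p * s < 1"
  shows "\<exists>Q\<ge>0. \<forall>a>0. alignment_force \<Omega> mass \<Phi> envelope (\<lambda>d. a * d powr p)
     (4 * \<Lambda> / (1 - s) * (a / 2) powr (- s) * Q + 4 * K\<^sub>0 * (measure mass UNIV + 1)) Rb"
proof -
  obtain Q where Q: "0 \<le> Q" "\<forall>\<alpha>\<in>\<Omega>. integrable mass (\<lambda>\<gamma>. \<bar>\<alpha> - \<gamma>\<bar> powr (- (p * s))) \<and>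
     (\<integral>\<gamma>. \<bar>\<alpha> - \<gamma>\<bar> powr (- (p * s)) \<partial>mass) \<le> Q"
    using riesz_potential_bound[OF assms] by blast
  have "alignment_force \<Omega> mass \<Phi> envelope (\<lambda>d. a * d powr p)
     (4 * \<Lambda> / (1 - s) * (a / 2) powr (- s) * Q + 4 * K\<^sub>0 * (measure mass UNIV + 1)) Rb" if a: "0 < a" for a
  proof -
    define C where "C = 4 * \<Lambda> / (1 - s) * (a / 2) powr (- s)"
    have C: "0 \<le> C" using s pos by (simp add: C_def)
    define h where "h \<alpha> \<gamma> = C * \<bar>\<alpha> - \<gamma>\<bar> powr (- (p * s)) + 4 * K\<^sub>0" for \<alpha> \<gamma>
    have hi: "integrable mass (h \<alpha>)" if "\<alpha> \<in> \<Omega>" for \<alpha>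
      unfolding h_def using Q(2) that
      by (intro Bochner_Integration.integrable_add integrable_mult_right finite_measure.integrable_const[OF finite_mass]) auto
    have hI: "(\<integral>\<gamma>. h \<alpha> \<gamma> \<partial>mass) \<le> C * Q + 4 * K\<^sub>0 * (measure mass UNIV + 1)" if "\<alpha> \<in> \<Omega>" for \<alpha>
    proof -
      have "(\<integral>\<gamma>. h \<alpha> \<gamma> \<partial>mass) = C * (\<integral>\<gamma>. \<bar>\<alpha> - \<gamma>\<bar> powr (- (p * s)) \<partial>mass) + (\<integral>\<gamma>. 4 * K\<^sub>0 \<partial>mass)"
        unfolding h_def using Q(2) that
        by (subst Bochner_Integration.integral_add)
          (auto intro!: integrable_mult_right finite_measure.integrable_const[OF finite_mass])
      also have "(\<integral>\<gamma>. 4 * K\<^sub>0 \<partial>mass) = 4 * K\<^sub>0 * measure mass UNIV"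
        by (simp add: mass_def)
      also have "C * (\<integral>\<gamma>. \<bar>\<alpha> - \<gamma>\<bar> powr (- (p * s)) \<partial>mass) + 4 * K\<^sub>0 * measure mass UNIV \<le>
          C * Q + 4 * K\<^sub>0 * (measure mass UNIV + 1)"
        using Q(2) that C K\<^sub>0_pos by (intro add_mono mult_left_mono) auto
      finally show ?thesis .
    qed
    have ae: "AE \<gamma> in mass. envelope (Y \<alpha> - Y \<gamma>) \<le> h \<alpha> \<gamma>"
      if "Y \<in> separated \<Omega> (\<lambda>d. a * d powr p)" "\<alpha> \<in> \<Omega>" for Y \<alpha>
      using AE_mass_\<Omega> AE_mass[OF AE_lborel_singleton[of \<alpha>]]
      by eventually_elim (unfold h_def C_def, rule envelope_separated_le[OF that(1) a that(2)])
    have meas: "(\<lambda>\<gamma>. envelope (Y \<alpha> - Y \<gamma>)) \<in> borel_measurable mass"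
      if "Y \<in> separated \<Omega> (\<lambda>d. a * d powr p)" for Y \<alpha>
    proof -
      have "Y \<in> borel_measurable borel"
        by (rule separated_measurable[OF open_\<Omega> _ that]) (use a in simp)
      then show ?thesis
        by (intro mass_measurable measurable_compose[OF _ borel_measurable_envelope] borel_measurable_diff) simp_all
    qed
    have di: "integrable mass (\<lambda>\<gamma>. envelope (Y \<alpha> - Y \<gamma>))"
      if "Y \<in> separated \<Omega> (\<lambda>d. a * d powr p)" "\<alpha> \<in> \<Omega>" for Y \<alpha>
    proof (rule Bochner_Integration.integrable_bound[OF hi[OF that(2)] meas[OF that(1)]])
      show "AE \<gamma> in mass. norm (envelope (Y \<alpha> - Y \<gamma>)) \<le> norm (h \<alpha> \<gamma>)"
        using ae[OF that] by eventually_elim (use envelope_pos[THEN less_imp_le] in auto)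
    qed
    show ?thesis
    proof (rule alignment_force.intro[OF finite_mass])
      show "sets mass = sets borel" by (simp add: mass_def)
      show "AE \<gamma> in mass. \<gamma> \<noteq> x" for x by (rule AE_mass[OF AE_lborel_singleton])
      show "(\<integral>\<gamma>. envelope (Y \<alpha> - Y \<gamma>) \<partial>mass) \<le>
          4 * \<Lambda> / (1 - s) * (a / 2) powr (- s) * Q + 4 * K\<^sub>0 * (measure mass UNIV + 1)"
        if "Y \<in> separated \<Omega> (\<lambda>d. a * d powr p)" "\<alpha> \<in> \<Omega>" for Y \<alpha>
        using integral_mono_AE[OF di[OF that] hi[OF that(2)] ae[OF that]] hI[OF that(2)] by (simp add: C_def)
      show "0 < 4 * \<Lambda> / (1 - s) * (a / 2) powr (- s) * Q + 4 * K\<^sub>0 * (measure mass UNIV + 1)"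
        using C Q(1) K\<^sub>0_pos unfolding C_def[symmetric] by (intro add_nonneg_pos mult_pos_pos) (auto simp: add_nonneg_pos)
    qed (use AE_mass_\<Omega> open_\<Omega> \<Omega>_le primitive_mono continuous_primitive primitive_lipschitz_away envelope_pos[THEN less_imp_le]
        di a in auto)
  qed
  then show ?thesis using Q(1) by blast
qed

theorem global_solution_exists:
  fixes \<psi> :: "real \<Rightarrow> real"
  assumes c: "0 < c" and \<mu>: "1 \<le> \<mu>" "\<mu> = 1 \<or> \<mu> < (1 - s) / s"
    and growth: "\<And>\<alpha> \<beta>. \<alpha> \<in> \<Omega> \<Longrightarrow> \<beta> \<in> \<Omega> \<Longrightarrow> \<alpha> \<le> \<beta> \<Longrightarrow> c * (\<beta> - \<alpha>) powr \<mu> \<le> \<psi> \<beta> - \<psi> \<alpha>"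
    and diff: "\<And>\<alpha>. \<alpha> \<in> \<Omega> \<Longrightarrow> \<psi> differentiable (at \<alpha>)" and bdd: "\<And>\<alpha>. \<alpha> \<in> \<Omega> \<Longrightarrow> \<bar>\<psi> \<alpha>\<bar> \<le> Pb"
    and init: "\<And>\<alpha>. \<alpha> \<in> \<Omega> \<Longrightarrow> \<psi> \<alpha> = psi_init \<phi> \<Omega> \<rho>\<^sub>0 u\<^sub>0 \<alpha>"
  shows "\<exists>\<rho> u. global_solution \<phi> \<Omega> \<rho>\<^sub>0 u\<^sub>0 \<rho> u"
proof -
  define p where "p = (if \<mu> = 1 then 1 else \<mu> / (1 - s))"
  have ps: "p * s < 1"
    using \<mu> s by (auto simp: p_def field_simps)
  have p: "1 \<le> p" "\<mu> \<le> p"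
  proof -
    have "\<mu> * (1 - s) \<le> \<mu> * 1" using \<mu>(1) s by (intro mult_left_mono) auto
    then have "\<mu> \<le> \<mu> / (1 - s)" using s by (simp add: le_divide_eq)
    then show "1 \<le> p" "\<mu> \<le> p" using \<mu>(1) by (auto simp: p_def)
  qed
  define M1 where "M1 = measure mass UNIV + 1"
  have M1: "0 < M1" by (simp add: M1_def add_nonneg_pos)
  define C1 where "C1 = 4 * \<Lambda> / (1 - s)"
  have C1: "0 < C1" using s pos by (simp add: C1_def)
  obtain Q where Q: "0 \<le> Q" "\<forall>a>0. alignment_force \<Omega> mass \<Phi> envelope (\<lambda>d. a * d powr p)
     (C1 * (a / 2) powr (- s) * Q + 4 * K\<^sub>0 * M1) Rb"
    using alignment_force_mass[OF ps] unfolding C1_def M1_def by blast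
  \<comment> \<open>A2 and A3 collect the coefficients of \<open>a powr (1 - s)\<close> and of a in
    the two bounds for the force increment derived under \<open>invariant\<close>.\<close>
  define A2 where "A2 = (if \<mu> = 1 then 4 * C1 * Q else 2 * C1 * M1)"
  define A3 where "A3 = (if \<mu> = 1 then 8 * K\<^sub>0 * M1 else 8 * K\<^sub>0 * M1 * (2 * Rb) powr (p - \<mu>))"
  obtain a where a: "0 < a" "a * (2 * Rb) powr (p - 1) \<le> 1" "A2 * a powr (1 - s) + A3 * a \<le> c"
    using small_constant_exists[OF s(2) c] by blast
  interpret AF: alignment_force \<Omega> mass \<Phi> envelope "\<lambda>d. a * d powr p" "C1 * (a / 2) powr (- s) * Q + 4 * K\<^sub>0 * M1" Rb
    using Q(2) a(1) by blast
  have invariant: "AF.F Y \<beta> - AF.F Y \<alpha> \<le> \<psi> \<beta> - \<psi> \<alpha>"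
    if Y: "Y \<in> separated \<Omega> (\<lambda>d. a * d powr p)" and ab: "\<alpha> \<in> \<Omega>" "\<beta> \<in> \<Omega>" "\<alpha> < \<beta>"
      and D: "Y \<beta> - Y \<alpha> \<le> 2 * (a * (\<beta> - \<alpha>) powr p)" for Y \<alpha> \<beta>
  proof -
    define \<delta> where "\<delta> = \<beta> - \<alpha>"
    have \<delta>: "0 < \<delta>" "\<delta> \<le> 2 * Rb"
      using ab(3) \<Omega>_le[OF ab(1)] \<Omega>_le[OF ab(2)] by (auto simp: \<delta>_def abs_le_iff)
    have Ypos: "0 < Y \<beta> - Y \<alpha>" using AF.S_less[OF Y ab] by simp
    have "AF.F Y \<beta> - AF.F Y \<alpha> \<le> c * \<delta> powr \<mu>"
    proof (cases "\<mu> = 1")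
      \<comment> \<open>Here the Lipschitz bound is used: K is of order \<open>a powr (- s)\<close>,
        and multiplication by the critical distance \<open>2 * a * \<delta>\<close> leaves
        \<open>a powr (1 - s) * \<delta>\<close>.\<close>
      case True
      have "AF.F Y \<beta> - AF.F Y \<alpha> \<le> (C1 * (a / 2) powr (- s) * Q + 4 * K\<^sub>0 * M1) * (Y \<beta> - Y \<alpha>)"
        using AF.F_diff[OF Y ab(1,2)] Ypos by simp
      also have "\<dots> \<le> (C1 * (a / 2) powr (- s) * Q + 4 * K\<^sub>0 * M1) * (2 * (a * \<delta>))"
        using D True AF.K_pos \<delta> by (intro mult_left_mono) (auto simp: p_def \<delta>_def)
      also have "\<dots> = (C1 * Q * (2 * (a * (a / 2) powr (- s))) + 8 * K\<^sub>0 * M1 * a) * \<delta>"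
        by (simp add: algebra_simps)
      also have "\<dots> \<le> (A2 * a powr (1 - s) + A3 * a) * \<delta>"
      proof -
        have "a * (a / 2) powr (- s) = 2 * (a / 2) powr (1 - s)"
          using a(1) powr_add[of "a / 2" 1 "- s"] by simp
        also have "\<dots> \<le> 2 * a powr (1 - s)"
          using a(1) s by (intro mult_left_mono powr_mono2) auto
        finally have "C1 * Q * (2 * (a * (a / 2) powr (- s))) \<le> C1 * Q * (2 * (2 * a powr (1 - s)))"
          using C1 Q(1) by (intro mult_left_mono) auto
        then show ?thesis
          using \<delta>(1) True by (intro mult_right_mono) (auto simp: A2_def A3_def)
      qed
      also have "\<dots> \<le> c * \<delta>" using a(3) \<delta>(1) by (intro mult_right_mono) auto
      finally show ?thesis using True \<delta>(1) by simp
    next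
      \<comment> \<open>Here the Hoelder bound is used, and p turns \<open>D powr (1 - s)\<close>
        into the power \<mu> of \<delta>.\<close>
      case False
      have p_eq: "p * (1 - s) = \<mu>" using False s by (simp add: p_def)
      define D where "D = Y \<beta> - Y \<alpha>"
      have D: "0 < D" "D \<le> 2 * a * \<delta> powr p" using Ypos \<open>Y \<beta> - Y \<alpha> \<le> _\<close> by (auto simp: D_def \<delta>_def)
      have D1: "D powr (1 - s) \<le> 2 * (a powr (1 - s) * \<delta> powr \<mu>)"
      proof -
        have "D powr (1 - s) \<le> (2 * (a * \<delta> powr p)) powr (1 - s)"
          using D s by (intro powr_mono2) auto
        also have "\<dots> = 2 powr (1 - s) * (a powr (1 - s) * \<delta> powr \<mu>)"
          by (simp only: powr_mult powr_powr p_eq)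
        also have "\<dots> \<le> 2 * (a powr (1 - s) * \<delta> powr \<mu>)"
          using s powr_mono[of "1 - s" 1 2] by (intro mult_right_mono) auto
        finally show ?thesis .
      qed
      \<comment> \<open>The linear part of the Hoelder bound has the higher power p of \<delta>; the
        excess p - \<mu> is absorbed by the diameter bound 2 Rb.\<close>
      have D2: "D \<le> 2 * a * ((2 * Rb) powr (p - \<mu>) * \<delta> powr \<mu>)"
      proof -
        have "\<delta> powr p = \<delta> powr (p - \<mu>) * \<delta> powr \<mu>" using \<delta>(1) powr_add[of \<delta> "p - \<mu>" \<mu>] by simp
        also have "\<dots> \<le> (2 * Rb) powr (p - \<mu>) * \<delta> powr \<mu>"
          using \<delta> p by (intro mult_right_mono powr_mono2) auto
        finally have "2 * a * \<delta> powr p \<le> 2 * a * ((2 * Rb) powr (p - \<mu>) * \<delta> powr \<mu>)"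
          using a(1) by (intro mult_left_mono) auto
        then show ?thesis using D(2) by linarith
      qed
      define H where "H = C1 * D powr (1 - s) + 4 * K\<^sub>0 * D"
      have "0 \<le> H" using C1 D K\<^sub>0_pos by (simp add: H_def)
      have "AF.F Y \<beta> - AF.F Y \<alpha> = (\<integral>\<gamma>. \<Phi> (Y \<beta> - Y \<gamma>) - \<Phi> (Y \<alpha> - Y \<gamma>) \<partial>mass)"
        unfolding AF.F_def by (rule Bochner_Integration.integral_diff[symmetric]) (intro AF.\<Phi>_integrable Y)+
      also have "\<dots> \<le> (\<integral>\<gamma>. H \<partial>mass)"
      proof (rule integral_mono)
        show "integrable mass (\<lambda>\<gamma>. \<Phi> (Y \<beta> - Y \<gamma>) - \<Phi> (Y \<alpha> - Y \<gamma>))"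
          by (intro Bochner_Integration.integrable_diff AF.\<Phi>_integrable Y)
        show "integrable mass (\<lambda>\<gamma>. H)" by (rule finite_measure.integrable_const[OF finite_mass])
        show "\<Phi> (Y \<beta> - Y \<gamma>) - \<Phi> (Y \<alpha> - Y \<gamma>) \<le> H" for \<gamma>
          using primitive_holder[of D "Y \<alpha> - Y \<gamma>"] D(1) by (simp add: H_def C1_def D_def)
      qed
      also have "\<dots> = H * measure mass UNIV" by (simp add: mass_def mult.commute)
      also have "\<dots> \<le> H * M1" using \<open>0 \<le> H\<close> by (intro mult_left_mono) (auto simp: M1_def)
      also have "\<dots> \<le> (C1 * (2 * (a powr (1 - s) * \<delta> powr \<mu>)) +
          4 * K\<^sub>0 * (2 * a * ((2 * Rb) powr (p - \<mu>) * \<delta> powr \<mu>))) * M1"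
        unfolding H_def using D1 D2 C1 K\<^sub>0_pos M1 by (intro mult_right_mono add_mono mult_left_mono) auto
      also have "\<dots> = (A2 * a powr (1 - s) + A3 * a) * \<delta> powr \<mu>"
        using False by (simp add: A2_def A3_def algebra_simps)
      also have "\<dots> \<le> c * \<delta> powr \<mu>" using a(3) by (intro mult_right_mono) auto
      finally show ?thesis .
    qed
    also have "\<dots> \<le> \<psi> \<beta> - \<psi> \<alpha>" using growth[OF ab(1,2)] ab(3) by (simp add: \<delta>_def)
    finally show ?thesis .
  qed
  interpret LS: lagrangian_system \<Omega> mass \<Phi> envelope "\<lambda>d. a * d powr p"
    "C1 * (a / 2) powr (- s) * Q + 4 * K\<^sub>0 * M1" Rb \<psi> Pb
  proof (unfold_locales, goal_cases)
    case (1 Y \<alpha> \<beta>)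
    then show ?case by (rule invariant)
  next
    case (2 \<alpha> \<beta>)
    define \<delta> where "\<delta> = \<beta> - \<alpha>"
    have \<delta>: "0 < \<delta>" "\<delta> \<le> 2 * Rb"
      using 2 \<Omega>_le[OF 2(1)] \<Omega>_le[OF 2(2)] by (auto simp: \<delta>_def abs_le_iff)
    have "\<delta> powr p = \<delta> powr (p - 1) * \<delta>" using \<delta>(1) powr_add[of \<delta> "p - 1" 1] by simp
    also have "\<dots> \<le> (2 * Rb) powr (p - 1) * \<delta>" using \<delta> p by (intro mult_right_mono powr_mono2) auto
    finally have "a * \<delta> powr p \<le> (a * (2 * Rb) powr (p - 1)) * \<delta>" using a(1) by (simp add: mult.assoc mult_left_mono)
    also have "\<dots> \<le> 1 * \<delta>" using a(2) \<delta>(1) by (intro mult_right_mono) auto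
    finally show ?case by (simp add: \<delta>_def)
  next
    case (3 \<alpha> \<beta>)
    have "0 \<le> c * (\<beta> - \<alpha>) powr \<mu>" using c by simp
    then show ?case using growth[OF 3] by linarith
  next
    case (4 \<alpha>)
    then show ?case by (rule bdd)
  qed
  obtain X where X: "LS.admissible X" "\<And>\<alpha>. \<alpha> \<in> \<Omega> \<Longrightarrow> X \<alpha> 0 = \<alpha>"
    "\<And>\<alpha> t. \<alpha> \<in> \<Omega> \<Longrightarrow> 0 \<le> t \<Longrightarrow>
       (X \<alpha> has_real_derivative \<psi> \<alpha> - AF.F (\<lambda>\<gamma>. X \<gamma> t) \<alpha>) (at t within {0..})"
    by (rule LS.global_flow_exists) blast
  interpret EF: eulerian_flow \<Omega> mass \<Phi> envelope "\<lambda>d. a * d powr p"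
    "C1 * (a / 2) powr (- s) * Q + 4 * K\<^sub>0 * M1" Rb \<psi> Pb \<phi> "deriv \<psi>" X \<rho>\<^sub>0
  proof (unfold_locales, goal_cases)
    case (3 \<alpha> t)
    then show ?case by (rule X(3))
  next
    case (9 \<alpha>)
    then show ?case using diff by (simp add: DERIV_deriv_iff_real_differentiable)
  qed (use X(1,2) borel_measurable_kernel countable_discontinuities has_real_derivative_primitive kernel_nonneg
      kernel_le_envelope mass_def \<rho>\<^sub>0_measurable \<rho>\<^sub>0_pos \<rho>\<^sub>0_off in auto)
  show ?thesis using EF.global_solution_flow[OF refl init] by blast
qed

end

section \<open>Initial data on a finite union of intervals\<close>

text \<open>Provides the lower bound of the derivatives that the real \<open>INF\<close> in the
  first growth assumption requires: without one its value would be unspecified.\<close>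

lemma mono_imp_deriv_nonneg:
  fixes f :: "real \<Rightarrow> real"
  assumes "(f has_real_derivative D) (at x)" "open S" "x \<in> S"
    and mono: "\<And>y. y \<in> S \<Longrightarrow> x \<le> y \<Longrightarrow> f x \<le> f y"
  shows "0 \<le> D"
proof (rule ccontr)
  assume "\<not> 0 \<le> D"
  then obtain d where d: "0 < d" "\<And>h. 0 < h \<Longrightarrow> h < d \<Longrightarrow> f (x + h) < f x"
    using DERIV_neg_dec_right[OF assms(1)] by auto
  obtain r where r: "0 < r" "ball x r \<subseteq> S" using assms(2,3) open_contains_ball by blast
  define h where "h = min d r / 2"
  have "0 < h" "h < d" "h < r" using d(1) r(1) by (auto simp: h_def min_def)
  then have "x + h \<in> S" using r(2) by (auto simp: dist_real_def subset_iff)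
  then show False using mono[of "x + h"] d(2)[of h] \<open>0 < h\<close> \<open>h < d\<close> by simp
qed

text \<open>The mean value theorem needs both labels in one component of \<Omega>; below the
  smallest gap this is automatic.\<close>

lemma separated_intervals_gap:
  fixes l r :: "nat \<Rightarrow> real" and J :: nat
  assumes lr: "\<And>j. j \<le> J \<Longrightarrow> l j < r j" and rl: "\<And>j. j \<in> {1..J} \<Longrightarrow> r (j - 1) < l j"
  shows "\<exists>d>0. \<forall>\<alpha> \<beta> i j. i \<le> J \<longrightarrow> j \<le> J \<longrightarrow> \<alpha> \<in> {l i<..<r i} \<longrightarrow> \<beta> \<in> {l j<..<r j} \<longrightarrow>
     \<alpha> \<le> \<beta> \<longrightarrow> \<beta> - \<alpha> < d \<longrightarrow> i = j"
proof -
  \<comment> \<open>The element 1 covers J = 0, where there are no gaps.\<close>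
  define d where "d = Min (insert 1 ((\<lambda>j. l j - r (j - 1)) ` {1..J}))"
  have "0 < d" using rl by (auto simp: d_def)
  have gap: "d \<le> l (Suc i) - r i" if "Suc i \<le> J" for i
    unfolding d_def using that by (intro Min_le) (auto intro!: rev_image_eqI[of "Suc i"])
  have mono: "l i \<le> l j" if "i \<le> j" "j \<le> J" for i j
    using that
  proof (induction j rule: dec_induct)
    case (step n)
    then show ?case using lr[of n] rl[of "Suc n"] by simp
  qed simp
  have "i = j" if ij: "i \<le> J" "j \<le> J" and \<alpha>: "\<alpha> \<in> {l i<..<r i}" and \<beta>: "\<beta> \<in> {l j<..<r j}"
    and ab: "\<alpha> \<le> \<beta>" "\<beta> - \<alpha> < d" for \<alpha> \<beta> i j
  proof (rule ccontr)
    assume "i \<noteq> j"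
    then consider "i < j" | "j < i" by linarith
    then show False
    proof cases
      case 1
      then have "l (Suc i) \<le> l j" "d \<le> l (Suc i) - r i" using mono[of "Suc i" j] gap[of i] ij by auto
      then show False using \<alpha> \<beta> ab by simp
    next
      case 2
      then have "l (Suc j) \<le> l i" "r j < l (Suc j)" using mono[of "Suc j" i] rl[of "Suc j"] ij by auto
      then show False using \<alpha> \<beta> ab by simp
    qed
  qed
  then show ?thesis using \<open>0 < d\<close> by blast
qed

lemma square_integrable_imp_integrable:
  assumes "square_integrable_on S h" "bounded S" "open S"
  shows "set_integrable lebesgue S h"
  unfolding set_integrable_def
proof (rule Bochner_Integration.integrable_bound)
  have "S \<in> lmeasurable" using assms(2,3) by (simp add: bounded_set_imp_lmeasurable)
  then have "integrable lebesgue (\<lambda>x. indicator S x :: real)"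
    by (intro integrable_real_indicator) (auto simp: fmeasurable_def less_top)
  moreover have "integrable lebesgue (\<lambda>x. indicator S x *\<^sub>R (h x)\<^sup>2)"
    using assms(1) by (simp add: square_integrable_on_def set_integrable_def)
  ultimately show "integrable lebesgue (\<lambda>x. indicator S x + indicator S x *\<^sub>R (h x)\<^sup>2)"
    by (rule Bochner_Integration.integrable_add)
  show "(\<lambda>x. indicator S x *\<^sub>R h x) \<in> borel_measurable lebesgue"
    using assms(1) by (simp add: square_integrable_on_def set_borel_measurable_def)
  have "\<bar>y\<bar> \<le> 1 + y\<^sup>2" for y :: real
    using sum_squares_bound[of 1 "\<bar>y\<bar>"] by (simp add: power2_eq_square)
  then show "AE x in lebesgue. norm (indicator S x *\<^sub>R h x) \<le> norm (indicator S x + indicator S x *\<^sub>R (h x)\<^sup>2)"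
    by (intro AE_I2) (auto simp: indicator_def)
qed

text \<open>\<open>sobolev_H\<close> does not see null sets, so continuity of
  \<open>\<rho>\<^sub>0\<close> selects the representative for which pointwise positivity is meant.
  \<open>\<psi>_bar\<close> is the continuous extension of \<open>\<psi>\<^sub>0\<close> to the
  closure of \<Omega>.\<close>

theorem theorem5p4:
  fixes \<phi> \<rho>\<^sub>0 u\<^sub>0 \<psi>\<^sub>0 \<psi>_bar :: "real \<Rightarrow> real"
    and s \<Lambda> R\<^sub>0 :: real
    and l r :: "nat \<Rightarrow> real" and J k :: nat
    and \<Omega> :: "real set"
  assumes "nonnegative_kernel \<phi>" and "radially_decreasing \<phi>" and "weakly_singular \<phi>"
    and "0 < s" and "s < 1" and "0 < \<Lambda>" and "0 < R\<^sub>0"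
    and "\<And>x. 0 < \<bar>x\<bar> \<Longrightarrow> \<bar>x\<bar> < R\<^sub>0 \<Longrightarrow> \<phi> x \<le> \<Lambda> * \<bar>x\<bar> powr (- s)"
    and "\<And>j. j \<le> J \<Longrightarrow> l j < r j"
    and "\<And>j. j \<in> {1..J} \<Longrightarrow> r (j - 1) < l j"
    and "\<Omega> = (\<Union>j\<in>{0..J}. {l j<..<r j})"
    and "1 \<le> k"
    and "sobolev_H k UNIV \<rho>\<^sub>0" and "continuous_on UNIV \<rho>\<^sub>0"
    and "\<And>x. x \<in> \<Omega> \<Longrightarrow> 0 < \<rho>\<^sub>0 x" and "\<And>x. x \<notin> \<Omega> \<Longrightarrow> \<rho>\<^sub>0 x = 0"
    and "\<psi>\<^sub>0 = psi_init \<phi> \<Omega> \<rho>\<^sub>0 u\<^sub>0"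
    and "sobolev_H (k + 1) \<Omega> \<psi>\<^sub>0"
    and "continuous_on (closure \<Omega>) \<psi>_bar" and "\<And>x. x \<in> \<Omega> \<Longrightarrow> \<psi>_bar x = \<psi>\<^sub>0 x"
    and "strict_mono_on (closure \<Omega>) \<psi>_bar"
    and "0 < (INF \<alpha>\<in>\<Omega>. deriv \<psi>\<^sub>0 \<alpha>) \<or>
         (s < 1 / 2 \<and>
          (\<exists>\<mu> c R\<^sub>1. 1 < \<mu> \<and> \<mu> < (1 - s) / s \<and> 0 < c \<and> 0 < R\<^sub>1 \<and> R\<^sub>1 < R\<^sub>0 \<and>
             (\<forall>\<alpha>\<in>\<Omega>. \<forall>\<beta>\<in>\<Omega>. 0 \<le> \<beta> - \<alpha> \<and> \<beta> - \<alpha> < R\<^sub>1 \<longrightarrow>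
                c * (\<beta> - \<alpha>) powr \<mu> \<le> \<psi>\<^sub>0 \<beta> - \<psi>\<^sub>0 \<alpha>)))"
  shows "\<exists>\<rho> u. global_solution \<phi> \<Omega> \<rho>\<^sub>0 u\<^sub>0 \<rho> u"
proof -
  note \<phi> = assms(1-3) and sL = assms(4-7) and upper = assms(8) and lr = assms(9) and rl = assms(10)
    and \<Omega> = assms(11) and \<rho>\<^sub>0 = assms(14-16) and init = assms(17) and sob = assms(18) and bar = assms(19-21)
    and growth = assms(22)
  have open_\<Omega>: "open \<Omega>" unfolding \<Omega> by auto
  have bdd_\<Omega>: "bounded \<Omega>" unfolding \<Omega> by auto
  obtain Rb where Rb: "0 < Rb" "\<forall>x\<in>\<Omega>. norm x \<le> Rb" using bdd_\<Omega> unfolding bounded_pos by blast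
  interpret alignment_data \<phi> s \<Lambda> R\<^sub>0 \<Omega> \<rho>\<^sub>0 Rb
    by unfold_locales (use \<phi> sL upper open_\<Omega> Rb \<rho>\<^sub>0 in auto)
  have sub: "\<Omega> \<subseteq> closure \<Omega>" by (rule closure_subset)
  have cont: "continuous_on \<Omega> \<psi>\<^sub>0"
    using continuous_on_subset[OF bar(1) sub] continuous_on_cong[OF refl bar(2), of \<Omega> "\<lambda>x. x"] by simp
  have mono: "\<psi>\<^sub>0 \<alpha> \<le> \<psi>\<^sub>0 \<beta>" if "\<alpha> \<in> \<Omega>" "\<beta> \<in> \<Omega>" "\<alpha> \<le> \<beta>" for \<alpha> \<beta>
    using strict_mono_onD[OF bar(3), of \<alpha> \<beta>] sub that bar(2) by (cases "\<alpha> = \<beta>") force+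
  obtain Pb where Pb: "\<And>\<alpha>. \<alpha> \<in> \<Omega> \<Longrightarrow> \<bar>\<psi>\<^sub>0 \<alpha>\<bar> \<le> Pb"
  proof -
    have "bounded (\<psi>_bar ` closure \<Omega>)"
      using bdd_\<Omega> by (intro compact_imp_bounded compact_continuous_image bar(1)) simp
    then obtain P where P: "\<forall>y\<in>\<psi>_bar ` closure \<Omega>. norm y \<le> P" unfolding bounded_iff by blast
    have "\<bar>\<psi>\<^sub>0 \<alpha>\<bar> \<le> P" if "\<alpha> \<in> \<Omega>" for \<alpha>
      using P sub that bar(2)[OF that] by force
    then show thesis by (rule that)
  qed
  have diff: "\<psi>\<^sub>0 differentiable (at \<alpha>)" if "\<alpha> \<in> \<Omega>" for \<alpha>
  proof -
    have "2 \<in> {1..k + 1}" using assms(12) by simp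
    then obtain h where h: "square_integrable_on \<Omega> h" "weak_derivative 2 \<Omega> \<psi>\<^sub>0 h"
      using sob unfolding sobolev_H_def by blast
    show ?thesis
      by (rule weak_second_derivative_imp_differentiable[OF open_\<Omega> bdd_\<Omega> cont h(2)
            square_integrable_imp_integrable[OF h(1) bdd_\<Omega> open_\<Omega>] that])
  qed
  have deriv: "(\<psi>\<^sub>0 has_real_derivative deriv \<psi>\<^sub>0 \<alpha>) (at \<alpha>)" if "\<alpha> \<in> \<Omega>" for \<alpha>
    using diff[OF that] by (simp add: DERIV_deriv_iff_real_differentiable)
  \<comment> \<open>Both assumptions become local power growth: the first with \<mu> = 1, by the
    mean value theorem below the smallest gap of \<Omega>.\<close>
  obtain \<mu> c R where \<mu>: "1 \<le> \<mu>" "\<mu> = 1 \<or> \<mu> < (1 - s) / s" and c: "0 < c" and R: "0 < R"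
    and loc: "\<And>\<alpha> \<beta>. \<alpha> \<in> \<Omega> \<Longrightarrow> \<beta> \<in> \<Omega> \<Longrightarrow> 0 \<le> \<beta> - \<alpha> \<Longrightarrow> \<beta> - \<alpha> < R \<Longrightarrow> c * (\<beta> - \<alpha>) powr \<mu> \<le> \<psi>\<^sub>0 \<beta> - \<psi>\<^sub>0 \<alpha>"
    using growth
  proof
    assume pos: "0 < (INF \<alpha>\<in>\<Omega>. deriv \<psi>\<^sub>0 \<alpha>)"
    have "bdd_below (deriv \<psi>\<^sub>0 ` \<Omega>)"
      using mono_imp_deriv_nonneg[OF deriv open_\<Omega>] mono by (intro bdd_belowI[of _ 0]) auto
    then have inf: "(INF \<alpha>\<in>\<Omega>. deriv \<psi>\<^sub>0 \<alpha>) \<le> deriv \<psi>\<^sub>0 \<alpha>" if "\<alpha> \<in> \<Omega>" for \<alpha>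
      using that by (rule cINF_lower)
    obtain d where d: "0 < d" "\<forall>\<alpha> \<beta> i j. i \<le> J \<longrightarrow> j \<le> J \<longrightarrow> \<alpha> \<in> {l i<..<r i} \<longrightarrow> \<beta> \<in> {l j<..<r j} \<longrightarrow>
        \<alpha> \<le> \<beta> \<longrightarrow> \<beta> - \<alpha> < d \<longrightarrow> i = j"
      using separated_intervals_gap[where l = l and r = r and J = J, OF lr rl] by blast
    show thesis
    proof (rule that[of 1 "INF \<alpha>\<in>\<Omega>. deriv \<psi>\<^sub>0 \<alpha>" d])
      fix \<alpha> \<beta> assume ab: "\<alpha> \<in> \<Omega>" "\<beta> \<in> \<Omega>" "0 \<le> \<beta> - \<alpha>" "\<beta> - \<alpha> < d"
      show "(INF \<alpha>\<in>\<Omega>. deriv \<psi>\<^sub>0 \<alpha>) * (\<beta> - \<alpha>) powr 1 \<le> \<psi>\<^sub>0 \<beta> - \<psi>\<^sub>0 \<alpha>"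
      proof (cases "\<alpha> = \<beta>")
        case False
        then have less: "\<alpha> < \<beta>" using ab(3) by simp
        obtain i j where ij: "i \<le> J" "j \<le> J" "\<alpha> \<in> {l i<..<r i}" "\<beta> \<in> {l j<..<r j}"
          using ab(1,2) unfolding \<Omega> by auto
        have "i = j" using d(2) ij ab(4) less by (meson less_imp_le)
        then have seg: "z \<in> \<Omega>" if "\<alpha> \<le> z" "z \<le> \<beta>" for z
          unfolding \<Omega> using ij that by (intro UN_I[of j]) auto
        obtain z where z: "\<alpha> < z" "z < \<beta>" "\<psi>\<^sub>0 \<beta> - \<psi>\<^sub>0 \<alpha> = (\<beta> - \<alpha>) * deriv \<psi>\<^sub>0 z"
          using MVT2[OF less, of \<psi>\<^sub>0 "deriv \<psi>\<^sub>0"] deriv seg by blast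
        have "(INF \<alpha>\<in>\<Omega>. deriv \<psi>\<^sub>0 \<alpha>) * (\<beta> - \<alpha>) \<le> deriv \<psi>\<^sub>0 z * (\<beta> - \<alpha>)"
          using inf[OF seg[of z]] z less by (intro mult_right_mono) auto
        then show ?thesis using z(3) less by (simp add: mult.commute)
      qed simp
    qed (use pos d in auto)
  next
    assume "s < 1 / 2 \<and> (\<exists>\<mu> c R\<^sub>1. 1 < \<mu> \<and> \<mu> < (1 - s) / s \<and> 0 < c \<and> 0 < R\<^sub>1 \<and> R\<^sub>1 < R\<^sub>0 \<and>
       (\<forall>\<alpha>\<in>\<Omega>. \<forall>\<beta>\<in>\<Omega>. 0 \<le> \<beta> - \<alpha> \<and> \<beta> - \<alpha> < R\<^sub>1 \<longrightarrow> c * (\<beta> - \<alpha>) powr \<mu> \<le> \<psi>\<^sub>0 \<beta> - \<psi>\<^sub>0 \<alpha>))"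
    then obtain \<mu> c R\<^sub>1 where *: "1 < \<mu>" "\<mu> < (1 - s) / s" "0 < c" "0 < R\<^sub>1"
      "\<forall>\<alpha>\<in>\<Omega>. \<forall>\<beta>\<in>\<Omega>. 0 \<le> \<beta> - \<alpha> \<and> \<beta> - \<alpha> < R\<^sub>1 \<longrightarrow> c * (\<beta> - \<alpha>) powr \<mu> \<le> \<psi>\<^sub>0 \<beta> - \<psi>\<^sub>0 \<alpha>"
      by blast
    show thesis by (rule that[of \<mu> c R\<^sub>1]) (use * in auto)
  qed
  have "0 \<le> \<mu>" using \<mu>(1) by simp
  obtain c' where c': "0 < c'"
    "\<forall>\<alpha>\<in>\<Omega>. \<forall>\<beta>\<in>\<Omega>. \<alpha> \<le> \<beta> \<longrightarrow> c' * (\<beta> - \<alpha>) powr \<mu> \<le> \<psi>\<^sub>0 \<beta> - \<psi>\<^sub>0 \<alpha>"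
    using powr_growth_global[OF bar(1,3) bdd_\<Omega> bar(2) c R \<open>0 \<le> \<mu>\<close> loc] by blast
  show ?thesis
    by (rule global_solution_exists[OF c'(1) \<mu> _ diff Pb]) (use c'(2) in \<open>simp_all add: init\<close>)
qed

end
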